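(* Suppose the material parameters $\varepsilon,\mu$ are element-wise constant (local $hp$-refinement in time is allowed, i.e. the temporal partition and the temporal polynomial degrees may depend on the spatial element). Let $(E_h,H_h)\in V_h\times V_h$ satisfy $$C_h((E_h,H_h),(v,w))+S_h((E_h,H_h),(v,w))=L((v,w))\qquad\text{for all }(v,w)\in W_h\times W_h.$$ Then $$\mathcal E(t_{n+1})-\mathcal E(t_n)=(J,\pi E_h)-\langle n\times g,\pi H_h\rangle_{\mathcal F_b}.$$
   Context: Setting: the discretization, on one time slab, of Maxwell's equations $\varepsilon E_t-\operatorname{curl}H=J$, $\mu H_t+\operatorname{curl}E=0$ in $\Omega\subset\mathbb R^3$, with boundary condition $n\times E=n\times g$ on $\partial\Omega$. Here $\varepsilon(x),\mu(x):\Omega\to\mathbb R$ are the (positive, time-independent) permittivity and permeability, and $J,g$ are given data regular enough for the integrals below to exist. Mesh: $I_n=(t_n,t_{n+1}]$. $\Omega$ is partitioned into finitely many non-overlapping hexahedral elements $K=F_K(\hat K)$, $\hat K=[0,1]^3$, where $F_K$ is a smooth invertible map with Jacobian matrix $DF_K$. For each $K$, $I_n$ is partitioned into subintervals $I_1^K,\dots,I_{N_K}^K$. Each space-time element $I_k^K\times K$ carries a temporal degree $p_t\ge1$ (which may depend on the element) and spatial degrees $p_x,p_y,p_z$, which may depend on $K$ but not on $k$. Spaces: $P_p(I)$ denotes polynomials of degree at most $p$ on $I$, and $Q_{p_x,p_y,p_z}(\hat K)$ tensor product polynomials of degrees $p_x,p_y,p_z$ in the three coordinates. Put $S_K(I_n)=\{u\in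 H^1(I_n):u|_{I_k^K}\in P_{p_t}(I_k^K)\ \forall k\}$ and $T_K(I_n)=\{u\in L_2(I_n):u|_{I_k^K}\in P_{p_t-1}(I_k^K)\ \forall k\}$. $V_h$ is the space of $v\in H^1(I_n;L_2(\Omega)^3)$ such that for each $K$, $DF_K^T\,(v|_K\circ F_K)\in S_K(I_n)\otimes[Q_{p_x,p_y,p_z}(\hat K)]^3$ (composition in the spatial variable). $W_h$ is the space of $v\in L_2(I_n;L_2(\Omega)^3)$ such that for each $K$, $DF_K^T\,(v|_K\circ F_K)\in T_K(I_n)\otimes[Q_{p_x,p_y,p_z}(\hat K)]^3$. Functions in both spaces may be discontinuous across spatial element interfaces. $\pi$ is the $L_2(I_n;L_2(\Omega)^3)$-orthogonal projection onto $W_h$. Faces and traces: $\mathcal F_0$ is the set of interior faces $f=\partial K^1\cap\partial K^2$, $\mathcal F_b$ the set of boundary faces $f=\partial K\cap\partial\Omega$. On an interior face, $\{v\}=(v^1+v^2)/2$ and $[v]_T=n^1\times v^1+n^2\times v^2$, where $v^i$ is the trace from $K^i$ and $n^i$ the outward unit normal of $K^i$. On a boundary face, $\{v\}=v$ and $[v]_T=n\times v$. Forms: $(a,b)=\int_{I_n}\int_\Omega a\cdot b\,dx\,dt$; $\langle a,b\rangle_{\mathcal G}=\int_{I_n}\sum_{f\in\mathcal G}\int_f a\cdot b\,dS\,dt$ for a set $\mathcal G$ of faces; $\operatorname{curl}_h$ is the element-wise curl in space. Then $$C_h((E_h,H_h),(v,w))=(\varepsilon\partial_tE_h,v)+(\mu\partial_tH_h,w)-(H_h,\operatorname{curl}_hv)+(\operatorname{curl}_hE_h,w)+\langle\{H_h\},[v]_T\rangle_{\mathcal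 F_0\cup\mathcal F_b}-\langle[E_h]_T,\{w\}\rangle_{\mathcal F_0\cup\mathcal F_b},$$ $$L((v,w))=(J,v)-\langle n\times g,w\rangle_{\mathcal F_b}.$$ Stabilization: for an interior face $f=\partial K^1\cap\partial K^2$ let $\tilde\pi_f:L_2(I_n)\to T_{K^1}(I_n)\cap T_{K^2}(I_n)$ be the $L_2$-orthogonal projection, and let $\tilde\pi$ act on traces over $I_n\times f$ (from either side, in the time variable, componentwise) as $\tilde\pi_f$. Then $$S_h((E_h,H_h),(v,w))=\tfrac12\Big(\langle\{H_h\},[\tilde\pi v-v]_T\rangle_{\mathcal F_0}+\langle[H_h]_T,\{\tilde\pi v-v\}\rangle_{\mathcal F_0}\Big)-\tfrac12\Big(\langle\{E_h\},[\tilde\pi w-w]_T\rangle_{\mathcal F_0}+\langle[E_h]_T,\{\tilde\pi w-w\}\rangle_{\mathcal F_0}\Big).$$ Energy: $\mathcal E(t)=\frac12\int_\Omega(\varepsilon E_h\cdot E_h+\mu H_h\cdot H_h)\,dx$ at time $t$ (value at $t_n$ understood as the limit from within the slab). *)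

theory Defs
  imports "HOL-Analysis.Analysis" "HOL-Computational_Algebra.Polynomial"
begin

section \<open>Function spaces\<close>

definition L2 :: "'a::euclidean_space set \<Rightarrow> ('a \<Rightarrow> 'b::euclidean_space) set" where
  "L2 S = {u. u \<in> borel_measurable (lebesgue_on S) \<and>
              integrable (lebesgue_on S) (\<lambda>x. (norm (u x))\<^sup>2)}"

text \<open>The space of continuously differentiable functions with compact support in \<open>(a,b)\<close>.\<close>

definition test_fun :: "real \<Rightarrow> real \<Rightarrow> (real \<Rightarrow> real) set" where
  "test_fun a b = {\<phi>. \<phi> C1_differentiable_on UNIV \<and> closure {t. \<phi> t \<noteq> 0} \<subseteq> {a<..<b}}"

definition weak_deriv_against ::
  "real \<Rightarrow> real \<Rightarrow> (real \<Rightarrow> real) \<Rightarrow> (real \<Rightarrow> 'b::euclidean_space) \<Rightarrow> (real \<Rightarrow> 'b) \<Rightarrow> bool" where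
  "weak_deriv_against a b \<phi> u u' \<longleftrightarrow>
     (LINT t|lebesgue_on {a<..b}. deriv \<phi> t *\<^sub>R u t) = - (LINT t|lebesgue_on {a<..b}. \<phi> t *\<^sub>R u' t)"

definition H1 :: "real \<Rightarrow> real \<Rightarrow> (real \<Rightarrow> 'b::euclidean_space) set" where
  "H1 a b = {u \<in> L2 {a<..b}. \<exists>u' \<in> L2 {a<..b}. \<forall>\<phi> \<in> test_fun a b. weak_deriv_against a b \<phi> u u'}"

text \<open>
  The Bochner spaces \<open>L\<^sub>2((a,b]; L\<^sub>2(\<Omega>)\<^sup>3)\<close> and \<open>H\<^sup>1((a,b]; L\<^sub>2(\<Omega>)\<^sup>3)\<close>. The former is identified
  with the square integrable fields on the cylinder; in the latter the identity defining the weak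
  time derivative is one between elements of \<open>L\<^sub>2(\<Omega>)\<^sup>3\<close>, hence one for almost every \<open>x\<close>.
\<close>

type_synonym field = "real \<Rightarrow> real^3 \<Rightarrow> real^3"

definition L2_L2 :: "real \<Rightarrow> real \<Rightarrow> (real^3) set \<Rightarrow> field set" where
  "L2_L2 a b \<Omega> = {v. (\<lambda>(t, x). v t x) \<in> L2 ({a<..b} \<times> \<Omega>)}"

definition H1_L2 :: "real \<Rightarrow> real \<Rightarrow> (real^3) set \<Rightarrow> field set" where
  "H1_L2 a b \<Omega> = {v \<in> L2_L2 a b \<Omega>. \<exists>v' \<in> L2_L2 a b \<Omega>. \<forall>\<phi> \<in> test_fun a b.
      AE x in lebesgue_on \<Omega>. weak_deriv_against a b \<phi> (\<lambda>t. v t x) (\<lambda>t. v' t x)}"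

definition poly_space :: "nat \<Rightarrow> real set \<Rightarrow> (real \<Rightarrow> real) set" where
  "poly_space p I = {u. \<exists>r. degree r \<le> p \<and> (\<forall>t\<in>I. u t = poly r t)}"

definition Q_space :: "(3 \<Rightarrow> nat) \<Rightarrow> (real^3 \<Rightarrow> real) set" where
  "Q_space p = {q. \<exists>c :: nat \<Rightarrow> nat \<Rightarrow> nat \<Rightarrow> real. \<forall>\<xi>.
      q \<xi> = (\<Sum>i\<le>p 1. \<Sum>j\<le>p 2. \<Sum>k\<le>p 3. c i j k * (\<xi>$1)^i * (\<xi>$2)^j * (\<xi>$3)^k)}"

definition Q3_space :: "(3 \<Rightarrow> nat) \<Rightarrow> (real^3 \<Rightarrow> real^3) set" where
  "Q3_space p = {q. \<forall>c. (\<lambda>\<xi>. q \<xi> $ c) \<in> Q_space p}"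

text \<open>The algebraic tensor product of \<open>A\<close> and \<open>B\<close>, as functions on \<open>I \<times> D\<close>.\<close>

definition tensor_space ::
  "real set \<Rightarrow> (real^3) set \<Rightarrow> (real \<Rightarrow> real) set \<Rightarrow> (real^3 \<Rightarrow> real^3) set \<Rightarrow> field set" where
  "tensor_space I D A B = {w. \<exists>(m::nat) a q. (\<forall>i<m. a i \<in> A \<and> q i \<in> B) \<and>
      (\<forall>t\<in>I. \<forall>\<xi>\<in>D. w t \<xi> = (\<Sum>i<m. a i t *\<^sub>R q i \<xi>))}"

text \<open>
  Orthogonal projection onto \<open>W\<close> with respect to the inner product \<open>ip\<close>. For function spaces the
  projection is determined only up to changes on null sets, hence the choice operator.
\<close>

definition orth_proj :: "('v::minus \<Rightarrow> 'v \<Rightarrow> real) \<Rightarrow> 'v set \<Rightarrow> 'v \<Rightarrow> 'v" where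
  "orth_proj ip W u = (SOME p. p \<in> W \<and> (\<forall>w\<in>W. ip (u - p) w = 0))"

section \<open>Space-time mesh on one slab\<close>

text \<open>
  Elements are numbered \<open>0, \<dots>, n_elem - 1\<close>, the temporal subintervals of element \<open>K\<close> are
  \<open>(node K k, node K (k + 1)]\<close> for \<open>k < n_sub K\<close>, and \<open>deg_x K d\<close> is the polynomial degree in the
  \<open>d\<close>-th reference coordinate.
\<close>

record slab_mesh =
  Omega :: "(real^3) set"
  t_start :: real
  t_end :: real
  n_elem :: nat
  el_map :: "nat \<Rightarrow> real^3 \<Rightarrow> real^3"
  n_sub :: "nat \<Rightarrow> nat"
  node :: "nat \<Rightarrow> nat \<Rightarrow> real"
  deg_t :: "nat \<Rightarrow> nat \<Rightarrow> nat"
  deg_x :: "nat \<Rightarrow> 3 \<Rightarrow> nat"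

definition slab :: "slab_mesh \<Rightarrow> real set" where
  "slab M = {t_start M<..t_end M}"

definition subint :: "slab_mesh \<Rightarrow> nat \<Rightarrow> nat \<Rightarrow> real set" where
  "subint M K k = {node M K k<..node M K (Suc k)}"

definition elem :: "slab_mesh \<Rightarrow> nat \<Rightarrow> (real^3) set" where
  "elem M K = el_map M K ` cbox 0 1"

primrec Ck_on :: "nat \<Rightarrow> 'a::real_normed_vector set \<Rightarrow> ('a \<Rightarrow> 'b::real_normed_vector) \<Rightarrow> bool" where
  "Ck_on 0 U f \<longleftrightarrow> continuous_on U f"
| "Ck_on (Suc k) U f \<longleftrightarrow> (\<forall>x\<in>U. f differentiable (at x)) \<and>
     (\<forall>h. Ck_on k U (\<lambda>x. frechet_derivative f (at x) h))"

text \<open>Smooth up to the boundary of the reference cube, with a smooth inverse.\<close>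

definition smooth_invertible :: "(real^3 \<Rightarrow> real^3) \<Rightarrow> bool" where
  "smooth_invertible F \<longleftrightarrow>
     (\<exists>U. open U \<and> cbox 0 1 \<subseteq> U \<and> (\<forall>k. Ck_on k U F)) \<and>
     inj_on F (cbox 0 1) \<and> (\<forall>\<xi>\<in>cbox 0 1. det (jacobian F (at \<xi>)) \<noteq> 0)"

definition valid_mesh :: "slab_mesh \<Rightarrow> bool" where
  "valid_mesh M \<longleftrightarrow>
     open (Omega M) \<and>
     (\<forall>K<n_elem M. smooth_invertible (el_map M K)) \<and>
     closure (Omega M) = (\<Union>K<n_elem M. elem M K) \<and>
     (\<forall>K<n_elem M. interior (elem M K) \<subseteq> Omega M) \<and>
     (\<forall>K<n_elem M. \<forall>K'<n_elem M. K \<noteq> K' \<longrightarrow> interior (elem M K) \<inter> interior (elem M K') = {}) \<and>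
     t_start M < t_end M \<and>
     (\<forall>K<n_elem M. node M K 0 = t_start M \<and> node M K (n_sub M K) = t_end M \<and>
        (\<forall>k<n_sub M K. node M K k < node M K (Suc k) \<and> 1 \<le> deg_t M K k))"

section \<open>Discrete spaces\<close>

definition S_time :: "slab_mesh \<Rightarrow> nat \<Rightarrow> (real \<Rightarrow> real) set" where
  "S_time M K = {u \<in> H1 (t_start M) (t_end M).
     \<forall>k<n_sub M K. u \<in> poly_space (deg_t M K k) (subint M K k)}"

definition T_time :: "slab_mesh \<Rightarrow> nat \<Rightarrow> (real \<Rightarrow> real) set" where
  "T_time M K = {u \<in> L2 (slab M).
     \<forall>k<n_sub M K. u \<in> poly_space (deg_t M K k - 1) (subint M K k)}"

definition pull_back :: "slab_mesh \<Rightarrow> nat \<Rightarrow> field \<Rightarrow> field" where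
  "pull_back M K v = (\<lambda>t \<xi>. transpose (jacobian (el_map M K) (at \<xi>)) *v v t (el_map M K \<xi>))"

text \<open>
  A member of \<open>V\<^sub>h\<close> or \<open>W\<^sub>h\<close> is given by the representative of its \<open>L\<^sub>2\<close> class that has the prescribed
  form at every time of the slab and at every point of every open element. Its values on the mesh
  skeleton, a null set, are irrelevant.
\<close>

definition V_h :: "slab_mesh \<Rightarrow> field set" where
  "V_h M = {v \<in> H1_L2 (t_start M) (t_end M) (Omega M). \<forall>K<n_elem M.
     pull_back M K v \<in> tensor_space (slab M) (box 0 1) (S_time M K) (Q3_space (deg_x M K))}"

definition W_h :: "slab_mesh \<Rightarrow> field set" where
  "W_h M = {v \<in> L2_L2 (t_start M) (t_end M) (Omega M). \<forall>K<n_elem M.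
     pull_back M K v \<in> tensor_space (slab M) (box 0 1) (T_time M K) (Q3_space (deg_x M K))}"

definition ip :: "slab_mesh \<Rightarrow> field \<Rightarrow> field \<Rightarrow> real" where
  "ip M a b = (LINT t|lebesgue_on (slab M). LINT x|lebesgue_on (Omega M). a t x \<bullet> b t x)"

definition proj_W :: "slab_mesh \<Rightarrow> field \<Rightarrow> field" where
  "proj_W M = orth_proj (ip M) (W_h M)"

section \<open>Faces, traces and surface integrals\<close>

text \<open>
  \<open>Interior K1 K2\<close> stands for \<open>\<partial>K1 \<inter> \<partial>K2\<close> and \<open>Boundary K\<close> for \<open>\<partial>K \<inter> \<partial>\<Omega>\<close>. Pairs of elements (or
  elements) for which this set has no area contribute nothing to the face integrals.
\<close>

datatype face = Interior nat nat | Boundary nat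

fun face_set :: "slab_mesh \<Rightarrow> face \<Rightarrow> (real^3) set" where
  "face_set M (Interior K1 K2) = frontier (elem M K1) \<inter> frontier (elem M K2)"
| "face_set M (Boundary K) = frontier (elem M K) \<inter> frontier (Omega M)"

definition F0 :: "slab_mesh \<Rightarrow> face set" where
  "F0 M = {Interior K1 K2 | K1 K2. K1 < K2 \<and> K2 < n_elem M}"

definition Fb :: "slab_mesh \<Rightarrow> face set" where
  "Fb M = {Boundary K | K. K < n_elem M}"

fun sides :: "face \<Rightarrow> nat set" where
  "sides (Interior K1 K2) = {K1, K2}"
| "sides (Boundary K) = {K}"

text \<open>The outward unit normal of the reference cube, away from its edges.\<close>

definition ref_normal :: "real^3 \<Rightarrow> real^3" where
  "ref_normal \<xi> = (\<chi> d. if \<xi> $ d = 0 then -1 else if \<xi> $ d = 1 then 1 else 0)"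

text \<open>
  The outward unit normal of the element \<open>F(K\<^sub>0)\<close>, where \<open>K\<^sub>0\<close> is the reference cube, at \<open>F(\<xi>)\<close> is
  the normalisation of \<open>DF(\<xi>)\<^sup>-\<^sup>T n\<^sub>0(\<xi>)\<close>; this vector is orthogonal to the tangent plane and its
  inner product with the outward vector \<open>DF(\<xi>) n\<^sub>0(\<xi>)\<close> is \<open>1\<close>.
\<close>

definition normal :: "slab_mesh \<Rightarrow> nat \<Rightarrow> real^3 \<Rightarrow> real^3" where
  "normal M K x = (let \<xi> = inv_into (cbox 0 1) (el_map M K) x in
     sgn (matrix_inv (transpose (jacobian (el_map M K) (at \<xi>))) *v ref_normal \<xi>))"

text \<open>Charts of the six faces of an element: \<open>d\<close> is the frozen coordinate and \<open>s \<in> {0, 1}\<close> its value.\<close>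

definition ref_chart :: "3 \<Rightarrow> real \<Rightarrow> real^2 \<Rightarrow> real^3" where
  "ref_chart d s \<eta> =
     (if d = 1 then vector [s, \<eta>$1, \<eta>$2]
      else if d = 2 then vector [\<eta>$1, s, \<eta>$2]
      else vector [\<eta>$1, \<eta>$2, s])"

definition chart :: "slab_mesh \<Rightarrow> nat \<Rightarrow> 3 \<Rightarrow> real \<Rightarrow> real^2 \<Rightarrow> real^3" where
  "chart M K d s = el_map M K \<circ> ref_chart d s"

definition area_element :: "(real^2 \<Rightarrow> real^3) \<Rightarrow> real^2 \<Rightarrow> real" where
  "area_element \<Phi> \<eta> =
     norm (cross3 (frechet_derivative \<Phi> (at \<eta>) (axis 1 1)) (frechet_derivative \<Phi> (at \<eta>) (axis 2 1)))"

definition chart_dom :: "slab_mesh \<Rightarrow> nat \<Rightarrow> (real^3) set \<Rightarrow> 3 \<Rightarrow> real \<Rightarrow> (real^2) set" where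
  "chart_dom M K f d s = {\<eta> \<in> cbox 0 1. chart M K d s \<eta> \<in> f}"

definition surface_integral :: "slab_mesh \<Rightarrow> nat \<Rightarrow> (real^3) set \<Rightarrow> (real^3 \<Rightarrow> real) \<Rightarrow> real" where
  "surface_integral M K f \<phi> = (\<Sum>d\<in>UNIV. \<Sum>s\<in>{0,1}.
     (LINT \<eta>|lebesgue_on (chart_dom M K f d s).
        \<phi> (chart M K d s \<eta>) * area_element (chart M K d s) \<eta>))"

text \<open>
  The surface integral does not depend on the parametrisation, so on an interior face the one
  inherited from the first of the two elements is used.
\<close>

fun face_integral :: "slab_mesh \<Rightarrow> face \<Rightarrow> (real^3 \<Rightarrow> real) \<Rightarrow> real" where
  "face_integral M (Interior K1 K2) \<phi> = surface_integral M K1 (face_set M (Interior K1 K2)) \<phi>"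
| "face_integral M (Boundary K) \<phi> = surface_integral M K (face_set M (Boundary K)) \<phi>"

text \<open>
  Traces are indexed by the element from which they are taken. Averages and jumps act on any such
  family, so that they also apply to traces projected in time.
\<close>

type_synonym side_field = "nat \<Rightarrow> field"

definition tr :: "slab_mesh \<Rightarrow> field \<Rightarrow> side_field" where
  "tr M v K t x = Lim (at x within interior (elem M K)) (v t)"

fun avg :: "side_field \<Rightarrow> face \<Rightarrow> field" where
  "avg a (Interior K1 K2) = (\<lambda>t x. (1/2) *\<^sub>R (a K1 t x + a K2 t x))"
| "avg a (Boundary K) = a K"

fun tjump :: "slab_mesh \<Rightarrow> side_field \<Rightarrow> face \<Rightarrow> field" where
  "tjump M a (Interior K1 K2) = (\<lambda>t x. cross3 (normal M K1 x) (a K1 t x) + cross3 (normal M K2 x) (a K2 t x))"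
| "tjump M a (Boundary K) = (\<lambda>t x. cross3 (normal M K x) (a K t x))"

definition face_ip :: "slab_mesh \<Rightarrow> face set \<Rightarrow> (face \<Rightarrow> field) \<Rightarrow> (face \<Rightarrow> field) \<Rightarrow> real" where
  "face_ip M G a b =
     (LINT t|lebesgue_on (slab M).
       (\<Sum>f\<in>G. face_integral M f (\<lambda>x. a f t x \<bullet> b f t x)))"

definition time_ip :: "slab_mesh \<Rightarrow> (real \<Rightarrow> real) \<Rightarrow> (real \<Rightarrow> real) \<Rightarrow> real" where
  "time_ip M a b = (LINT t|lebesgue_on (slab M). a t * b t)"

definition face_proj :: "slab_mesh \<Rightarrow> face \<Rightarrow> side_field \<Rightarrow> side_field" where
  "face_proj M f a K t x =
     (\<chi> c. orth_proj (time_ip M) (\<Inter>K'\<in>sides f. T_time M K') (\<lambda>s. a K s x $ c) t)"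

text \<open>The traces of \<open>P v - v\<close> on \<open>f\<close>, where \<open>P\<close> is the temporal projection belonging to \<open>f\<close>.\<close>

definition proj_defect :: "slab_mesh \<Rightarrow> field \<Rightarrow> face \<Rightarrow> side_field" where
  "proj_defect M v f = face_proj M f (tr M v) - tr M v"

section \<open>Forms and energy\<close>

text \<open>
  For members of \<open>V\<^sub>h\<close> the weak time derivative is the classical one outside finitely many times, and
  the element-wise curl is the classical one outside the mesh skeleton.
\<close>

definition time_deriv :: "field \<Rightarrow> field" where
  "time_deriv v t x = vector_derivative (\<lambda>s. v s x) (at t)"

definition curl_h :: "field \<Rightarrow> field" where
  "curl_h v t x = (let D = jacobian (v t) (at x) in
     vector [D$3$2 - D$2$3, D$1$3 - D$3$1, D$2$1 - D$1$2])"

definition C_h :: "slab_mesh \<Rightarrow> (real^3 \<Rightarrow> real) \<Rightarrow> (real^3 \<Rightarrow> real) \<Rightarrow>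
    field \<times> field \<Rightarrow> field \<times> field \<Rightarrow> real" where
  "C_h M \<epsilon> \<mu> = (\<lambda>(E, H) (v, w).
     ip M (\<lambda>t x. \<epsilon> x *\<^sub>R time_deriv E t x) v + ip M (\<lambda>t x. \<mu> x *\<^sub>R time_deriv H t x) w
     - ip M H (curl_h v) + ip M (curl_h E) w
     + face_ip M (F0 M \<union> Fb M) (avg (tr M H)) (tjump M (tr M v))
     - face_ip M (F0 M \<union> Fb M) (tjump M (tr M E)) (avg (tr M w)))"

definition S_h :: "slab_mesh \<Rightarrow> field \<times> field \<Rightarrow> field \<times> field \<Rightarrow> real" where
  "S_h M = (\<lambda>(E, H) (v, w).
     1/2 * (face_ip M (F0 M) (avg (tr M H)) (\<lambda>f. tjump M (proj_defect M v f) f)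
            + face_ip M (F0 M) (tjump M (tr M H)) (\<lambda>f. avg (proj_defect M v f) f))
     - 1/2 * (face_ip M (F0 M) (avg (tr M E)) (\<lambda>f. tjump M (proj_defect M w f) f)
            + face_ip M (F0 M) (tjump M (tr M E)) (\<lambda>f. avg (proj_defect M w f) f)))"

text \<open>The boundary datum \<open>g\<close> is given on the boundary of the domain and has no sides.\<close>

definition n_cross :: "slab_mesh \<Rightarrow> field \<Rightarrow> face \<Rightarrow> field" where
  "n_cross M g = tjump M (\<lambda>K. g)"

definition L_form :: "slab_mesh \<Rightarrow> field \<Rightarrow> field \<Rightarrow> field \<times> field \<Rightarrow> real" where
  "L_form M J g = (\<lambda>(v, w). ip M J v - face_ip M (Fb M) (n_cross M g) (avg (tr M w)))"

text \<open>The data are regular enough for all integrals in the right-hand side to exist.\<close>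

definition source_admissible :: "slab_mesh \<Rightarrow> field \<Rightarrow> bool" where
  "source_admissible M J \<longleftrightarrow> (\<forall>v\<in>W_h M.
     integrable (lebesgue_on (slab M \<times> Omega M)) (\<lambda>(t, x). J t x \<bullet> v t x))"

definition boundary_admissible :: "slab_mesh \<Rightarrow> field \<Rightarrow> bool" where
  "boundary_admissible M g \<longleftrightarrow> (\<forall>w\<in>W_h M. \<forall>K<n_elem M. \<forall>d. \<forall>s\<in>{0,1}.
     integrable (lebesgue_on (slab M \<times> chart_dom M K (face_set M (Boundary K)) d s))
       (\<lambda>(t, \<eta>). (let x = chart M K d s \<eta> in cross3 (normal M K x) (g t x) \<bullet> tr M w K t x)
                   * area_element (chart M K d s) \<eta>))"

definition elementwise_constant :: "slab_mesh \<Rightarrow> (real^3 \<Rightarrow> real) \<Rightarrow> bool" where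
  "elementwise_constant M a \<longleftrightarrow>
     (\<forall>K<n_elem M. \<exists>c. \<forall>x\<in>interior (elem M K). a x = c)"

definition energy_in :: "slab_mesh \<Rightarrow> (real^3 \<Rightarrow> real) \<Rightarrow> (real^3 \<Rightarrow> real) \<Rightarrow>
    field \<Rightarrow> field \<Rightarrow> real \<Rightarrow> real" where
  "energy_in M \<epsilon> \<mu> E H t = 1/2 *
     (LINT x|lebesgue_on (Omega M). \<epsilon> x * (E t x \<bullet> E t x) + \<mu> x * (H t x \<bullet> H t x))"

definition energy :: "slab_mesh \<Rightarrow> (real^3 \<Rightarrow> real) \<Rightarrow> (real^3 \<Rightarrow> real) \<Rightarrow>
    field \<Rightarrow> field \<Rightarrow> real \<Rightarrow> real" where
  "energy M \<epsilon> \<mu> E H t =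
     (if t = t_start M then Lim (at_right t) (energy_in M \<epsilon> \<mu> E H) else energy_in M \<epsilon> \<mu> E H t)"

end

theory Submission
  imports Defs
begin

text \<open>
  Test with \<open>v = \<pi>E\<^sub>h\<close> and \<open>w = \<pi>H\<^sub>h\<close>. On each element the spatial weight of the \<open>L\<^sub>2\<close> inner product
  does not depend on time, so \<open>\<pi>\<close> is the \<open>L\<^sub>2\<close> projection in time, applied for each point in space
  separately; in particular it commutes with the curl and with traces. Since \<open>\<epsilon> \<partial>\<^sub>tE\<^sub>h\<close> is in \<open>W\<^sub>h\<close>, the
  projection may be dropped in \<open>(\<epsilon> \<partial>\<^sub>tE\<^sub>h, \<pi>E\<^sub>h)\<close>, which leaves the energy difference. The curl terms
  cancel, both being equal to \<open>(\<pi>H\<^sub>h, curl \<pi>E\<^sub>h)\<close>, without any integration by parts, and so do the boundary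
  face terms. On an interior face the two normals are opposite almost everywhere; what remains of the
  volume form after moving the projections of each side is cancelled by the stabilization, because the
  temporal projection \<open>P\<close> of the face satisfies \<open>P \<pi> = P\<close> on both sides and is self-adjoint.
\<close>

section \<open>Bounded measurable functions and iterated integrals\<close>

text \<open>Two obstacles shape the proof. First, \<open>orth_proj\<close> picks a representative
  that orthogonality fixes only almost everywhere, while traces and curls are taken pointwise. So an
  explicit projection is built from the temporal factors of the field on each element; rigidity
  (polynomial in time, continuous in space) shows that the chosen one equals it at every time of the
  slab and at every point of the open elements. Secondly, integrals may be split and exchanged only
  for integrable functions. All integrands to be rearranged are built from finite sums of a bounded
  function of time times a bounded function of space, so boundedness and measurability on a product
  of finite measures suffice throughout. On an interior face the projections of the two sides
  differ, so self-adjointness cannot treat H from one side against pi E from the other. The triple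
  product is skew, hence each pair of stabilizing products reduces to exactly these mixed terms,
  with P - pi in place of pi; in the sum only P survives. Membership in \<open>H1\<close> enters
  through continuity at the temporal nodes, where the energy would otherwise pick up jumps.\<close>

lemma integral_lebesgue_on_spike:
  fixes f g :: "'a::euclidean_space \<Rightarrow> real"
  assumes N: "negligible N" and S: "S \<in> sets lebesgue" and eq: "\<And>x. x \<in> S - N \<Longrightarrow> f x = g x"
  shows "(LINT x|lebesgue_on S. f x) = (LINT x|lebesgue_on S. g x)"
    and "integrable (lebesgue_on S) f \<longleftrightarrow> integrable (lebesgue_on S) g"
proof -
  have null: "N \<inter> S \<in> null_sets (lebesgue_on S)"
    using N S by (metis inf_le2 negligible_iff_null_sets negligible_Int null_sets_restrict_space)
  \<comment> \<open>Lebesgue measure is complete, so measurability passes from one function to the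
    other. \<open>integral_cong_AE\<close> asks for it on both sides, and traces and normals are not
    controlled on the exceptional set.\<close>
  have meas: "f \<in> borel_measurable (lebesgue_on S) \<longleftrightarrow> g \<in> borel_measurable (lebesgue_on S)"
    unfolding borel_measurable_diff_null[OF null S, symmetric]
    using eq by (intro measurable_cong) auto
  have AE: "AE x in lebesgue_on S. f x = g x"
    using eq by (intro AE_I'[OF null]) auto
  show "integrable (lebesgue_on S) f \<longleftrightarrow> integrable (lebesgue_on S) g"
    using integrable_cong_AE[OF _ _ AE] meas borel_measurable_integrable by blast
  \<comment> \<open>If neither function is integrable, both integrals have the default value
    0.\<close>
  then show "(LINT x|lebesgue_on S. f x) = (LINT x|lebesgue_on S. g x)"
    using integral_cong_AE[OF _ _ AE] meas not_integrable_integral_eq borel_measurable_integrable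
    by metis
qed

lemma integral_lebesgue_on_spike_set:
  fixes f :: "'a::euclidean_space \<Rightarrow> real"
  assumes N: "negligible N" and "S \<in> sets lebesgue" "T \<in> sets lebesgue"
    and "S - N \<subseteq> T" "T \<subseteq> S"
  shows "(LINT x|lebesgue_on S. f x) = (LINT x|lebesgue_on T. f x)"
proof -
  have "(LINT x|lebesgue_on S. f x) = (LINT x|lebesgue_on S. (if x \<in> T then f x else 0))"
    using assms by (intro integral_lebesgue_on_spike(1)[OF N]) auto
  also have "\<dots> = (LINT x|lebesgue_on T. f x)"
    using assms by (subst integral_restrict) auto
  finally show ?thesis .
qed

text \<open>On a finite measure these functions are integrable and closed under products, which
  integrable functions are not. The bound holds everywhere, not just almost everywhere, so that it
  passes to every slice of a function of two variables.\<close>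

definition bdd_meas :: "'a measure \<Rightarrow> ('a \<Rightarrow> real) \<Rightarrow> bool" where
  "bdd_meas M f \<longleftrightarrow> f \<in> borel_measurable M \<and> (\<exists>C. \<forall>x\<in>space M. \<bar>f x\<bar> \<le> C)"

lemma bdd_meas_measurable: "bdd_meas M f \<Longrightarrow> f \<in> borel_measurable M"
  by (simp add: bdd_meas_def)

lemma bdd_meas_const: "bdd_meas M (\<lambda>x. c)"
  by (auto simp: bdd_meas_def)

lemma bdd_meas_add:
  assumes "bdd_meas M f" "bdd_meas M g" shows "bdd_meas M (\<lambda>x. f x + g x)"
proof -
  obtain C D where "\<forall>x\<in>space M. \<bar>f x\<bar> \<le> C" "\<forall>x\<in>space M. \<bar>g x\<bar> \<le> D"
    using assms by (auto simp: bdd_meas_def)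
  then have "\<forall>x\<in>space M. \<bar>f x + g x\<bar> \<le> C + D"
    by (meson abs_triangle_ineq add_mono order_trans)
  then show ?thesis
    using assms by (auto simp: bdd_meas_def)
qed

lemma bdd_meas_mult:
  assumes "bdd_meas M f" "bdd_meas M g" shows "bdd_meas M (\<lambda>x. f x * g x)"
proof -
  obtain C D where "\<forall>x\<in>space M. \<bar>f x\<bar> \<le> C" "\<forall>x\<in>space M. \<bar>g x\<bar> \<le> D"
    using assms by (auto simp: bdd_meas_def)
  then have "\<forall>x\<in>space M. \<bar>f x * g x\<bar> \<le> C * D"
    using order_trans[OF abs_ge_zero] unfolding abs_mult by (intro ballI mult_mono) blast+
  then show ?thesis
    using assms by (auto simp: bdd_meas_def)
qed

lemma bdd_meas_minus: "bdd_meas M f \<Longrightarrow> bdd_meas M (\<lambda>x. - f x)"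
  using bdd_meas_mult[OF bdd_meas_const[of M "-1"]] by fastforce

lemma bdd_meas_diff: "bdd_meas M f \<Longrightarrow> bdd_meas M g \<Longrightarrow> bdd_meas M (\<lambda>x. f x - g x)"
  using bdd_meas_add[OF _ bdd_meas_minus] by fastforce

lemma bdd_meas_sum: "(\<And>i. i \<in> I \<Longrightarrow> bdd_meas M (f i)) \<Longrightarrow> bdd_meas M (\<lambda>x. \<Sum>i\<in>I. f i x)"
  by (induction I rule: infinite_finite_induct) (simp_all add: bdd_meas_const bdd_meas_add)

lemmas bdd_meas_intros = bdd_meas_const bdd_meas_add bdd_meas_mult bdd_meas_minus bdd_meas_diff bdd_meas_sum

lemma bdd_meas_cong: "(\<And>x. x \<in> space M \<Longrightarrow> f x = g x) \<Longrightarrow> bdd_meas M f \<longleftrightarrow> bdd_meas M g"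
  unfolding bdd_meas_def by (metis measurable_cong)

lemma bdd_meas_integrable: "finite_measure M \<Longrightarrow> bdd_meas M f \<Longrightarrow> integrable M f"
  unfolding bdd_meas_def
  by (metis (mono_tags, lifting) AE_I2 finite_measure.integrable_const_bound real_norm_def)

lemma bdd_meas_fst: "bdd_meas M f \<Longrightarrow> bdd_meas (M \<Otimes>\<^sub>M N) (\<lambda>(t, x). f t)"
  unfolding bdd_meas_def by (auto simp: space_pair_measure)

lemma bdd_meas_snd: "bdd_meas N f \<Longrightarrow> bdd_meas (M \<Otimes>\<^sub>M N) (\<lambda>(t, x). f x)"
  unfolding bdd_meas_def by (auto simp: space_pair_measure)

lemma bdd_meas_slice: "bdd_meas (M \<Otimes>\<^sub>M N) (\<lambda>(t, x). f t x) \<Longrightarrow> t \<in> space M \<Longrightarrow> bdd_meas N (f t)"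
  unfolding bdd_meas_def by (auto simp: space_pair_measure measurable_Pair2)

lemma bdd_meas_slice2: "bdd_meas (M \<Otimes>\<^sub>M N) (\<lambda>(t, x). f t x) \<Longrightarrow> x \<in> space N \<Longrightarrow> bdd_meas M (\<lambda>t. f t x)"
  unfolding bdd_meas_def
  by (auto simp: space_pair_measure)

lemma bdd_meas_continuous_compact:
  fixes f :: "'a::euclidean_space \<Rightarrow> real"
  assumes "compact C" "continuous_on C f" "S \<subseteq> C" "S \<in> sets lebesgue"
  shows "bdd_meas (lebesgue_on S) f"
proof -
  have "bounded (f ` C)"
    using assms compact_continuous_image compact_imp_bounded by blast
  then obtain B where "\<forall>x\<in>C. \<bar>f x\<bar> \<le> B"
    by (auto simp: bounded_iff)
  moreover have "f \<in> borel_measurable (lebesgue_on S)"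
    using assms continuous_on_subset continuous_imp_measurable_on_sets_lebesgue by blast
  ultimately show ?thesis
    using assms by (auto simp: bdd_meas_def)
qed

lemma bdd_meas_finite_pair:
  assumes "finite_measure M" "finite_measure N" "bdd_meas (M \<Otimes>\<^sub>M N) (\<lambda>(t, x). f t x)"
  shows "integrable M (\<lambda>t. LINT x|N. f t x)"
    and "(LINT t|M. LINT x|N. f t x) = (LINT x|N. LINT t|M. f t x)"
proof -
  interpret M: finite_measure M by fact
  interpret N: finite_measure N by fact
  interpret pair_sigma_finite M N by unfold_locales
  have "finite_measure (M \<Otimes>\<^sub>M N)"
    using assms by (intro finite_measure_pair_measure)
  then have int: "integrable (M \<Otimes>\<^sub>M N) (case_prod f)"
    using assms bdd_meas_integrable by blast
  show "integrable M (\<lambda>t. LINT x|N. f t x)"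
    using integrable_fst[OF int] .
  show "(LINT t|M. LINT x|N. f t x) = (LINT x|N. LINT t|M. f t x)"
    using Fubini_integral[OF int] by simp
qed

section \<open>Orthogonal projections and the temporal spaces\<close>

text \<open>A relation instead of the value of \<open>orth_proj\<close>: linear combinations and
  compositions of projections are projections again, whereas the choice operator need not commute
  with these operations.\<close>

definition is_proj :: "'a measure \<Rightarrow> ('a \<Rightarrow> real) set \<Rightarrow> ('a \<Rightarrow> real) \<Rightarrow> ('a \<Rightarrow> real) \<Rightarrow> bool" where
  "is_proj N W u p \<longleftrightarrow> p \<in> W \<and> (\<forall>w\<in>W. (LINT t|N. (u t - p t) * w t) = 0)"

definition fun_subspace :: "('a \<Rightarrow> real) set \<Rightarrow> bool" where
  "fun_subspace W \<longleftrightarrow> (\<lambda>_. 0) \<in> W \<and> (\<forall>u\<in>W. \<forall>v\<in>W. (\<lambda>t. u t + v t) \<in> W) \<and>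
     (\<forall>c. \<forall>u\<in>W. (\<lambda>t. c * u t) \<in> W)"

lemma fun_subspace_sum:
  assumes "fun_subspace W" "\<And>i. i \<in> I \<Longrightarrow> f i \<in> W"
  shows "(\<lambda>t. \<Sum>i\<in>I. f i t) \<in> W"
  using assms(2)
  by (induction I rule: infinite_finite_induct) (use assms(1) in \<open>auto simp: fun_subspace_def\<close>)

lemma fun_subspace_diff:
  assumes "fun_subspace W" "u \<in> W" "v \<in> W" shows "(\<lambda>t. u t - v t) \<in> W"
proof -
  have "(\<lambda>t. (-1) * v t) \<in> W"
    using assms(1,3) unfolding fun_subspace_def by blast
  then have "(\<lambda>t. u t + (-1) * v t) \<in> W"
    using assms(1,2) unfolding fun_subspace_def by fast
  then show ?thesis by simp
qed

text \<open>Integration gives only a semidefinite form on functions. This settles the degenerate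
  case: a function of norm zero vanishes almost everywhere.\<close>

lemma integral_mult_eq_0:
  assumes "finite_measure N" "bdd_meas N u" "bdd_meas N w" "(LINT t|N. w t * w t) = 0"
  shows "(LINT t|N. u t * w t) = 0"
proof -
  have "integrable N (\<lambda>t. w t * w t)"
    using assms by (intro bdd_meas_integrable bdd_meas_mult)
  then have "AE t in N. w t * w t = 0"
    using assms(4) by (subst (asm) integral_nonneg_eq_0_iff_AE) simp_all
  then have "AE t in N. u t * w t = 0"
    by eventually_elim simp
  then show ?thesis
    by (rule integral_eq_zero_AE)
qed

text \<open>The finite set \<open>X\<close> stands for linear functionals separating the points of \<open>W\<close>; the induction
  splits off one dimension for each of them.\<close>

lemma is_proj_exists:
  assumes N: "finite_measure N" and "finite X"
    and "fun_subspace W" "\<And>w. w \<in> W \<Longrightarrow> bdd_meas N w"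
    and "\<And>w. w \<in> W \<Longrightarrow> (\<And>x. x \<in> X \<Longrightarrow> w x = 0) \<Longrightarrow> (LINT t|N. w t * w t) = 0"
    and "bdd_meas N u"
  shows "\<exists>p. is_proj N W u p"
  using assms(2-6)
proof (induction X arbitrary: W u rule: finite_induct)
  case empty
  have "(LINT t|N. u t * w t) = 0" if "w \<in> W" for w
    by (rule integral_mult_eq_0[OF N empty(4) empty(2)[OF that] empty(3)[OF that]]) simp
  then have "is_proj N W u (\<lambda>_. 0)"
    using empty(1) by (simp add: is_proj_def fun_subspace_def)
  then show ?case by blast
next
  case (insert x X)
  define W' where "W' = {w \<in> W. w x = 0}"
  have sub: "fun_subspace W'"
    using insert.prems(1) by (auto simp: W'_def fun_subspace_def)
  have proj: "\<exists>p. is_proj N W' v p" if "bdd_meas N v" for v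
    by (rule insert.IH) (use insert.prems sub that in \<open>auto simp: W'_def\<close>)
  have int: "integrable N (\<lambda>t. f t * g t)" if "bdd_meas N f" "bdd_meas N g" for f g
    using that N by (intro bdd_meas_integrable bdd_meas_mult)
  show ?case
  proof (cases "W' = W")
    case True
    then show ?thesis using proj insert.prems by auto
  next
    case False
    then obtain w0 where w0: "w0 \<in> W" "w0 x \<noteq> 0"
      by (auto simp: W'_def)
    obtain p0 where p0: "is_proj N W' w0 p0"
      using proj w0 insert.prems by blast
    obtain p' where p': "is_proj N W' u p'"
      using proj insert.prems by blast
    \<comment> \<open>Gram-Schmidt: \<open>e\<close> is orthogonal to \<open>W'\<close> and does not
      vanish at \<open>x\<close>, so that \<open>W\<close> consists of \<open>W'\<close> and
      multiples of \<open>e\<close>.\<close>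
    define e where "e = (\<lambda>t. w0 t - p0 t)"
    have eW: "e \<in> W"
      using p0 w0 insert.prems(1) by (auto simp: e_def is_proj_def W'_def intro!: fun_subspace_diff)
    have ex: "e x \<noteq> 0"
      using p0 w0 by (auto simp: e_def is_proj_def W'_def)
    have bdd_meas: "bdd_meas N e" "bdd_meas N p'" "bdd_meas N u" "p' \<in> W"
      using eW p' insert.prems by (auto simp: is_proj_def W'_def)
    have eort: "(LINT t|N. e t * w t) = 0" if "w \<in> W'" for w
      using p0 that by (auto simp: is_proj_def e_def)
    \<comment> \<open>If \<open>e\<close> has norm zero, division by zero gives 0; the numerator
      vanishes too, so the equation \<open>c\<close> below holds in either case.\<close>
    define c where "c = (LINT t|N. u t * e t) / (LINT t|N. e t * e t)"
    have c: "(LINT t|N. u t * e t) = c * (LINT t|N. e t * e t)"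
      using integral_mult_eq_0[OF N, of u e] bdd_meas by (auto simp: c_def)
    define p where "p = (\<lambda>t. p' t + c * e t)"
    have "(LINT t|N. (u t - p t) * w t) = 0" if w: "w \<in> W" for w
    proof -
      \<comment> \<open>Subtracting this multiple of \<open>e\<close> makes the value at
        \<open>x\<close> zero, which puts the remainder into \<open>W'\<close>.\<close>
      define d where "d = w x / e x"
      define w' where "w' = (\<lambda>t. w t - d * e t)"
      have "(\<lambda>t. d * e t) \<in> W"
        using insert.prems(1) eW by (auto simp: fun_subspace_def)
      then have w': "w' \<in> W'"
        using ex fun_subspace_diff[OF insert.prems(1) w] by (auto simp: W'_def w'_def d_def)
      then have bw: "bdd_meas N w'"
        using insert.prems by (auto simp: W'_def)
      have "(LINT t|N. (u t - p t) * w t) =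
        (LINT t|N. (u t - p' t) * w' t - c * (e t * w' t) + d * (u t * e t) - d * (e t * p' t)
           - d * c * (e t * e t))"
        by (intro Bochner_Integration.integral_cong) (auto simp: p_def w'_def algebra_simps)
      also have "\<dots> = (LINT t|N. (u t - p' t) * w' t) - c * (LINT t|N. e t * w' t)
          + d * (LINT t|N. u t * e t) - d * (LINT t|N. e t * p' t) - d * c * (LINT t|N. e t * e t)"
        using bdd_meas bw by (simp add: int bdd_meas_diff)
      also have "\<dots> = 0"
        using c p' w' eort[OF w'] eort[of p'] by (simp add: is_proj_def)
      finally show ?thesis .
    qed
    moreover have "p \<in> W"
      using bdd_meas eW insert.prems(1) by (auto simp: p_def fun_subspace_def)
    ultimately show ?thesis by (auto simp: is_proj_def)
  qed
qed

text \<open>Both sides equal the integral of \<open>p t * q t\<close>, because each residual is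
  orthogonal to the other projection.\<close>

lemma is_proj_adjoint:
  assumes N: "finite_measure N" and "is_proj N W u p" "is_proj N W v q"
    and "bdd_meas N u" "bdd_meas N v" "\<And>w. w \<in> W \<Longrightarrow> bdd_meas N w"
  shows "(LINT t|N. u t * q t) = (LINT t|N. p t * v t)"
proof -
  have pq: "p \<in> W" "q \<in> W" "bdd_meas N p" "bdd_meas N q"
    using assms by (auto simp: is_proj_def)
  have int: "integrable N (\<lambda>t. f t * g t)" if "bdd_meas N f" "bdd_meas N g" for f g
    using that N by (intro bdd_meas_integrable bdd_meas_mult)
  have "(LINT t|N. (u t - p t) * q t) = 0" "(LINT t|N. (v t - q t) * p t) = 0"
    using assms pq by (auto simp: is_proj_def)
  then show ?thesis
    using pq assms(4,5) by (simp_all add: left_diff_distrib int mult.commute[of "v _" "p _"] mult.commute[of "q _" "p _"])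
qed

text \<open>Used with \<open>W\<close> the temporal space of an element and \<open>V\<close> that of
  a face. A member of \<open>V\<close> is orthogonal to both residuals, hence to their sum.\<close>

lemma is_proj_trans:
  assumes N: "finite_measure N" and "is_proj N W u p" "is_proj N V p q" "V \<subseteq> W"
    and "bdd_meas N u" "\<And>w. w \<in> W \<Longrightarrow> bdd_meas N w"
  shows "is_proj N V u q"
proof -
  have pq: "p \<in> W" "q \<in> V" "bdd_meas N p" "bdd_meas N q"
    using assms by (auto simp: is_proj_def)
  have int: "integrable N (\<lambda>t. f t * g t)" if "bdd_meas N f" "bdd_meas N g" for f g
    using that N by (intro bdd_meas_integrable bdd_meas_mult)
  have "(LINT t|N. (u t - q t) * w t) = 0" if "w \<in> V" for w
  proof -
    have "(LINT t|N. (u t - q t) * w t) = (LINT t|N. (u t - p t) * w t + (p t - q t) * w t)"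
      by (intro Bochner_Integration.integral_cong) (auto simp: algebra_simps)
    also have "\<dots> = (LINT t|N. (u t - p t) * w t) + (LINT t|N. (p t - q t) * w t)"
      using pq assms that by (intro Bochner_Integration.integral_add int bdd_meas_diff) auto
    also have "\<dots> = 0"
      using assms that by (auto simp: is_proj_def)
    finally show ?thesis .
  qed
  then show ?thesis using pq by (auto simp: is_proj_def)
qed

lemma is_proj_sum:
  assumes N: "finite_measure N" and W: "fun_subspace W" "\<And>w. w \<in> W \<Longrightarrow> bdd_meas N w"
    and "\<And>i. i \<in> I \<Longrightarrow> is_proj N W (u i) (p i)" "\<And>i. i \<in> I \<Longrightarrow> bdd_meas N (u i)"
  shows "is_proj N W (\<lambda>t. \<Sum>i\<in>I. c i * u i t) (\<lambda>t. \<Sum>i\<in>I. c i * p i t)"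
proof -
  have pW: "p i \<in> W" "bdd_meas N (p i)" if "i \<in> I" for i
    using assms that by (auto simp: is_proj_def)
  have "(LINT t|N. ((\<Sum>i\<in>I. c i * u i t) - (\<Sum>i\<in>I. c i * p i t)) * w t) = 0" if "w \<in> W" for w
  proof -
    have "(LINT t|N. ((\<Sum>i\<in>I. c i * u i t) - (\<Sum>i\<in>I. c i * p i t)) * w t) =
       (LINT t|N. (\<Sum>i\<in>I. c i * ((u i t - p i t) * w t)))"
      by (intro Bochner_Integration.integral_cong)
        (auto simp: sum_distrib_left sum_distrib_right algebra_simps sum_subtractf)
    also have "\<dots> = (\<Sum>i\<in>I. c i * (LINT t|N. (u i t - p i t) * w t))"
      using assms pW that
      by (subst Bochner_Integration.integral_sum) (simp_all add: bdd_meas_integrable bdd_meas_mult bdd_meas_diff bdd_meas_const)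
    also have "\<dots> = 0"
      using assms that by (auto simp: is_proj_def)
    finally show ?thesis .
  qed
  moreover have "(\<lambda>t. \<Sum>i\<in>I. c i * p i t) \<in> W"
    using pW W by (intro fun_subspace_sum) (auto simp: fun_subspace_def)
  ultimately show ?thesis by (auto simp: is_proj_def)
qed

text \<open>The difference lies in \<open>W\<close> and is orthogonal to \<open>W\<close>, hence to
  itself. The step from norm zero to pointwise equality is made later, for piecewise
  polynomials.\<close>

lemma is_proj_unique:
  assumes N: "finite_measure N" and W: "fun_subspace W" "\<And>w. w \<in> W \<Longrightarrow> bdd_meas N w"
    and "is_proj N W u p" "is_proj N W u q" "bdd_meas N u"
  shows "(LINT t|N. (p t - q t) * (p t - q t)) = 0"
proof -
  have pq: "p \<in> W" "q \<in> W" "bdd_meas N p" "bdd_meas N q"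
    using assms by (auto simp: is_proj_def)
  have d: "(\<lambda>t. p t - q t) \<in> W"
    using W pq by (intro fun_subspace_diff)
  have "(LINT t|N. (p t - q t) * (p t - q t)) =
    (LINT t|N. (u t - q t) * (p t - q t) - (u t - p t) * (p t - q t))"
    by (intro Bochner_Integration.integral_cong) (auto simp: algebra_simps)
  also have "\<dots> = (LINT t|N. (u t - q t) * (p t - q t)) - (LINT t|N. (u t - p t) * (p t - q t))"
    using pq assms by (intro Bochner_Integration.integral_diff bdd_meas_integrable bdd_meas_mult bdd_meas_diff) auto
  also have "\<dots> = 0"
    using assms(4,5) d by (auto simp: is_proj_def)
  finally show ?thesis .
qed

section \<open>Piecewise polynomials on the time slab\<close>

lemma bdd_meas_Un:
  assumes "S \<in> sets lebesgue" "T \<in> sets lebesgue" "bdd_meas (lebesgue_on S) f" "bdd_meas (lebesgue_on T) f"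
  shows "bdd_meas (lebesgue_on (S \<union> T)) f"
proof -
  obtain C D where "\<forall>x\<in>S. \<bar>f x\<bar> \<le> C" "\<forall>x\<in>T. \<bar>f x\<bar> \<le> D"
    using assms(3,4) by (auto simp: bdd_meas_def)
  then have "\<forall>x\<in>S \<union> T. \<bar>f x\<bar> \<le> max C D"
    by (auto simp: le_max_iff_disj)
  moreover have "f \<in> borel_measurable (lebesgue_on (S \<union> T))"
  proof (rule measurable_piecewise_restrict[of "{S, T}"])
    show "f \<in> borel_measurable (restrict_space (lebesgue_on (S \<union> T)) \<Omega>)" if "\<Omega> \<in> {S, T}" for \<Omega>
    proof -
      have "restrict_space (lebesgue_on (S \<union> T)) \<Omega> = lebesgue_on ((S \<union> T) \<inter> \<Omega>)"
        using that assms(1,2) by (intro restrict_restrict_space) auto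
      moreover have "(S \<union> T) \<inter> \<Omega> = \<Omega>"
        using that by auto
      ultimately show ?thesis
        using that assms(3,4) by (auto simp: bdd_meas_def)
    qed
  qed (use assms in \<open>auto simp: sets_restrict_space_iff\<close>)
  ultimately show ?thesis by (auto simp: bdd_meas_def)
qed

lemma bdd_meas_UN:
  assumes "finite I" "\<And>i. i \<in> I \<Longrightarrow> A i \<in> sets lebesgue" "\<And>i. i \<in> I \<Longrightarrow> bdd_meas (lebesgue_on (A i)) f"
  shows "bdd_meas (lebesgue_on (\<Union>i\<in>I. A i)) f"
  using assms
proof (induction I rule: finite_induct)
  case empty
  show ?case by (auto simp: bdd_meas_def measurable_def space_restrict_space)
next
  case (insert x F)
  then show ?case by (auto intro!: bdd_meas_Un sets.finite_UN)
qed

lemma poly_space_bdd_meas: "u \<in> poly_space d {a<..b} \<Longrightarrow> bdd_meas (lebesgue_on {a<..b}) u"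
proof -
  assume "u \<in> poly_space d {a<..b}"
  then obtain r where "\<forall>t\<in>{a<..b}. u t = poly r t"
    by (auto simp: poly_space_def)
  then have "bdd_meas (lebesgue_on {a<..b}) u \<longleftrightarrow> bdd_meas (lebesgue_on {a<..b}) (poly r)"
    by (intro bdd_meas_cong) auto
  moreover have "bdd_meas (lebesgue_on {a<..b}) (poly r)"
    by (rule bdd_meas_continuous_compact[of "{a..b}"]) (auto intro: continuous_intros)
  ultimately show ?thesis by simp
qed

lemma fun_subspace_poly_space: "fun_subspace (poly_space d I)"
  unfolding fun_subspace_def poly_space_def
proof (safe, goal_cases)
  case 1
  show ?case by (rule exI[of _ 0]) auto
next
  case (2 u v r s)
  then show ?case by (intro exI[of _ "r + s"]) (auto intro: degree_add_le)
next
  case (3 c u r)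
  then show ?case by (intro exI[of _ "smult c r"]) (auto intro: order_trans[OF degree_smult_le])
qed

lemma fun_subspace_INT: "(\<And>i. i \<in> I \<Longrightarrow> fun_subspace (W i)) \<Longrightarrow> fun_subspace (\<Inter>i\<in>I. W i)"
  by (auto simp: fun_subspace_def)

lemma slab_lmeasurable: "slab M \<in> lmeasurable"
  by (simp add: slab_def bounded_set_imp_lmeasurable)

lemma slab_finite: "finite_measure (lebesgue_on (slab M))"
  by (rule finite_measure_lebesgue_on[OF slab_lmeasurable])

lemma bdd_meas_L2:
  assumes "bdd_meas (lebesgue_on S) u" "S \<in> lmeasurable"
  shows "u \<in> L2 S"
proof -
  have "bdd_meas (lebesgue_on S) (\<lambda>x. (norm (u x))\<^sup>2)"
    using bdd_meas_mult[OF assms(1) assms(1)] by (simp add: power2_eq_square)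
  then have "integrable (lebesgue_on S) (\<lambda>x. (norm (u x))\<^sup>2)"
    using assms finite_measure_lebesgue_on bdd_meas_integrable by blast
  then show ?thesis using assms by (simp add: L2_def bdd_meas_def)
qed

context
  fixes M K
  assumes M: "valid_mesh M" and K: "K < n_elem M"
begin

lemma node_less: "k < n_sub M K \<Longrightarrow> node M K k < node M K (Suc k)"
  and node_0: "node M K 0 = t_start M" and node_end: "node M K (n_sub M K) = t_end M"
  and deg_pos: "k < n_sub M K \<Longrightarrow> 1 \<le> deg_t M K k"
  and slab_pos: "t_start M < t_end M"
  using M K by (auto simp: valid_mesh_def)

lemma node_mono: "i \<le> j \<Longrightarrow> j \<le> n_sub M K \<Longrightarrow> node M K i \<le> node M K j"
  by (induction j rule: dec_induct) (use node_less in \<open>auto simp: Suc_le_eq intro: order_trans less_imp_le\<close>)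

lemma slab_UN: "slab M = (\<Union>k<n_sub M K. subint M K k)"
proof -
  have "{node M K 0<..node M K n} = (\<Union>k<n. subint M K k)" if "n \<le> n_sub M K" for n
    using that
  proof (induction n)
    case (Suc n)
    have "node M K 0 \<le> node M K n" "node M K n \<le> node M K (Suc n)"
      using Suc.prems node_mono by auto
    then have "{node M K 0<..node M K (Suc n)} = {node M K 0<..node M K n} \<union> subint M K n"
      by (auto simp: subint_def)
    then show ?case using Suc by (auto simp: lessThan_Suc)
  qed simp
  then show ?thesis by (simp add: slab_def flip: node_0 node_end)
qed

lemma subint_slab: "k < n_sub M K \<Longrightarrow> subint M K k \<subseteq> slab M"
  using slab_UN by auto

lemma slab_subint: "t \<in> slab M \<Longrightarrow> \<exists>k<n_sub M K. t \<in> subint M K k"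
  using slab_UN by auto

lemma piecewise_poly_bdd_meas:
  assumes "\<And>k. k < n_sub M K \<Longrightarrow> u \<in> poly_space (d k) (subint M K k)"
  shows "bdd_meas (lebesgue_on (slab M)) u"
  unfolding slab_UN using assms
  by (intro bdd_meas_UN) (auto simp: subint_def intro: poly_space_bdd_meas)

text \<open>Square integrability is automatic, since a piecewise polynomial is bounded on the slab.
  What remains is an intersection of polynomial spaces, so that closure properties can be checked
  piece by piece.\<close>

lemma T_time_eq: "T_time M K = (\<Inter>k\<in>{..<n_sub M K}. poly_space (deg_t M K k - 1) (subint M K k))"
proof -
  have "u \<in> L2 (slab M)"
    if "\<And>k. k < n_sub M K \<Longrightarrow> u \<in> poly_space (deg_t M K k - 1) (subint M K k)" for u
    using that by (intro bdd_meas_L2[OF piecewise_poly_bdd_meas slab_lmeasurable])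
  then show ?thesis by (auto simp: T_time_def)
qed

lemma T_time_subspace: "fun_subspace (T_time M K)"
  unfolding T_time_eq by (intro fun_subspace_INT fun_subspace_poly_space)

lemma T_time_bdd_meas: "u \<in> T_time M K \<Longrightarrow> bdd_meas (lebesgue_on (slab M)) u"
  by (rule piecewise_poly_bdd_meas[of _ "\<lambda>k. deg_t M K k - 1"]) (auto simp: T_time_def)

lemma S_time_bdd_meas: "u \<in> S_time M K \<Longrightarrow> bdd_meas (lebesgue_on (slab M)) u"
  by (rule piecewise_poly_bdd_meas[of _ "deg_t M K"]) (auto simp: S_time_def)

text \<open>Take as many points in each subinterval as its degree \<open>deg_t\<close>: a polynomial
  of degree at most \<open>deg_t - 1\<close> that vanishes there is zero. Evaluations at these
  points are the functionals required by \<open>is_proj_exists\<close>. As degrees are at least 1,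
  the subtraction of natural numbers is exact.\<close>

lemma T_time_determining_set:
  "\<exists>X. finite X \<and> X \<subseteq> slab M \<and> (\<forall>w\<in>T_time M K. (\<forall>x\<in>X. w x = 0) \<longrightarrow> (\<forall>t\<in>slab M. w t = 0))"
proof -
  have "\<exists>X. finite X \<and> card X = deg_t M K k \<and> X \<subseteq> subint M K k" if "k < n_sub M K" for k
    using node_less[OF that] infinite_arbitrarily_large[of "subint M K k"] by (auto simp: subint_def)
  then obtain X where X: "\<And>k. k < n_sub M K \<Longrightarrow>
      finite (X k) \<and> card (X k) = deg_t M K k \<and> X k \<subseteq> subint M K k"
    by metis
  have "w t = 0" if w: "w \<in> T_time M K" "\<forall>x\<in>(\<Union>k<n_sub M K. X k). w x = 0" and t: "t \<in> slab M" for w t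
  proof -
    obtain k where k: "k < n_sub M K" "t \<in> subint M K k"
      using slab_subint[OF t] by blast
    then obtain r where r: "degree r \<le> deg_t M K k - 1" "\<And>s. s \<in> subint M K k \<Longrightarrow> w s = poly r s"
      using w(1) by (fastforce simp: T_time_def poly_space_def)
    have "r = 0"
    proof (rule ccontr)
      assume "r \<noteq> 0"
      then have "card (X k) \<le> card {x. poly r x = 0}"
        using X[OF k(1)] w(2) r(2) k(1) by (intro card_mono poly_roots_finite) force+
      then show False
        using card_poly_roots_bound[OF \<open>r \<noteq> 0\<close>] r(1) X[OF k(1)] deg_pos[OF k(1)] by simp
    qed
    then show ?thesis using r k by simp
  qed
  then show ?thesis
    using X subint_slab by (intro exI[of _ "\<Union>k<n_sub M K. X k"]) fastforce
qed

text \<open>A non-zero polynomial has finitely many zeros, but a subinterval is not negligible. This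
  is how statements that hold almost everywhere in time become statements about every time.\<close>

lemma T_time_eq_0:
  assumes w: "w \<in> T_time M K" and N: "negligible N" "\<And>t. t \<in> slab M - N \<Longrightarrow> w t = 0" and t: "t \<in> slab M"
  shows "w t = 0"
proof -
  obtain k where k: "k < n_sub M K" "t \<in> subint M K k"
    using slab_subint[OF t] by blast
  then obtain r where r: "\<And>s. s \<in> subint M K k \<Longrightarrow> w s = poly r s"
    using w(1) by (fastforce simp: T_time_def poly_space_def)
  have "r = 0"
  proof (rule ccontr)
    assume "r \<noteq> 0"
    then have "negligible (N \<union> {x. poly r x = 0})"
      using N poly_roots_finite by auto
    moreover have "box (node M K k) (node M K (Suc k)) \<subseteq> N \<union> {x. poly r x = 0}"
      using r N(2) subint_slab[OF k(1)] by (fastforce simp: subint_def)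
    ultimately have "negligible (box (node M K k) (node M K (Suc k)))"
      using negligible_subset by blast
    then show False
      using node_less[OF k(1)] by (simp only: negligible_interval) simp
  qed
  then show ?thesis using r k by simp
qed

lemma T_time_integral_eq_0:
  assumes w: "w \<in> T_time M K" and "(LINT t|lebesgue_on (slab M). w t * w t) = 0" and t: "t \<in> slab M"
  shows "w t = 0"
proof -
  have "AE t in lebesgue_on (slab M). w t * w t = 0"
    using assms(2) bdd_meas_integrable[OF slab_finite bdd_meas_mult[OF T_time_bdd_meas T_time_bdd_meas], OF w w]
    by (subst (asm) integral_nonneg_eq_0_iff_AE) simp_all
  then obtain N where N: "N \<in> null_sets (lebesgue_on (slab M))" "{t \<in> slab M. w t * w t \<noteq> 0} \<subseteq> N"
    by (auto simp: eventually_ae_filter)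
  then have "negligible N"
    using slab_lmeasurable by (metis fmeasurableD negligible_iff_null_sets null_sets_restrict_space)
  then show ?thesis
    using N(2) by (intro T_time_eq_0[OF w _ _ t]) auto
qed

text \<open>Stated for subspaces, so that it covers the intersection of the temporal spaces of two
  neighbours, onto which a face projects.\<close>

lemma is_proj_T_exists:
  assumes "W \<subseteq> T_time M K" "fun_subspace W" "bdd_meas (lebesgue_on (slab M)) u"
  shows "\<exists>p. is_proj (lebesgue_on (slab M)) W u p"
proof -
  obtain X where X: "finite X" "\<And>w t. w\<in>T_time M K \<Longrightarrow> \<forall>x\<in>X. w x = 0 \<Longrightarrow> t\<in>slab M \<Longrightarrow> w t = 0"
    using T_time_determining_set by blast
  show ?thesis
  proof (rule is_proj_exists[OF slab_finite X(1) assms(2) _ _ assms(3)])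
    show "(LINT t|lebesgue_on (slab M). w t * w t) = 0" if "w \<in> W" "\<And>x. x \<in> X \<Longrightarrow> w x = 0" for w
      using X(2)[of w] that assms(1) by (intro integral_eq_zero_AE AE_I2) auto
  qed (use assms T_time_bdd_meas in auto)
qed

text \<open>Uniqueness at every time of the slab. It identifies values picked by
  \<open>orth_proj\<close> with explicitly constructed projections.\<close>

lemma is_proj_T_unique:
  assumes "W \<subseteq> T_time M K" "fun_subspace W" "bdd_meas (lebesgue_on (slab M)) u"
    and "is_proj (lebesgue_on (slab M)) W u p" "is_proj (lebesgue_on (slab M)) W u q" "t \<in> slab M"
  shows "p t = q t"
proof -
  have "(LINT t|lebesgue_on (slab M). (p t - q t) * (p t - q t)) = 0"
    by (rule is_proj_unique[OF slab_finite assms(2) _ assms(4,5,3)]) (use assms T_time_bdd_meas in auto)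
  moreover have "(\<lambda>t. p t - q t) \<in> T_time M K"
    using fun_subspace_diff[OF assms(2)] assms by (auto simp: is_proj_def)
  ultimately show ?thesis
    using T_time_integral_eq_0 assms(6) by fastforce
qed

lemma orth_proj_time:
  assumes "W \<subseteq> T_time M K" "fun_subspace W" "bdd_meas (lebesgue_on (slab M)) u"
  shows "is_proj (lebesgue_on (slab M)) W u (orth_proj (time_ip M) W u)"
proof -
  have "\<exists>p. p \<in> W \<and> (\<forall>w\<in>W. time_ip M (u - p) w = 0)"
    using is_proj_T_exists[OF assms] by (auto simp: is_proj_def time_ip_def)
  from someI_ex[OF this] show ?thesis
    by (simp add: is_proj_def orth_proj_def time_ip_def)
qed

end

section \<open>Continuity in time\<close>

lemma has_real_derivative_max_0_squared:
  "((\<lambda>x::real. (max 0 x)\<^sup>2) has_real_derivative 2 * max 0 x) (at x)"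
proof -
  consider "x > 0" | "x < 0" | "x = 0" by linarith
  then show ?thesis
  proof cases
    case 1
    have "((\<lambda>x::real. x\<^sup>2) has_real_derivative 2 * x) (at x)"
      by (auto intro!: derivative_eq_intros)
    then have "((\<lambda>x::real. (max 0 x)\<^sup>2) has_real_derivative 2 * x) (at x)"
      by (rule has_field_derivative_transform_within_open[of _ _ _ "{0<..}"]) (use 1 in auto)
    then show ?thesis
      using 1 by simp
  next
    case 2
    have "((\<lambda>x::real. 0) has_real_derivative 0) (at x)"
      by auto
    then have "((\<lambda>x::real. (max 0 x)\<^sup>2) has_real_derivative 0) (at x)"
      by (rule has_field_derivative_transform_within_open[of _ _ _ "{..<0}"]) (use 2 in auto)
    then show ?thesis
      using 2 by simp
  next
    case 3
    \<comment> \<open>At 0 the difference quotient is \<open>max 0 h\<close> itself.\<close>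
    have "((\<lambda>h::real. max 0 h) \<longlongrightarrow> max 0 0) (at 0)"
      by (intro tendsto_intros)
    moreover have "\<forall>\<^sub>F h in at 0. max 0 h = (max 0 (0 + h))\<^sup>2 / (h::real)"
      by (auto simp: eventually_at_filter power2_eq_square max_def)
    ultimately show ?thesis
      using 3 by (auto simp: DERIV_def intro: Lim_transform_eventually)
  qed
qed

text \<open>For positive \<open>e\<close> this has value 1 at \<open>c\<close> and vanishes at
  distance \<open>e\<close> from it. Squaring the positive part of a parabola makes it continuously
  differentiable, which is the smoothness that \<open>test_fun\<close> asks for.\<close>

definition bump :: "real \<Rightarrow> real \<Rightarrow> real \<Rightarrow> real" where
  "bump c e t = (max 0 (1 - ((t - c) / e)\<^sup>2))\<^sup>2"

definition bump' :: "real \<Rightarrow> real \<Rightarrow> real \<Rightarrow> real" where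
  "bump' c e t = 2 * max 0 (1 - ((t - c) / e)\<^sup>2) * (- (2 * (t - c) / e\<^sup>2))"

lemma bump_deriv: "(bump c e has_real_derivative bump' c e t) (at t)"
proof -
  have "((\<lambda>t. 1 - ((t - c) / e)\<^sup>2) has_real_derivative - (2 * (t - c) / e\<^sup>2)) (at t)"
    by (cases "e = 0") (auto intro!: derivative_eq_intros simp: divide_simps power2_eq_square)
  from DERIV_chain[OF has_real_derivative_max_0_squared this] show ?thesis
    by (simp add: bump_def[abs_def] bump'_def o_def)
qed

lemma bump_continuous: "continuous_on S (bump c e)" "continuous_on S (bump' c e)"
  unfolding bump_def[abs_def] bump'_def[abs_def] divide_inverse by (intro continuous_intros)+

lemma bump_zero:
  assumes "0 < e" "e \<le> \<bar>t - c\<bar>" shows "bump c e t = 0" "bump' c e t = 0"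
proof -
  have "1 \<le> \<bar>(t - c) / e\<bar>"
    using assms by (simp add: abs_divide)
  then have "1 \<le> ((t - c) / e)\<^sup>2"
    by (metis abs_ge_zero one_le_power power2_abs)
  then show "bump c e t = 0" "bump' c e t = 0"
    by (auto simp: bump_def bump'_def)
qed

lemma bump_bound: "\<bar>bump c e t\<bar> \<le> 1"
proof -
  have "0 \<le> max 0 (1 - ((t - c) / e)\<^sup>2)" "max 0 (1 - ((t - c) / e)\<^sup>2) \<le> 1"
    by auto
  then show ?thesis
    unfolding bump_def by (simp add: power_le_one)
qed

lemma bump_test_fun:
  assumes "0 < e" "a < c - e" "c + e < b"
  shows "bump c e \<in> test_fun a b"
proof -
  have "bump c e C1_differentiable_on UNIV"
    unfolding C1_differentiable_on_def
    using bump_deriv[of c e] bump_continuous(2)[of UNIV c e]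
    by (intro exI[of _ "bump' c e"]) (simp add: has_real_derivative_iff_has_vector_derivative)
  moreover have "{t. bump c e t \<noteq> 0} \<subseteq> {c - e..c + e}"
  proof
    fix t assume "t \<in> {t. bump c e t \<noteq> 0}"
    then have "\<not> e \<le> \<bar>t - c\<bar>"
      using bump_zero assms by blast
    then show "t \<in> {c - e..c + e}" by auto
  qed
  then have "closure {t. bump c e t \<noteq> 0} \<subseteq> {c - e..c + e}"
    by (intro closure_minimal) auto
  ultimately show ?thesis
    using assms by (fastforce simp: test_fun_def)
qed

lemma bdd_meas_Ioc_continuous:
  fixes f :: "real \<Rightarrow> real"
  assumes "continuous_on UNIV f" shows "bdd_meas (lebesgue_on {a<..b}) f"
  using assms by (intro bdd_meas_continuous_compact[of "{a..b}"]) (auto intro: continuous_on_subset)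

lemma bdd_meas_if:
  assumes "bdd_meas M f" "bdd_meas M g" "Measurable.pred M P"
  shows "bdd_meas M (\<lambda>x. if P x then f x else g x)"
proof -
  obtain C D where "\<forall>x\<in>space M. \<bar>f x\<bar> \<le> C" "\<forall>x\<in>space M. \<bar>g x\<bar> \<le> D"
    using assms(1,2) by (auto simp: bdd_meas_def)
  then have "\<forall>x\<in>space M. \<bar>if P x then f x else g x\<bar> \<le> max C D"
    by (auto simp: le_max_iff_disj)
  then show ?thesis
    using assms unfolding bdd_meas_def by (intro conjI measurable_If exI[of _ "max C D"]) (auto simp: pred_def)
qed

text \<open>The weak derivative is tested with bumps around \<open>c\<close> whose supports shrink.
  Integration by parts on both sides expresses the jump as the integral of the bump against a fixed
  integrable function, and this tends to zero by dominated convergence.\<close>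

lemma H1_no_jump:
  fixes u :: "real \<Rightarrow> real"
  assumes u: "u \<in> H1 a b" and ord: "a \<le> l" "l < c" "c < r" "r \<le> b"
    and p: "\<And>t. t \<in> {l<..c} \<Longrightarrow> u t = poly p t" and q: "\<And>t. t \<in> {c<..r} \<Longrightarrow> u t = poly q t"
  shows "poly p c = poly q c"
proof -
  let ?N = "lebesgue_on {a<..b}"
  have fin: "finite_measure ?N"
    by (intro finite_measure_lebesgue_on bounded_set_imp_lmeasurable) auto
  obtain u' where u': "u' \<in> L2 {a<..b}" "\<And>\<phi>. \<phi> \<in> test_fun a b \<Longrightarrow> weak_deriv_against a b \<phi> u u'"
    using u by (auto simp: H1_def)
  have u'_meas: "u' \<in> borel_measurable ?N"
    using u' by (auto simp: L2_def)
  \<comment> \<open>An integrable majorant of \<open>u'\<close>, which is only known to be square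
    integrable.\<close>
  have "integrable ?N (\<lambda>x. 1 + (u' x)\<^sup>2)"
    using u' bdd_meas_integrable[OF fin bdd_meas_const] by (intro Bochner_Integration.integrable_add) (auto simp: L2_def)
  then have u'_int: "integrable ?N u'"
  proof (rule Bochner_Integration.integrable_bound[OF _ u'_meas], intro AE_I2)
    fix x
    have "0 \<le> (\<bar>u' x\<bar> - 1/2)\<^sup>2" by simp
    then have "\<bar>u' x\<bar> \<le> 1 + (u' x)\<^sup>2"
      by (simp add: power2_diff power_divide)
    then show "norm (u' x) \<le> norm (1 + (u' x)\<^sup>2)"
      by simp
  qed
  \<comment> \<open>The two polynomials are continued to the whole interval. They need to agree with
    \<open>u\<close> only between \<open>l\<close> and \<open>r\<close>, because the bumps and their
    derivatives vanish elsewhere.\<close>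
  define U D where "U = (\<lambda>t. if t \<le> c then poly p t else poly q t)"
    and "D = (\<lambda>t. if t \<le> c then poly (pderiv p) t else poly (pderiv q) t)"
  have pred: "Measurable.pred ?N (\<lambda>t. t \<le> c)"
    by (intro measurable_restrict_space1 measurable_completion) simp
  have UD: "bdd_meas ?N U" "bdd_meas ?N D"
    unfolding U_def D_def
    by (intro bdd_meas_if bdd_meas_Ioc_continuous continuous_intros pred)+
  have bb: "bdd_meas ?N (bump c e)" "bdd_meas ?N (bump' c e)" for e
    by (intro bdd_meas_Ioc_continuous bump_continuous)+
  define h where "h = (\<lambda>t. D t - u' t)"
  have h: "integrable ?N h"
    unfolding h_def using u'_int bdd_meas_integrable[OF fin UD(2)] by auto
  \<comment> \<open>Integration by parts on either side of \<open>c\<close>: the bump vanishes at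
    \<open>a\<close> and \<open>b\<close> and equals 1 at \<open>c\<close>. The weak derivative then
    replaces the term with \<open>bump'\<close> by one with \<open>u'\<close>.\<close>
  have jump: "(LINT t|?N. bump c e t * h t) = poly p c - poly q c"
    if e: "0 < e" "l < c - e" "c + e < r" for e
  proof -
    let ?G = "\<lambda>t. bump' c e t * U t + bump c e t * D t"
    have zero: "bump c e a = 0" "bump c e b = 0"
      using e ord by (auto intro!: bump_zero)
    have one: "bump c e c = 1"
      by (simp add: bump_def)
    have der: "((\<lambda>t. bump c e t * poly p t) has_vector_derivative
        bump' c e t * poly p t + bump c e t * poly (pderiv p) t) (at t within S)" for p t S
      using DERIV_mult[OF bump_deriv[of c e t] poly_DERIV[of p t]]
      by (auto simp: has_real_derivative_iff_has_vector_derivative algebra_simps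
          intro: has_vector_derivative_at_within)
    have "((\<lambda>t. bump' c e t * poly p t + bump c e t * poly (pderiv p) t) has_integral
        bump c e c * poly p c - bump c e a * poly p a) {a..c}"
      using ord by (intro fundamental_theorem_of_calculus der) auto
    then have 1: "(?G has_integral poly p c) {a..c}"
      by (rule has_integral_eq[rotated, THEN has_integral_eq_rhs])
        (auto simp: zero one U_def D_def)
    have "((\<lambda>t. bump' c e t * poly q t + bump c e t * poly (pderiv q) t) has_integral
        bump c e b * poly q b - bump c e c * poly q c) {c..b}"
      using ord by (intro fundamental_theorem_of_calculus der) auto
    then have "(?G has_integral bump c e b * poly q b - bump c e c * poly q c) {c..b}"
      by (rule has_integral_spike_finite[of "{c}", rotated 2]) (auto simp: U_def D_def)
    then have "(?G has_integral poly p c + (bump c e b * poly q b - bump c e c * poly q c)) {a..b}"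
      using ord by (intro has_integral_combine[OF _ _ 1]) auto
    then have "(?G has_integral poly p c - poly q c) {a..b}"
      by (simp add: zero one)
    then have "(?G has_integral poly p c - poly q c) {a<..b}"
      by (rule has_integral_spike_set_eq[THEN iffD1, rotated 2])
        (auto intro: negligible_subset[OF negligible_sing[of a]])
    moreover have G: "bdd_meas ?N ?G"
      by (intro bdd_meas_intros UD bb)
    ultimately have "(LINT t|?N. ?G t) = poly p c - poly q c"
      by (intro has_integral_unique[OF has_integral_integral_lebesgue_on[OF bdd_meas_integrable[OF fin G]]]) simp_all
    moreover have "(LINT t|?N. bump' c e t * U t) = (LINT t|?N. deriv (bump c e) t *\<^sub>R u t)"
    proof (intro Bochner_Integration.integral_cong)
      fix t assume "t \<in> space ?N"
      show "bump' c e t * U t = deriv (bump c e) t *\<^sub>R u t"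
      proof (cases "e \<le> \<bar>t - c\<bar>")
        case True
        then show ?thesis using bump_zero e DERIV_imp_deriv[OF bump_deriv] by simp
      next
        case False
        then have "U t = u t"
          using e p q by (auto simp: U_def abs_le_iff)
        then show ?thesis using DERIV_imp_deriv[OF bump_deriv] by simp
      qed
    qed simp
    moreover have "bump c e \<in> test_fun a b"
      using e ord by (intro bump_test_fun) auto
    ultimately have w: "(LINT t|?N. bump' c e t * U t + bump c e t * D t) = poly p c - poly q c"
      "(LINT t|?N. bump' c e t * U t) = - (LINT t|?N. bump c e t * u' t)"
      using u'(2) by (auto simp: weak_deriv_against_def)
    have i: "integrable ?N (\<lambda>t. bump' c e t * U t)" "integrable ?N (\<lambda>t. bump c e t * D t)"
      by (intro bdd_meas_integrable fin bdd_meas_mult UD bb)+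
    have "integrable ?N (\<lambda>t. bump c e t * u' t)"
      using u'_int
    proof (rule Bochner_Integration.integrable_bound)
      show "(\<lambda>t. bump c e t * u' t) \<in> borel_measurable ?N"
        by (intro borel_measurable_times bdd_meas_measurable bb u'_meas)
      show "AE t in ?N. norm (bump c e t * u' t) \<le> norm (u' t)"
        using bump_bound by (auto simp: abs_mult intro!: mult_left_le_one_le)
    qed
    then show ?thesis
      using w i by (simp add: h_def right_diff_distrib)
  qed
  \<comment> \<open>The summand 2 keeps the supports strictly between \<open>l\<close> and
    \<open>r\<close> from \<open>n = 0\<close> on.\<close>
  define e where "e = (\<lambda>n. min (c - l) (r - c) / (2 + real n))"
  have e: "0 < e n" "l < c - e n" "c + e n < r" for n
  proof -
    have pos: "0 < min (c - l) (r - c)" using ord by simp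
    then have "e n \<le> min (c - l) (r - c) / 2"
      unfolding e_def by (intro divide_left_mono) auto
    moreover have "0 < e n"
      unfolding e_def by (intro divide_pos_pos pos) simp
    ultimately show "0 < e n" "l < c - e n" "c + e n < r"
      using ord by (auto simp: min_def split: if_splits)
  qed
  have e_lim: "e \<longlonglongrightarrow> 0"
    unfolding e_def by (intro tendsto_divide_0[OF tendsto_const] filterlim_at_top_imp_at_infinity filterlim_tendsto_add_at_top[OF tendsto_const] filterlim_real_sequentially)
  \<comment> \<open>At \<open>t = c\<close> every bump equals 1, so the pointwise limit is supported
    on a single point, a null set.\<close>
  have "(\<lambda>n. LINT t|?N. bump c (e n) t * h t) \<longlonglongrightarrow> (LINT t|?N. (if t = c then h t else 0))"
  proof (rule integral_dominated_convergence[where w = "\<lambda>t. norm (h t)"])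
    show "AE t in ?N. (\<lambda>n. bump c (e n) t * h t) \<longlonglongrightarrow> (if t = c then h t else 0)"
    proof (intro AE_I2)
      fix t
      show "(\<lambda>n. bump c (e n) t * h t) \<longlonglongrightarrow> (if t = c then h t else 0)"
      proof (cases "t = c")
        case True
        then show ?thesis by (simp add: bump_def)
      next
        case False
        have "\<forall>\<^sub>F n in sequentially. e n < \<bar>t - c\<bar>"
          using False by (intro order_tendstoD(2)[OF e_lim]) auto
        then have "\<forall>\<^sub>F n in sequentially. bump c (e n) t * h t = 0"
          by eventually_elim (simp add: bump_zero e less_imp_le)
        then show ?thesis
          using False by (simp add: tendsto_eventually)
      qed
    qed
    show "AE t in ?N. norm (bump c (e n) t * h t) \<le> norm (h t)" for n
      using bump_bound by (auto simp: abs_mult intro!: mult_left_le_one_le)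
    show hm: "(\<lambda>t. bump c (e n) t * h t) \<in> borel_measurable ?N" for n
      by (intro borel_measurable_times bdd_meas_measurable bb borel_measurable_integrable h)
    show "(\<lambda>t. if t = c then h t else 0) \<in> borel_measurable ?N"
    proof -
      have "indicat_real {c} \<in> borel_measurable ?N"
        by (intro measurable_restrict_space1 measurable_completion) simp
      then have "(\<lambda>t. indicat_real {c} t * h t) \<in> borel_measurable ?N"
        by (intro borel_measurable_times borel_measurable_integrable[OF h])
      moreover have "(\<lambda>t. indicat_real {c} t * h t) = (\<lambda>t. if t = c then h t else 0)"
        by (auto simp: fun_eq_iff)
      ultimately show ?thesis by simp
    qed
  qed (use h in auto)
  moreover have "(LINT t|?N. (if t = c then h t else 0)) = (LINT t|?N. 0)"
    by (rule integral_lebesgue_on_spike(1)[of "{c}"]) auto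
  ultimately have "(\<lambda>n. poly p c - poly q c) \<longlonglongrightarrow> 0"
    using jump e by simp
  then have "poly p c - poly q c = 0"
    using LIMSEQ_const_iff by blast
  then show ?thesis by simp
qed


text \<open>The slab is open at its start and \<open>u a\<close> is arbitrary, so the initial value
  \<open>u0\<close> is read off a continuous extension \<open>U\<close> to the closed interval. The
  set \<open>N\<close> is meant for the temporal nodes.\<close>

definition time_regular :: "real \<Rightarrow> real \<Rightarrow> (real \<Rightarrow> real) \<Rightarrow> (real \<Rightarrow> real) \<Rightarrow> real \<Rightarrow> bool" where
  "time_regular a b u u' u0 \<longleftrightarrow> (\<exists>U N. continuous_on {a..b} U \<and> (\<forall>t\<in>{a<..b}. u t = U t) \<and> U a = u0 \<and>
     finite N \<and> (\<forall>t\<in>{a<..<b} - N. (u has_real_derivative u' t) (at t)))"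

lemma time_regular_tendsto:
  assumes "time_regular a b u u' u0" "a < b"
  shows "(u \<longlongrightarrow> u0) (at_right a)"
proof -
  obtain U where U: "continuous_on {a..b} U" "\<forall>t\<in>{a<..b}. u t = U t" "U a = u0"
    using assms by (auto simp: time_regular_def)
  have "(U \<longlongrightarrow> U a) (at_right a)"
    using U(1) assms(2) by (metis at_within_Icc_at_right atLeastAtMost_iff continuous_on less_imp_le order_refl)
  moreover have "\<forall>\<^sub>F t in at_right a. U t = u t"
    using U(2) assms(2) by (auto simp: eventually_at_right intro!: exI[of _ b])
  ultimately show ?thesis
    using U(3) Lim_transform_eventually by blast
qed

text \<open>The fundamental theorem is applied to the product of the continuous extensions. It
  tolerates finitely many points without derivative, because the extensions do not jump
  there.\<close>

lemma time_regular_integral: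
  assumes u: "time_regular a b u u' u0" and v: "time_regular a b v v' v0" and "a < b"
    and bdd_meas: "bdd_meas (lebesgue_on {a<..b}) u" "bdd_meas (lebesgue_on {a<..b}) u'"
      "bdd_meas (lebesgue_on {a<..b}) v" "bdd_meas (lebesgue_on {a<..b}) v'"
  shows "(LINT t|lebesgue_on {a<..b}. u' t * v t + u t * v' t) = u b * v b - u0 * v0"
proof -
  let ?N = "lebesgue_on {a<..b}"
  obtain U N1 where U: "continuous_on {a..b} U" "\<forall>t\<in>{a<..b}. u t = U t" "U a = u0"
     "finite N1" "\<forall>t\<in>{a<..<b} - N1. (u has_real_derivative u' t) (at t)"
    using u by (auto simp: time_regular_def)
  obtain V N2 where V: "continuous_on {a..b} V" "\<forall>t\<in>{a<..b}. v t = V t" "V a = v0"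
     "finite N2" "\<forall>t\<in>{a<..<b} - N2. (v has_real_derivative v' t) (at t)"
    using v by (auto simp: time_regular_def)
  let ?g = "\<lambda>t. u' t * v t + u t * v' t"
  have "(?g has_integral U b * V b - U a * V a) {a..b}"
  proof (rule fundamental_theorem_of_calculus_interior_strong[of "N1 \<union> N2"])
    fix t assume t: "t \<in> {a<..<b} - (N1 \<union> N2)"
    have "(U has_real_derivative u' t) (at t)" "(V has_real_derivative v' t) (at t)"
      by (rule has_field_derivative_transform_within_open[of u _ _ "{a<..<b}"],
        use U t in auto,
        rule has_field_derivative_transform_within_open[of v _ _ "{a<..<b}"], use V t in auto)
    from DERIV_mult[OF this]
    show "((\<lambda>t. U t * V t) has_vector_derivative ?g t) (at t)"
      using t U(2) V(2) by (simp add: has_real_derivative_iff_has_vector_derivative algebra_simps)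
  qed (use U V \<open>a < b\<close> in \<open>auto intro!: continuous_intros\<close>)
  then have "(?g has_integral U b * V b - U a * V a) {a<..b}"
    by (rule has_integral_spike_set_eq[THEN iffD1, rotated 2]) (auto intro: negligible_subset[OF negligible_sing[of a]])
  moreover have "finite_measure ?N"
    by (intro finite_measure_lebesgue_on bounded_set_imp_lmeasurable) auto
  then have "integrable ?N ?g"
    by (rule bdd_meas_integrable) (intro bdd_meas_intros bdd_meas)
  from has_integral_integral_lebesgue_on[OF this]
  have "(?g has_integral (LINT t|?N. ?g t)) {a<..b}" by simp
  ultimately show ?thesis
    using U(2,3) V(2,3) \<open>a < b\<close> has_integral_unique[of ?g _ "{a<..b}"] by auto
qed

text \<open>Differentiation lowers the degree by one on each piece, which is why the derivative lies
  in the temporal space of the test functions. Continuity is obtained node by node from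
  \<open>H1_no_jump\<close>.\<close>

lemma S_time_regular:
  assumes M: "valid_mesh M" "K < n_elem M" and u: "u \<in> S_time M K"
  shows "\<exists>u'\<in>T_time M K. \<exists>u0. time_regular (t_start M) (t_end M) u u' u0"
proof -
  let ?n = "n_sub M K" and ?x = "node M K"
  note less = node_less[OF M] and mono = node_mono[OF M]
  have "\<forall>k. \<exists>r. k < ?n \<longrightarrow> degree r \<le> deg_t M K k \<and> (\<forall>t\<in>subint M K k. u t = poly r t)"
    using u by (auto simp: S_time_def poly_space_def)
  then obtain r where r: "\<And>k. k < ?n \<Longrightarrow> degree (r k) \<le> deg_t M K k"
     "\<And>k t. k < ?n \<Longrightarrow> t \<in> subint M K k \<Longrightarrow> u t = poly (r k) t"
    by metis
  have H1: "u \<in> H1 (t_start M) (t_end M)"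
    using u by (simp add: S_time_def)
  \<comment> \<open>The index of the subinterval containing \<open>t\<close>. A node belongs to the
    piece on its left, as the pieces are closed on the right.\<close>
  define \<kappa> where "\<kappa> t = (LEAST k. t \<le> ?x (Suc k))" for t
  have \<kappa>: "\<kappa> t = k" if "k < ?n" "t \<in> subint M K k" for k t
    unfolding \<kappa>_def
  proof (rule Least_equality)
    show "t \<le> ?x (Suc k)" using that by (auto simp: subint_def)
    fix j assume j: "t \<le> ?x (Suc j)"
    show "k \<le> j"
    proof (rule ccontr)
      assume "\<not> k \<le> j"
      then have "?x (Suc j) \<le> ?x k"
        using that by (intro mono) auto
      then show False using j that by (auto simp: subint_def)
    qed
  qed
  define u' where "u' t = poly (pderiv (r (\<kappa> t))) t" for t
  have "u' \<in> poly_space (deg_t M K k - 1) (subint M K k)" if "k < ?n" for k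
    unfolding poly_space_def u'_def using \<kappa> that r(1)
    by (intro CollectI exI[of _ "pderiv (r k)"]) (auto simp: degree_pderiv intro: diff_le_mono)
  then have "u' \<in> T_time M K"
    by (simp add: T_time_eq[OF M])
  \<comment> \<open>At the initial time, where \<open>u\<close> is unspecified, the first polynomial
    supplies the value.\<close>
  define U where "U t = (if t \<le> ?x 0 then poly (r 0) t else u t)" for t
  have U_u: "U t = u t" if "t \<in> slab M" for t
    using that node_0[OF M] by (simp add: U_def slab_def)
  have cont: "continuous_on {?x 0..?x j} U" if "j \<le> ?n" for j
    using that
  proof (induction j)
    case 0
    then show ?case by simp
  next
    case (Suc j)
    then have j: "j < ?n" by simp
    have U_r: "U t = poly (r j) t" if "t \<in> {?x j..?x (Suc j)}" for t
    proof (cases "t = ?x j")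
      case False
      then have "t \<in> subint M K j" using that by (auto simp: subint_def)
      then show ?thesis using U_u r(2) j subint_slab[OF M] by fastforce
    next
      case True
      show ?thesis
      proof (cases j)
        case 0
        then show ?thesis using True by (simp add: U_def)
      next
        case (Suc i)
        then have i: "i < ?n" "?x i < ?x j" using j less by auto
        \<comment> \<open>At an inner node \<open>u\<close> takes the value of the polynomial on the
          left; for continuity from the right, the next polynomial must take it as well.\<close>
        have "poly (r i) (?x j) = poly (r j) (?x j)"
        proof (rule H1_no_jump[OF H1])
          show "t_start M \<le> ?x i" "?x (Suc j) \<le> t_end M"
            using mono[of 0 i] mono[of "Suc j" ?n] i j by (simp_all add: node_0[OF M] node_end[OF M])
          show "u t = poly (r i) t" if "t \<in> {?x i<..?x j}" for t
            using that r(2) i Suc by (auto simp: subint_def)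
          show "u t = poly (r j) t" if "t \<in> {?x j<..?x (Suc j)}" for t
            using that r(2) j by (auto simp: subint_def)
        qed (use i j less in auto)
        moreover have "?x j \<in> subint M K i" using i Suc by (auto simp: subint_def)
        ultimately show ?thesis
          using True r(2)[of i "?x j"] U_u[of "?x j"] i subint_slab[OF M, of i] by auto
      qed
    qed
    have "?x 0 \<le> ?x j" "?x j \<le> ?x (Suc j)"
      using mono j less by (auto intro: less_imp_le)
    then have "{?x 0..?x (Suc j)} = {?x 0..?x j} \<union> {?x j..?x (Suc j)}" by auto
    moreover have "continuous_on {?x j..?x (Suc j)} U"
      by (rule continuous_on_cong[THEN iffD2, OF refl U_r]) (auto intro: continuous_intros)
    ultimately show ?case
      using Suc by (auto intro: continuous_on_closed_Un)
  qed
  have "(u has_real_derivative u' t) (at t)" if t: "t \<in> {t_start M<..<t_end M} - ?x ` {..?n}" for t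
  proof -
    obtain k where k: "k < ?n" "t \<in> subint M K k"
      using slab_subint[OF M, of t] t by (auto simp: slab_def)
    have "t \<noteq> ?x (Suc k)" using t k(1) by auto
    then have "t \<in> {?x k<..<?x (Suc k)}" using k by (auto simp: subint_def)
    then have "(u has_real_derivative poly (pderiv (r k)) t) (at t)"
      using r(2)[OF k(1)]
      by (intro has_field_derivative_transform_within_open[OF poly_DERIV, of "{?x k<..<?x (Suc k)}"])
        (auto simp: subint_def)
    then show ?thesis by (simp add: u'_def \<kappa>[OF k])
  qed
  moreover have "\<forall>t\<in>{t_start M<..t_end M}. u t = U t"
    using U_u by (simp add: slab_def)
  ultimately have "time_regular (t_start M) (t_end M) u u' (U (t_start M))"
    using cont[of ?n] unfolding time_regular_def
    by (intro exI[of _ U] exI[of _ "?x ` {..?n}"]) (auto simp: node_0[OF M] node_end[OF M])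
  then show ?thesis
    using \<open>u' \<in> T_time M K\<close> by blast
qed

section \<open>Geometry of the elements\<close>

definition has_C1 :: "'a::real_normed_vector set \<Rightarrow> ('a \<Rightarrow> 'b::real_normed_vector) \<Rightarrow> ('a \<Rightarrow> 'a \<Rightarrow> 'b) \<Rightarrow> bool" where
  "has_C1 U f f' \<longleftrightarrow> (\<forall>x\<in>U. (f has_derivative f' x) (at x)) \<and> (\<forall>h. continuous_on U (\<lambda>x. f' x h))"

lemma has_C1_continuous: "has_C1 U f f' \<Longrightarrow> continuous_on U f"
  unfolding has_C1_def
  by (meson continuous_at_imp_continuous_on has_derivative_continuous)

lemma has_C1_subset: "has_C1 U f f' \<Longrightarrow> V \<subseteq> U \<Longrightarrow> has_C1 V f f'"
  unfolding has_C1_def using continuous_on_subset by blast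

lemma has_C1_const: "has_C1 U (\<lambda>x. c) (\<lambda>x h. 0)"
  by (simp add: has_C1_def)

lemma has_C1_bounded_linear: "bounded_linear f \<Longrightarrow> has_C1 U f (\<lambda>x. f)"
  by (simp add: has_C1_def bounded_linear_imp_has_derivative)

lemma has_C1_add: "has_C1 U f f' \<Longrightarrow> has_C1 U g g' \<Longrightarrow> has_C1 U (\<lambda>x. f x + g x) (\<lambda>x h. f' x h + g' x h)"
  by (auto simp: has_C1_def intro!: derivative_intros continuous_intros)

lemma has_C1_bilinear:
  assumes "bounded_bilinear b" "has_C1 U f f'" "has_C1 U g g'"
  shows "has_C1 U (\<lambda>x. b (f x) (g x)) (\<lambda>x h. b (f x) (g' x h) + b (f' x h) (g x))"
  using assms(2,3) has_C1_continuous[OF assms(2)] has_C1_continuous[OF assms(3)]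
  by (auto simp: has_C1_def intro!: bounded_bilinear.FDERIV[OF assms(1)]
      bounded_bilinear.continuous_on[OF assms(1)] continuous_intros)

lemma has_C1_inverse:
  fixes f :: "'a::real_normed_vector \<Rightarrow> real"
  assumes "has_C1 U f f'" "\<And>x. x \<in> U \<Longrightarrow> f x \<noteq> 0"
  shows "has_C1 U (\<lambda>x. inverse (f x)) (\<lambda>x h. - (inverse (f x) * f' x h * inverse (f x)))"
  using assms has_C1_continuous[OF assms(1)]
  by (auto simp: has_C1_def intro!: has_derivative_inverse continuous_intros)

definition C1 :: "'a::real_normed_vector set \<Rightarrow> ('a \<Rightarrow> 'b::real_normed_vector) \<Rightarrow> bool" where
  "C1 U f \<longleftrightarrow> (\<exists>f'. has_C1 U f f')"

lemma C1_const: "C1 U (\<lambda>x. c)"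
  and C1_bounded_linear: "bounded_linear g \<Longrightarrow> C1 U g"
  and C1_add: "C1 U f \<Longrightarrow> C1 U h \<Longrightarrow> C1 U (\<lambda>x. f x + h x)"
  and C1_bilinear: "bounded_bilinear b \<Longrightarrow> C1 U k \<Longrightarrow> C1 U l \<Longrightarrow> C1 U (\<lambda>x. b (k x) (l x))"
  unfolding C1_def using has_C1_const has_C1_bounded_linear has_C1_add has_C1_bilinear by blast+

lemma C1_inverse: 
  fixes f :: "'a::real_normed_vector \<Rightarrow> real"
  shows "C1 U f \<Longrightarrow> (\<And>x. x \<in> U \<Longrightarrow> f x \<noteq> 0) \<Longrightarrow> C1 U (\<lambda>x. inverse (f x))"
  unfolding C1_def using has_C1_inverse by blast

lemma C1_sum: "(\<And>i. i \<in> I \<Longrightarrow> C1 U (f i)) \<Longrightarrow> C1 U (\<lambda>x. \<Sum>i\<in>I. f i x)"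
  by (induction I rule: infinite_finite_induct) (auto intro: C1_const C1_add)

lemma C1_mult: 
  fixes f :: "'a::real_normed_vector \<Rightarrow> real"
  shows "C1 U f \<Longrightarrow> C1 U g \<Longrightarrow> C1 U (\<lambda>x. f x * g x)"
  by (rule C1_bilinear[OF bounded_bilinear_mult])

lemma C1_power: 
  fixes f :: "'a::real_normed_vector \<Rightarrow> real"
  shows "C1 U f \<Longrightarrow> C1 U (\<lambda>x. f x ^ n)"
  by (induction n) (auto intro: C1_const C1_mult)

lemma C1_scaleR: "C1 U f \<Longrightarrow> C1 U g \<Longrightarrow> C1 U (\<lambda>x. f x *\<^sub>R g x)"
  by (rule C1_bilinear[OF bounded_bilinear_scaleR])

lemma bounded_bilinear_cross3: "bounded_bilinear cross3"
  using bilinear_cross bilinear_conv_bounded_bilinear by blast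

lemma C1_cross3: "C1 U f \<Longrightarrow> C1 U g \<Longrightarrow> C1 U (\<lambda>x. cross3 (f x) (g x))"
  by (rule C1_bilinear[OF bounded_bilinear_cross3])

lemma C1_inner: "C1 U f \<Longrightarrow> C1 U g \<Longrightarrow> C1 U (\<lambda>x. f x \<bullet> g x)"
  by (rule C1_bilinear[OF bounded_bilinear_inner])

lemma C1_nth: "C1 U (\<lambda>x::real^'n. x $ i)"
  by (intro C1_bounded_linear bounded_linear_vec_nth)

lemma C1_continuous: "C1 U f \<Longrightarrow> continuous_on U f"
  using has_C1_continuous C1_def by blast

lemma C1_subset: "C1 U f \<Longrightarrow> V \<subseteq> U \<Longrightarrow> C1 V f"
  unfolding C1_def using has_C1_subset by blast

lemma Ck_on_1_C1: "Ck_on (Suc 0) U f \<Longrightarrow> C1 U f"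
  by (auto simp: C1_def has_C1_def frechet_derivative_works intro!: exI[of _ "\<lambda>x. frechet_derivative f (at x)"])

lemma C1_Q_space:
  assumes "q \<in> Q_space p" shows "C1 U q"
proof -
  obtain c where "\<And>\<xi>. q \<xi> =
      (\<Sum>i\<le>p 1. \<Sum>j\<le>p 2. \<Sum>k\<le>p 3. c i j k * (\<xi>$1)^i * (\<xi>$2)^j * (\<xi>$3)^k)"
    using assms by (auto simp: Q_space_def)
  then have "q = (\<lambda>\<xi>. \<Sum>i\<le>p 1. \<Sum>j\<le>p 2. \<Sum>k\<le>p 3. c i j k * (\<xi>$1)^i * (\<xi>$2)^j * (\<xi>$3)^k)"
    by blast
  then show ?thesis
    by (auto intro!: C1_sum C1_mult C1_power C1_nth C1_const)
qed

text \<open>Cramer's rule for the inverse transpose. The explicit form makes its dependence on \<open>J\<close> visibly smooth.\<close>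

definition jinvT :: "real^3^3 \<Rightarrow> real^3 \<Rightarrow> real^3" where
  "jinvT J w = inverse (det J) *\<^sub>R (w$1 *\<^sub>R cross3 (column 2 J) (column 3 J)
     + w$2 *\<^sub>R cross3 (column 3 J) (column 1 J) + w$3 *\<^sub>R cross3 (column 1 J) (column 2 J))"

lemma det_columns: "det (J::real^3^3) = column 1 J \<bullet> cross3 (column 2 J) (column 3 J)"
  by (simp add: det_3 cross3_def inner_vec_def sum_3 column_def algebra_simps)

lemma transpose_jinvT: "det J \<noteq> 0 \<Longrightarrow> transpose J *v jinvT J w = w"
proof -
  assume d: "det J \<noteq> 0"
  have "(transpose J *v jinvT J w) = inverse (det J) *\<^sub>R (det J *\<^sub>R w)"
    unfolding jinvT_def matrix_vector_mult_scaleR det_3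
    by (simp add: vec_eq_iff forall_3 matrix_vector_mult_def transpose_def sum_3 cross3_def column_def algebra_simps)
  then show ?thesis using d by simp
qed

lemma jinvT_unique:
  assumes "det J \<noteq> 0" shows "transpose J *v y = w \<longleftrightarrow> y = jinvT J w"
proof -
  have "invertible (transpose J)"
    using assms by (simp add: invertible_det_nz)
  then have "inj ((*v) (transpose J))"
    by (metis invertible_def matrix_left_invertible_injective)
  then show ?thesis
    using transpose_jinvT[OF assms] by (metis injD)
qed

lemma matrix_inv_transpose:
  assumes "det (J::real^3^3) \<noteq> 0" shows "matrix_inv (transpose J) *v w = jinvT J w"
proof -
  have "invertible (transpose J)"
    using assms by (simp add: invertible_det_nz)
  then have "transpose J ** matrix_inv (transpose J) = mat 1"
    unfolding invertible_def matrix_inv_def by (rule someI2_ex) simp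
  then have "transpose J *v (matrix_inv (transpose J) *v w) = w"
    by (simp add: matrix_vector_mul_assoc)
  then show ?thesis
    using jinvT_unique[OF assms] by blast
qed

text \<open>For invertible \<open>J\<close> this is the inverse of \<open>J\<close>, obtained from
  the inverse transpose by adjointness: its components are inner products with the vectors
  \<open>jinvT J (axis i 1)\<close>. It thus inherits their smooth dependence on
  \<open>J\<close>.\<close>

definition jinv :: "real^3^3 \<Rightarrow> real^3 \<Rightarrow> real^3" where
  "jinv J h = (\<chi> i. h \<bullet> jinvT J (axis i 1))"

lemma jinv_inverse: "det J \<noteq> 0 \<Longrightarrow> jinv J (J *v h) = h"
proof -
  assume d: "det J \<noteq> 0"
  have "(J *v h) \<bullet> jinvT J (axis i 1) = h \<bullet> (transpose J *v jinvT J (axis i 1))" for i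
    by (metis dot_lmul_matrix inner_commute transpose_matrix_vector transpose_transpose)
  then have "(J *v h) \<bullet> jinvT J (axis i 1) = h $ i" for i
    unfolding transpose_jinvT[OF d] by (simp add: inner_axis)
  then show ?thesis
    by (simp add: jinv_def vec_eq_iff)
qed

lemma jinv_linear: "bounded_linear (jinv J)"
  unfolding jinv_def 
  by (intro linear_conv_bounded_linear[THEN iffD1] linearI) (auto simp: vec_eq_iff inner_add_left)

lemma inner_jinv: "h \<bullet> jinvT J w = jinv J h \<bullet> w"
proof -
  have "jinvT J w = (\<Sum>i\<in>UNIV. w$i *\<^sub>R jinvT J (axis i 1))"
    by (simp add: jinvT_def sum_3 axis_def scaleR_add_right mult.commute)
  then show ?thesis
    by (simp add: inner_sum_right jinv_def inner_vec_def[of "vec_lambda _"] mult.commute)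
qed

lemma jinvT_eq_0: "det J \<noteq> 0 \<Longrightarrow> jinvT J w = 0 \<longleftrightarrow> w = 0"
  using transpose_jinvT[of J w] by (auto simp: jinvT_def)

section \<open>Covariant fields on a single element\<close>

definition ref_inv :: "(real^3 \<Rightarrow> real^3) \<Rightarrow> real^3 \<Rightarrow> real^3" where
  "ref_inv F = inv_into (cbox 0 1) F"

text \<open>The covariant Piola transform of \<open>q\<close>, that is, the field on the element
  whose pull-back to the cube is \<open>q\<close>. The formula also makes sense on the boundary of
  the element, where it will give the traces.\<close>

definition cov_field :: "(real^3 \<Rightarrow> real^3) \<Rightarrow> (real^3 \<Rightarrow> real^3) \<Rightarrow> real^3 \<Rightarrow> real^3" where
  "cov_field F q x = jinvT (jacobian F (at (ref_inv F x))) (q (ref_inv F x))"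

context
  fixes F :: "real^3 \<Rightarrow> real^3"
  assumes F: "smooth_invertible F"
begin

text \<open>The Jacobian is assumed to be invertible on the closed cube only. By continuity of the
  determinant it is so on a neighbourhood, where boundary points of the cube can be treated like
  interior ones. Two derivatives of \<open>F\<close> are used, because the columns of the Jacobian
  have to be continuously differentiable themselves.\<close>

lemma smooth_neighbourhood:
  "\<exists>U. open U \<and> cbox 0 1 \<subseteq> U \<and> (\<forall>\<xi>\<in>U. (F has_derivative (*v) (jacobian F (at \<xi>))) (at \<xi>)) \<and>
     (\<forall>i. C1 U (\<lambda>\<xi>. column i (jacobian F (at \<xi>)))) \<and> (\<forall>\<xi>\<in>U. det (jacobian F (at \<xi>)) \<noteq> 0)"
proof -
  obtain U where U: "open U" "cbox 0 1 \<subseteq> U" "\<And>k. Ck_on k U F"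
    using F by (auto simp: smooth_invertible_def)
  have diff: "F differentiable (at \<xi>)" if "\<xi> \<in> U" for \<xi>
    using U(3)[of 1] that by auto
  have col: "column i (jacobian F (at \<xi>)) = frechet_derivative F (at \<xi>) (axis i 1)" if "\<xi> \<in> U" for i \<xi>
    using diff[OF that] matrix_works[of "frechet_derivative F (at \<xi>)" "axis i 1"]
    by (simp add: jacobian_def linear_frechet_derivative flip: matrix_vector_mult_basis)
  have "C1 U (\<lambda>\<xi>. frechet_derivative F (at \<xi>) (axis i 1))" for i
    using U(3)[of "Suc (Suc 0)"] by (intro Ck_on_1_C1) auto
  then obtain f' where f': "\<And>i. has_C1 U (\<lambda>\<xi>. frechet_derivative F (at \<xi>) (axis i 1)) (f' i)"
    unfolding C1_def by metis
  have "has_C1 U (\<lambda>\<xi>. column i (jacobian F (at \<xi>))) (f' i)" for i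
    using f'[of i] col U(1)
    by (auto simp: has_C1_def intro: has_derivative_transform_within_open)
  then have C1col: "C1 U (\<lambda>\<xi>. column i (jacobian F (at \<xi>)))" for i
    unfolding C1_def by blast
  define U' where "U' = {\<xi> \<in> U. det (jacobian F (at \<xi>)) \<noteq> 0}"
  have "continuous_on U (\<lambda>\<xi>. det (jacobian F (at \<xi>)))"
    unfolding det_columns by (intro C1_continuous C1_inner C1_cross3 C1col)
  then have "open U'"
    unfolding U'_def using continuous_open_preimage[OF _ U(1), of "\<lambda>\<xi>. det (jacobian F (at \<xi>))" "- {0}"]
    by (auto simp: vimage_def Int_def)
  moreover have "cbox 0 1 \<subseteq> U'"
    using F U by (auto simp: U'_def smooth_invertible_def)
  moreover have "C1 U' (\<lambda>\<xi>. column i (jacobian F (at \<xi>)))" for i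
    by (rule C1_subset[OF C1col]) (auto simp: U'_def)
  moreover have "(F has_derivative (*v) (jacobian F (at \<xi>))) (at \<xi>)" if "\<xi> \<in> U'" for \<xi>
    using diff[of \<xi>] that by (simp add: U'_def jacobian_works)
  ultimately show ?thesis
    by (intro exI[of _ U']) (auto simp: U'_def)
qed

lemma C1_jinvT:
  assumes "\<And>i. C1 U (\<lambda>\<xi>. column i (jacobian F (at \<xi>)))" "\<And>\<xi>. \<xi> \<in> U \<Longrightarrow> det (jacobian F (at \<xi>)) \<noteq> 0"
    and "\<And>i. C1 U (\<lambda>\<xi>. q \<xi> $ i)"
  shows "C1 U (\<lambda>\<xi>. jinvT (jacobian F (at \<xi>)) (q \<xi>))"
proof -
  have "C1 U (\<lambda>\<xi>. det (jacobian F (at \<xi>)))"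
    unfolding det_columns by (intro C1_inner C1_cross3 assms)
  then show ?thesis
    unfolding jinvT_def by (intro C1_scaleR C1_add C1_cross3 C1_inverse assms)
qed

lemma det_nz: "\<xi> \<in> cbox 0 1 \<Longrightarrow> det (jacobian F (at \<xi>)) \<noteq> 0"
  using F by (auto simp: smooth_invertible_def)

lemma F_deriv: "\<xi> \<in> cbox 0 1 \<Longrightarrow> (F has_derivative (*v) (jacobian F (at \<xi>))) (at \<xi>)"
  using smooth_neighbourhood by blast

lemma F_inj: "inj_on F (cbox 0 1)"
  using F by (auto simp: smooth_invertible_def)

lemma F_cont: "continuous_on (cbox 0 1) F"
  using F_deriv by (meson continuous_at_imp_continuous_on has_derivative_continuous)

lemma ref_inv_F: "\<xi> \<in> cbox 0 1 \<Longrightarrow> ref_inv F (F \<xi>) = \<xi>"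
  by (simp add: ref_inv_def inv_into_f_f F_inj)

lemma F_ref_inv: "x \<in> F ` cbox 0 1 \<Longrightarrow> F (ref_inv F x) = x" "x \<in> F ` cbox 0 1 \<Longrightarrow> ref_inv F x \<in> cbox 0 1"
  using ref_inv_F by auto

lemma ref_inv_cont: "continuous_on (F ` cbox 0 1) (ref_inv F)"
  using continuous_on_inv[OF F_cont compact_cbox] ref_inv_F by blast

lemma ocube_cube: "box 0 1 \<subseteq> cbox (0::real^3) 1"
  by (rule box_subset_cbox)

lemma open_F_ocube: "open (F ` box 0 1)"
  using ocube_cube
  by (intro invariance_of_domain continuous_on_subset[OF F_cont] inj_on_subset[OF F_inj]) auto

lemma compact_F_cube: "compact (F ` cbox 0 1)"
  using compact_continuous_image[OF F_cont] by simp

text \<open>Invariance of domain in both directions: applied to \<open>F\<close> it shows that the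
  image of the open cube is open, applied to \<open>ref_inv F\<close> that interior points come from
  the open cube.\<close>

lemma interior_F_cube: "interior (F ` cbox 0 1) = F ` box 0 1"
proof
  show "F ` box 0 1 \<subseteq> interior (F ` cbox 0 1)"
    by (rule interior_maximal[OF image_mono[OF ocube_cube] open_F_ocube])
  have "inj_on (ref_inv F) (F ` cbox 0 1)"
    using F_ref_inv by (metis inj_onI)
  then have "open (ref_inv F ` interior (F ` cbox 0 1))"
    using ref_inv_cont interior_subset
    by (intro invariance_of_domain) (auto intro: continuous_on_subset inj_on_subset)
  moreover have "ref_inv F ` interior (F ` cbox 0 1) \<subseteq> cbox 0 1"
    using F_ref_inv interior_subset by blast
  ultimately have "ref_inv F ` interior (F ` cbox 0 1) \<subseteq> interior (cbox 0 1)"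
    by (intro interior_maximal)
  then have sub: "ref_inv F ` interior (F ` cbox 0 1) \<subseteq> box 0 1"
    by simp
  show "interior (F ` cbox 0 1) \<subseteq> F ` box 0 1"
  proof
    fix x assume x: "x \<in> interior (F ` cbox 0 1)"
    then have "F (ref_inv F x) = x" using F_ref_inv interior_subset by blast
    then show "x \<in> F ` box 0 1" using sub x by (metis image_eqI image_subset_iff)
  qed
qed

lemma ref_inv_deriv:
  assumes "x \<in> F ` box 0 1"
  shows "(ref_inv F has_derivative jinv (jacobian F (at (ref_inv F x)))) (at x)"
proof -
  have x: "x \<in> F ` cbox 0 1" using assms ocube_cube by blast
  have "(ref_inv F has_derivative jinv (jacobian F (at (ref_inv F x)))) (at (F (ref_inv F x)))"
  proof (rule has_derivative_inverse[OF compact_cbox[of 0 1], where f = F and x = "ref_inv F x"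
        and f' = "(*v) (jacobian F (at (ref_inv F x)))"])
    show "F (ref_inv F x) \<in> interior (F ` cbox 0 1)"
      using assms x by (simp add: interior_F_cube F_ref_inv)
    show "jinv (jacobian F (at (ref_inv F x))) \<circ> (*v) (jacobian F (at (ref_inv F x))) = id"
      using jinv_inverse[OF det_nz[OF F_ref_inv(2)[OF x]]] by auto
  qed (use x in \<open>auto simp: F_ref_inv ref_inv_F jinv_linear F_cont intro: F_deriv\<close>)
  then show ?thesis using x by (simp add: F_ref_inv)
qed

text \<open>The field and its directional derivatives have continuous versions on the compact
  element. The first yields traces, the second boundedness of the curl.\<close>

lemma cov_field_C1:
  assumes q: "q \<in> Q3_space p"
  shows "continuous_on (F ` cbox 0 1) (cov_field F q)"
    and "\<exists>D. (\<forall>x\<in>F ` box 0 1. (cov_field F q has_derivative D x) (at x)) \<and>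
          (\<forall>h. continuous_on (F ` cbox 0 1) (\<lambda>x. D x h))"
proof -
  obtain U where U: "open U" "cbox 0 1 \<subseteq> U" "\<And>i. C1 U (\<lambda>\<xi>. column i (jacobian F (at \<xi>)))"
      "\<And>\<xi>. \<xi> \<in> U \<Longrightarrow> det (jacobian F (at \<xi>)) \<noteq> 0"
    using smooth_neighbourhood by blast
  have C1R: "C1 U (\<lambda>\<xi>. jinvT (jacobian F (at \<xi>)) (w \<xi>))" if "\<And>i. C1 U (\<lambda>\<xi>. w \<xi> $ i)" for w
    by (intro C1_jinvT U that)
  have "C1 U (\<lambda>\<xi>. q \<xi> $ i)" for i
    using q by (intro C1_Q_space) (auto simp: Q3_space_def)
  then obtain R' where R': "has_C1 U (\<lambda>\<xi>. jinvT (jacobian F (at \<xi>)) (q \<xi>)) R'"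
    using C1R unfolding C1_def by blast
  have inv: "ref_inv F ` (F ` cbox 0 1) \<subseteq> cbox 0 1" by (auto simp: ref_inv_F)
  have comp: "continuous_on (F ` cbox 0 1) (\<lambda>x. f (ref_inv F x))" if "continuous_on U f" for f :: "real^3 \<Rightarrow> 'z::topological_space"
    by (rule continuous_on_compose2[OF that ref_inv_cont]) (use inv U(2) in blast)
  show "continuous_on (F ` cbox 0 1) (cov_field F q)"
    unfolding cov_field_def[abs_def]
    by (rule comp[OF has_C1_continuous[OF R']])
  define D where "D x h = R' (ref_inv F x) (jinv (jacobian F (at (ref_inv F x))) h)" for x h
  have der: "(cov_field F q has_derivative D x) (at x)" if "x \<in> F ` box 0 1" for x
  proof -
    have "ref_inv F x \<in> U"
      using that U(2) ocube_cube F_ref_inv(2)[of x] by blast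
    then have "((\<lambda>\<xi>. jinvT (jacobian F (at \<xi>)) (q \<xi>)) has_derivative R' (ref_inv F x)) (at (ref_inv F x))"
      using R' by (auto simp: has_C1_def)
    from has_derivative_compose[OF ref_inv_deriv[OF that] this] show ?thesis
      by (simp add: D_def[abs_def] cov_field_def[abs_def])
  qed
  have "continuous_on (F ` cbox 0 1) (\<lambda>x. D x h)" for h
  proof -
    have R'c: "continuous_on U (\<lambda>\<xi>. R' \<xi> v)" for v
      using R' by (simp add: has_C1_def)
    have lin: "linear (R' \<xi>)" if "\<xi> \<in> U" for \<xi>
      using R' that has_derivative_linear by (auto simp: has_C1_def)
    \<comment> \<open>The chain rule applies \<open>R'\<close> to a direction that varies with
      \<open>x\<close>, while continuity of \<open>R'\<close> is known for fixed directions only.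
      Expansion in the standard basis removes the dependence.\<close>
    have "continuous_on (F ` cbox 0 1) (\<lambda>x. \<Sum>i\<in>UNIV. (h \<bullet> jinvT (jacobian F (at (ref_inv F x))) (axis i 1)) *\<^sub>R
        R' (ref_inv F x) (axis i 1))"
      by (intro continuous_intros comp[OF R'c] comp[OF C1_continuous] C1R C1_const)
    moreover have "D x h = (\<Sum>i\<in>UNIV. (h \<bullet> jinvT (jacobian F (at (ref_inv F x))) (axis i 1)) *\<^sub>R
        R' (ref_inv F x) (axis i 1))" if "x \<in> F ` cbox 0 1" for x
    proof -
      have "ref_inv F x \<in> U" using F_ref_inv(2)[OF that] U(2) by blast
      note lin = lin[OF this]
      have "jinv (jacobian F (at (ref_inv F x))) h = (\<Sum>i\<in>UNIV. (h \<bullet> jinvT (jacobian F (at (ref_inv F x))) (axis i 1)) *\<^sub>R axis i 1)"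
        using basis_expansion[of "jinv (jacobian F (at (ref_inv F x))) h"]
        by (simp add: jinv_def vector_scalar_mult_def scalar_mult_eq_scaleR)
      then show ?thesis
        by (simp add: D_def linear_sum[OF lin] linear_cmul[OF lin])
    qed
    ultimately show ?thesis
      by (simp cong: continuous_on_cong)
  qed
  then show "\<exists>D. (\<forall>x\<in>F ` box 0 1. (cov_field F q has_derivative D x) (at x)) \<and>
          (\<forall>h. continuous_on (F ` cbox 0 1) (\<lambda>x. D x h))"
    using der by blast
qed

lemma closure_F_ocube: "F ` cbox 0 1 \<subseteq> closure (F ` box 0 1)"
proof -
  have "closure (box 0 1) = cbox (0::real^3) 1"
    by (rule closure_box) (auto simp: box_ne_empty(2) inner_axis Basis_vec_def)
  then show ?thesis
    using image_closure_subset[of "box 0 1" F "closure (F ` box 0 1)"] F_cont closure_subset[of "F ` box 0 1"]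
    by (auto simp del: closure_box)
qed

text \<open>\<open>Lim\<close> is determined only for a nontrivial filter. Every point of the closed
  element, on edges and corners too, is a limit point of the interior.\<close>

lemma trace_lim:
  assumes x: "x \<in> F ` cbox 0 1" and Q: "continuous_on (F ` cbox 0 1) Q" and eq: "\<And>y. y \<in> F ` box 0 1 \<Longrightarrow> f y = Q y"
  shows "Lim (at x within interior (F ` cbox 0 1)) f = Q x"
proof (rule tendsto_Lim)
  have "x islimpt F ` box 0 1"
  proof (cases "x \<in> F ` box 0 1")
    case True
    then show ?thesis using open_F_ocube interior_limit_point interior_open by blast
  next
    case False
    then show ?thesis using closure_F_ocube x by (auto simp: closure_def)
  qed
  then show "at x within interior (F ` cbox 0 1) \<noteq> bot"
    by (simp add: interior_F_cube trivial_limit_within)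
  have "(Q \<longlongrightarrow> Q x) (at x within F ` box 0 1)"
    using Q x by (meson continuous_on tendsto_within_subset image_mono ocube_cube)
  moreover have "\<forall>\<^sub>F y in at x within F ` box 0 1. Q y = f y"
    using eq by (auto simp: eventually_at_filter)
  ultimately show "(f \<longlongrightarrow> Q x) (at x within interior (F ` cbox 0 1))"
    unfolding interior_F_cube by (rule Lim_transform_eventually)
qed

lemma negligible_F_frontier: "negligible (F ` (cbox 0 1 - box 0 1))"
proof (rule negligible_differentiable_image_negligible[OF order_refl negligible_frontier_interval])
  show "F differentiable_on cbox 0 1 - box 0 1"
    using F_deriv unfolding differentiable_on_def differentiable_def
    by (metis Diff_iff has_derivative_at_withinI)
qed

lemma F_ocube_lmeasurable: "F ` box 0 1 \<in> lmeasurable"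
  using open_F_ocube bounded_subset[OF compact_imp_bounded[OF compact_F_cube] image_mono[OF ocube_cube]]
  by (intro lmeasurable_open) auto

end

section \<open>Inverse maps at the boundary of an element\<close>

lemma mult_jinv: "det J \<noteq> 0 \<Longrightarrow> J *v jinv J h = h"
proof -
  assume d: "det J \<noteq> 0"
  then obtain B where "J ** B = mat 1"
    using invertible_det_nz invertible_def by blast
  then have "J *v (B *v h) = h"
    by (simp add: matrix_vector_mul_assoc)
  then show ?thesis
    using jinv_inverse[OF d, of "B *v h"] by simp
qed

text \<open>The inverse function theorem at points of the closed cube. At the boundary
  \<open>ref_inv\<close> inverts \<open>F\<close> on one side only, whereas \<open>g\<close> does so
  on a full neighbourhood.\<close>

lemma smooth_local_inverse:
  assumes F: "smooth_invertible F" and \<xi>: "\<xi> \<in> cbox 0 1"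
  shows "\<exists>U V g. open U \<and> open V \<and> \<xi> \<in> U \<and> F \<xi> \<in> V \<and> homeomorphism U V F g \<and>
     (g has_derivative jinv (jacobian F (at \<xi>))) (at (F \<xi>))"
proof -
  let ?J = "\<lambda>\<xi>. jacobian F (at \<xi>)"
  obtain U where U: "open U" "cbox 0 1 \<subseteq> U" "\<And>\<xi>. \<xi> \<in> U \<Longrightarrow> (F has_derivative (*v) (?J \<xi>)) (at \<xi>)"
     "\<And>i. C1 U (\<lambda>\<xi>. column i (?J \<xi>))" "\<And>\<xi>. \<xi> \<in> U \<Longrightarrow> det (?J \<xi>) \<noteq> 0"
    using smooth_neighbourhood[OF F] by blast
  define f' where "f' \<xi> = Blinfun ((*v) (?J \<xi>))" for \<xi>
  have f'[simp]: "blinfun_apply (f' \<xi>) = (*v) (?J \<xi>)" for \<xi>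
    by (simp add: f'_def bounded_linear_Blinfun_apply)
  have cont: "continuous_on U f'"
    by (rule continuous_on_blinfun_componentwise)
      (auto simp: Basis_vec_def matrix_vector_mult_basis intro: C1_continuous[OF U(4)])
  have inv: "Blinfun (jinv (?J \<xi>)) o\<^sub>L f' \<xi> = id_blinfun"
    using U \<xi> by (intro blinfun_eqI) (auto simp: bounded_linear_Blinfun_apply jinv_linear jinv_inverse)
  have xi: "\<xi> \<in> U" using U(2) \<xi> by blast
  have der: "(F has_derivative blinfun_apply (f' x)) (at x)" if "x \<in> U" for x
    using U(3)[OF that] by simp
  obtain U' V g g' where g: "open U'" "U' \<subseteq> U" "\<xi> \<in> U'" "open V" "F \<xi> \<in> V"
      "homeomorphism U' V F g" "\<And>y. y \<in> V \<Longrightarrow> (g has_derivative (g' y)) (at y)"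
      "\<And>y. y \<in> V \<Longrightarrow> g' y = inv (blinfun_apply (f'(g y)))"
      "\<And>y. y \<in> V \<Longrightarrow> bij (blinfun_apply (f'(g y)))"
    by (rule inverse_function_theorem[OF U(1) _ cont xi inv]) (erule der,
        rule that, assumption+)
  have "g (F \<xi>) = \<xi>"
    using g(3,6) by (auto simp: homeomorphism_def)
  moreover have "inv ((*v) (?J \<xi>)) = jinv (?J \<xi>)"
    using U \<xi> by (intro inv_equality) (auto simp: jinv_inverse mult_jinv)
  ultimately have "g' (F \<xi>) = jinv (?J \<xi>)"
    using g(8)[OF g(5)] by simp
  then show ?thesis
    using g(1,3-6) g(7)[OF g(5)] by metis
qed

text \<open>By continuity, \<open>ref_inv F\<close> maps points of the element near
  \<open>F \<xi>\<close> into the set \<open>U\<close> on which the local inverse undoes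
  \<open>F\<close>, so the two inverses agree there.\<close>

lemma ref_inv_deriv_within:
  assumes F: "smooth_invertible F" and \<xi>: "\<xi> \<in> cbox 0 1"
  shows "(ref_inv F has_derivative jinv (jacobian F (at \<xi>))) (at (F \<xi>) within F ` cbox 0 1)"
proof -
  obtain U V g where g: "open U" "open V" "\<xi> \<in> U" "F \<xi> \<in> V" "homeomorphism U V F g"
     "(g has_derivative jinv (jacobian F (at \<xi>))) (at (F \<xi>))"
    using smooth_local_inverse[OF assms] by blast
  have "\<forall>\<^sub>F y in at (F \<xi>) within F ` cbox 0 1. ref_inv F y \<in> U"
  proof (rule topological_tendstoD[OF _ g(1)])
    show "(ref_inv F \<longlongrightarrow> ref_inv F (F \<xi>)) (at (F \<xi>) within F ` cbox 0 1)"
      using ref_inv_cont[OF F] \<xi> by (meson continuous_on imageI)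
  qed (use ref_inv_F[OF F \<xi>] g(3) in simp)
  moreover have "\<forall>\<^sub>F y in at (F \<xi>) within F ` cbox 0 1. y \<in> F ` cbox 0 1"
    by (simp add: eventually_at_filter)
  ultimately have ev: "\<forall>\<^sub>F y in at (F \<xi>) within F ` cbox 0 1. g y = ref_inv F y"
  proof eventually_elim
    case (elim y)
    then show ?case
      using F_ref_inv(1)[OF F elim(2)] g(5) by (metis homeomorphism_apply1)
  qed
  have "g (F \<xi>) = ref_inv F (F \<xi>)"
    using g(3,5) ref_inv_F[OF F \<xi>] by (simp add: homeomorphism_def)
  then show ?thesis
    using has_derivative_transform_eventually[OF has_derivative_at_withinI[OF g(6)] ev] \<xi> by auto
qed

text \<open>The relative interior of a face. Edges and corners are excluded, because
  \<open>ref_normal\<close> has several non-zero entries there.\<close>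

definition face_point :: "3 \<Rightarrow> real \<Rightarrow> real^3 \<Rightarrow> bool" where
  "face_point d s \<xi> \<longleftrightarrow> s \<in> {0, 1} \<and> \<xi> $ d = s \<and> (\<forall>i. i \<noteq> d \<longrightarrow> 0 < \<xi> $ i \<and> \<xi> $ i < 1)"

lemma mem_cube: "\<xi> \<in> cbox 0 (1::real^3) \<longleftrightarrow> (\<forall>i. 0 \<le> \<xi> $ i \<and> \<xi> $ i \<le> 1)"
  and mem_ocube: "\<xi> \<in> box 0 (1::real^3) \<longleftrightarrow> (\<forall>i. 0 < \<xi> $ i \<and> \<xi> $ i < 1)"
  by (auto simp: mem_box_cart)

lemma face_point_cube: "face_point d s \<xi> \<Longrightarrow> \<xi> \<in> cbox 0 1"
  unfolding face_point_def mem_cube by (metis empty_iff insert_iff less_eq_real_def zero_less_one_class.zero_le_one)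

lemma ref_normal_face_point: "face_point d s \<xi> \<Longrightarrow> ref_normal \<xi> = axis d (2 * s - 1)"
  by (auto simp: face_point_def ref_normal_def vec_eq_iff axis_def)

lemma curve_enters_cube:
  fixes z :: "real \<Rightarrow> real^3"
  assumes z: "(z has_vector_derivative k) (at 0)" and fp: "face_point d s (z 0)"
    and k: "(2 * s - 1) * k $ d < 0"
  shows "\<forall>\<^sub>F t in at_right 0. z t \<in> box 0 1"
proof -
  have der: "((\<lambda>t. z t $ i) has_real_derivative k $ i) (at 0)" for i
    using bounded_linear.has_vector_derivative[OF bounded_linear_vec_nth z]
    by (simp add: has_real_derivative_iff_has_vector_derivative)
  have lim: "((\<lambda>t. z t $ i) \<longlongrightarrow> z 0 $ i) (at_right 0)" for i
    using DERIV_isCont[OF der] by (simp add: isCont_def filterlim_at_split)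
  have "\<forall>\<^sub>F t in at_right 0. 0 < z t $ i \<and> z t $ i < 1" for i
  proof (cases "i = d")
    case False
    then show ?thesis
      using fp order_tendstoD[OF lim[of i]] by (auto simp: face_point_def intro!: eventually_conj)
  next
    case True
    consider "s = 0" | "s = 1" using fp by (auto simp: face_point_def)
    then show ?thesis
    proof cases
      case 1
      then have "z 0 $ d = 0" "0 < k $ d" using fp k by (auto simp: face_point_def)
      then obtain e where "e > 0" "\<And>h. 0 < h \<Longrightarrow> h < e \<Longrightarrow> 0 < z h $ d"
        using DERIV_pos_inc_right[OF der[of d]] by auto
      then have "\<forall>\<^sub>F t in at_right 0. 0 < z t $ d"
        by (auto simp: eventually_at_right intro!: exI[of _ e])
      moreover have "\<forall>\<^sub>F t in at_right 0. z t $ d < 1"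
        using \<open>z 0 $ d = 0\<close> by (intro order_tendstoD(2)[OF lim]) simp
      ultimately have "\<forall>\<^sub>F t in at_right 0. 0 < z t $ d \<and> z t $ d < 1"
        by eventually_elim simp
      then show ?thesis using True by simp
    next
      case 2
      then have "z 0 $ d = 1" "k $ d < 0" using fp k by (auto simp: face_point_def)
      then obtain e where "e > 0" "\<And>h. 0 < h \<Longrightarrow> h < e \<Longrightarrow> z h $ d < 1"
        using DERIV_neg_dec_right[OF der[of d]] by auto
      then have "\<forall>\<^sub>F t in at_right 0. z t $ d < 1"
        by (auto simp: eventually_at_right intro!: exI[of _ e])
      moreover have "\<forall>\<^sub>F t in at_right 0. 0 < z t $ d"
        using \<open>z 0 $ d = 1\<close> by (intro order_tendstoD(1)[OF lim]) simp
      ultimately have "\<forall>\<^sub>F t in at_right 0. 0 < z t $ d \<and> z t $ d < 1"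
        by eventually_elim simp
      then show ?thesis using True by simp
    qed
  qed
  then show ?thesis
    unfolding mem_ocube by (intro eventually_all_finite) auto
qed

text \<open>\<open>normal\<close> as a function of the reference point, with the explicit formula
  for the inverse transpose.\<close>

definition outer_normal :: "(real^3 \<Rightarrow> real^3) \<Rightarrow> real^3 \<Rightarrow> real^3" where
  "outer_normal F \<xi> = sgn (jinvT (jacobian F (at \<xi>)) (ref_normal \<xi>))"

lemma normal_outer_normal:
  assumes "smooth_invertible (el_map M K)" "\<xi> \<in> cbox 0 1"
  shows "normal M K (el_map M K \<xi>) = outer_normal (el_map M K) \<xi>"
  using ref_inv_F[OF assms] matrix_inv_transpose[OF det_nz[OF assms]]
  by (simp add: normal_def outer_normal_def ref_inv_def)

lemma outer_normal_unit:
  assumes "smooth_invertible F" "face_point d s \<xi>"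
  shows "norm (outer_normal F \<xi>) = 1"
proof -
  have "ref_normal \<xi> \<noteq> 0"
    using assms(2) by (auto simp: ref_normal_face_point face_point_def axis_eq_0_iff)
  then show ?thesis
    using jinvT_eq_0[OF det_nz[OF assms(1) face_point_cube[OF assms(2)]]]
    by (simp add: outer_normal_def norm_sgn)
qed

text \<open>Up to a positive factor the outward normal is the inverse transpose of the Jacobian
  applied to the reference normal. Its product with \<open>h\<close> thus has the sign of the
  product of the reference normal with the pulled back direction: inward directions correspond to
  inward directions.\<close>

lemma outer_normal_jinv:
  assumes F: "smooth_invertible F" and fp: "face_point d s \<xi>" and h: "outer_normal F \<xi> \<bullet> h < 0"
  shows "(2 * s - 1) * jinv (jacobian F (at \<xi>)) h $ d < 0"
proof -
  let ?w = "jinvT (jacobian F (at \<xi>)) (ref_normal \<xi>)"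
  have "?w \<bullet> h < 0"
  proof (rule ccontr)
    assume "\<not> ?w \<bullet> h < 0"
    then have "0 \<le> inverse (norm ?w) * (?w \<bullet> h)"
      by (intro mult_nonneg_nonneg) auto
    then show False
      using h by (simp add: outer_normal_def sgn_div_norm)
  qed
  then have "jinv (jacobian F (at \<xi>)) h \<bullet> axis d (2 * s - 1) < 0"
    unfolding inner_jinv[symmetric] ref_normal_face_point[OF fp, symmetric] by (simp add: inner_commute)
  then show ?thesis by (simp add: inner_axis mult.commute)
qed

text \<open>Otherwise there is a direction pointing into both elements, so that they overlap.\<close>

lemma opposite_normals:
  assumes F: "smooth_invertible F1" "smooth_invertible F2"
    and fp: "face_point d1 s1 \<xi>1" "face_point d2 s2 \<xi>2" and eq: "F1 \<xi>1 = F2 \<xi>2"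
    and disj: "F1 ` box 0 1 \<inter> F2 ` box 0 1 = {}"
  shows "outer_normal F2 \<xi>2 = - outer_normal F1 \<xi>1"
proof (rule ccontr)
  let ?n1 = "outer_normal F1 \<xi>1" and ?n2 = "outer_normal F2 \<xi>2"
  assume "?n2 \<noteq> - ?n1"
  then have "?n1 + ?n2 \<noteq> 0" by (simp add: add_eq_0_iff)
  then have "0 < (?n1 + ?n2) \<bullet> (?n1 + ?n2)" by simp
  moreover have "?n1 \<bullet> ?n1 = 1" "?n2 \<bullet> ?n2 = 1"
    using outer_normal_unit[OF F(1) fp(1)] outer_normal_unit[OF F(2) fp(2)]
    by (simp_all add: norm_eq_1)
  ultimately have pos: "0 < 1 + ?n1 \<bullet> ?n2"
    by (simp add: inner_add_left inner_add_right inner_commute)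
  \<comment> \<open>For unit vectors with non-zero sum the inner product exceeds -1, so the negative
    sum has a negative product with each of them.\<close>
  define h where "h = - (?n1 + ?n2)"
  have h: "?n1 \<bullet> h < 0" "?n2 \<bullet> h < 0"
    using pos \<open>?n1 \<bullet> ?n1 = 1\<close> \<open>?n2 \<bullet> ?n2 = 1\<close>
    by (simp_all add: h_def inner_diff_right inner_commute)
  let ?J1 = "jacobian F1 (at \<xi>1)" and ?J2 = "jacobian F2 (at \<xi>2)"
  obtain U V g where g: "open U" "open V" "\<xi>2 \<in> U" "F2 \<xi>2 \<in> V" "homeomorphism U V F2 g"
     "(g has_derivative jinv ?J2) (at (F2 \<xi>2))"
    using smooth_local_inverse[OF F(2) face_point_cube[OF fp(2)]] by blast
  \<comment> \<open>A straight line in the first reference cube, its image \<open>y\<close>, and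
    then its pull-back to the second cube. The latter uses the local inverse \<open>g\<close>,
    because the points of \<open>y\<close> are not known in advance to lie in the second
    element.\<close>
  define x where "x t = \<xi>1 + t *\<^sub>R jinv ?J1 h" for t
  define y where "y t = F1 (x t)" for t
  have x: "(x has_vector_derivative jinv ?J1 h) (at 0)"
    unfolding x_def by (auto intro!: derivative_eq_intros simp: has_vector_derivative_def)
  have x0: "x 0 = \<xi>1" by (simp add: x_def)
  have J1h: "?J1 *v jinv ?J1 h = h"
    by (rule mult_jinv[OF det_nz[OF F(1) face_point_cube[OF fp(1)]]])
  have "(F1 has_derivative (*v) ?J1) (at (x 0))"
    using F_deriv[OF F(1) face_point_cube[OF fp(1)]] x0 by simp
  then have y: "(y has_vector_derivative h) (at 0)"
    using vector_derivative_diff_chain_within[OF x, of F1 "(*v) ?J1"] J1h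
    by (simp add: y_def[abs_def] o_def has_derivative_at_withinI)
  have y0: "y 0 = F2 \<xi>2" by (simp add: y_def x0 eq)
  have "(g has_derivative jinv ?J2) (at (y 0) within range y)"
    using g(6) y0 has_derivative_at_withinI by simp
  then have z: "((\<lambda>t. g (y t)) has_vector_derivative jinv ?J2 h) (at 0)"
    using vector_derivative_diff_chain_within[OF y, of g "jinv ?J2"] by (simp add: o_def)
  have "g (y 0) = \<xi>2" using g(3,5) y0 by (simp add: homeomorphism_def)
  then have "\<forall>\<^sub>F t in at_right 0. g (y t) \<in> box 0 1"
    using outer_normal_jinv[OF F(2) fp(2) h(2)] fp(2) by (intro curve_enters_cube[OF z]) auto
  moreover have "\<forall>\<^sub>F t in at_right 0. x t \<in> box 0 1"
    using outer_normal_jinv[OF F(1) fp(1) h(1)] fp(1) x0 by (intro curve_enters_cube[OF x]) auto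
  moreover have "\<forall>\<^sub>F t in at_right 0. y t \<in> V"
  proof (rule topological_tendstoD[OF _ g(2)])
    show "(y \<longlongrightarrow> y 0) (at_right 0)"
      using has_vector_derivative_continuous[OF y] by (simp add: continuous_at filterlim_at_split)
  qed (use y0 g(4) in simp)
  ultimately have "\<forall>\<^sub>F t in at_right (0::real). False"
  proof eventually_elim
    case (elim t)
    then have "F2 (g (y t)) = y t" using g(5) by (simp add: homeomorphism_def)
    then show ?case using disj elim(1,2) by (auto simp: y_def)
  qed
  then show False by simp
qed

section \<open>Face charts and edges\<close>

definition ref_proj :: "3 \<Rightarrow> real^3 \<Rightarrow> real^2" where
  "ref_proj d \<xi> = (if d = 1 then vector [\<xi>$2, \<xi>$3] else if d = 2 then vector [\<xi>$1, \<xi>$3] else vector [\<xi>$1, \<xi>$2])"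

lemma ref_proj_chart: "ref_proj d (ref_chart d s \<eta>) = \<eta>"
  by (auto simp: ref_proj_def ref_chart_def vec_eq_iff forall_2)

lemma ref_proj_linear: "bounded_linear (ref_proj d)"
  unfolding ref_proj_def
  by (intro linear_conv_bounded_linear[THEN iffD1] linearI) (auto simp: vec_eq_iff forall_2)

lemma ref_chart_affine: "ref_chart d s \<eta> = ref_chart d s 0 + ref_chart d 0 \<eta>"
  by (auto simp: ref_chart_def vec_eq_iff forall_3)

lemma ref_chart_linear: "bounded_linear (ref_chart d 0)"
  unfolding ref_chart_def
  by (intro linear_conv_bounded_linear[THEN iffD1] linearI) (auto simp: vec_eq_iff forall_3)

lemma ref_chart_deriv: "(ref_chart d s has_derivative ref_chart d 0) (at \<eta> within S)"
proof -
  have "((\<lambda>\<eta>. ref_chart d s 0 + ref_chart d 0 \<eta>) has_derivative ref_chart d 0) (at \<eta> within S)"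
    using has_derivative_add[OF has_derivative_const bounded_linear_imp_has_derivative[OF ref_chart_linear]]
    by simp
  moreover have "ref_chart d s = (\<lambda>\<eta>. ref_chart d s 0 + ref_chart d 0 \<eta>)"
    by (rule ext) (rule ref_chart_affine)
  ultimately show ?thesis by metis
qed

lemma mem_square: "\<eta> \<in> cbox 0 (1::real^2) \<longleftrightarrow> (\<forall>i. 0 \<le> \<eta> $ i \<and> \<eta> $ i \<le> 1)"
  and mem_osquare: "\<eta> \<in> box 0 (1::real^2) \<longleftrightarrow> (\<forall>i. 0 < \<eta> $ i \<and> \<eta> $ i < 1)"
  by (auto simp: mem_box_cart)

lemma ref_chart_cube: "s \<in> {0,1} \<Longrightarrow> \<eta> \<in> cbox 0 1 \<Longrightarrow> ref_chart d s \<eta> \<in> cbox 0 1"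
  by (auto simp: mem_cube mem_square ref_chart_def forall_3 forall_2)

lemma ref_chart_face_point: "s \<in> {0,1} \<Longrightarrow> \<eta> \<in> box 0 1 \<Longrightarrow> face_point d s (ref_chart d s \<eta>)"
  using exhaust_3[of d] by (auto simp: mem_osquare face_point_def ref_chart_def forall_3 forall_2)

text \<open>With \<open>c\<close> ranging over the corners, these curves sweep out the edges of the cube.\<close>

definition edge_curve :: "3 \<Rightarrow> (3 \<Rightarrow> real) \<Rightarrow> real \<Rightarrow> real^3" where
  "edge_curve i c \<tau> = (\<chi> j. if j = i then \<tau> else c j)"

text \<open>The cases are distinguished by the number of coordinates equal to 0 or 1: none, exactly
  one, or at least two.\<close>

lemma cube_cases:
  assumes "\<xi> \<in> cbox 0 (1::real^3)"
  obtains "\<xi> \<in> box 0 1" | d s where "face_point d s \<xi>"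
    | i c \<tau> where "c \<in> UNIV \<rightarrow> {0,1}" "\<tau> \<in> {0..1}" "\<xi> = edge_curve i c \<tau>"
proof -
  define B where "B = {d. \<xi> $ d \<in> {0,1}}"
  have in01: "0 < \<xi> $ j \<and> \<xi> $ j < 1" if "j \<notin> B" for j
    using that assms by (auto simp: B_def mem_cube order.strict_iff_order)
  show thesis
  proof (cases "B = {} \<or> (\<exists>d. B = {d})")
    case True
    then show ?thesis
    proof
      assume "B = {}"
      then show ?thesis using that(1) in01 by (auto simp: mem_ocube)
    next
      assume "\<exists>d. B = {d}"
      then obtain d where d: "B = {d}" by blast
      then have "\<xi> $ d \<in> {0,1}" by (auto simp: B_def)
      then have "face_point d (\<xi> $ d) \<xi>" using in01 d by (auto simp: face_point_def)
      then show ?thesis using that(2) by blast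
    qed
  next
    case False
    then obtain d e where de: "d \<in> B" "e \<in> B" "d \<noteq> e" by blast
    \<comment> \<open>In dimension three, two different coordinates leave only one that can be
      free.\<close>
    have "\<exists>i::3. \<forall>j. j \<noteq> i \<longrightarrow> j = d \<or> j = e"
      by (rule ccontr) (use exhaust_3[of d] exhaust_3[of e] de(3) in \<open>auto simp: forall_3\<close>)
    then obtain i where i: "\<And>j. j \<noteq> i \<Longrightarrow> j \<in> B"
      using de by metis
    \<comment> \<open>\<open>edge_curve i\<close> ignores the value at \<open>i\<close>; 0 is chosen
      to stay among the corners.\<close>
    define c where "c j = (if j = i then 0 else \<xi> $ j)" for j
    have "c \<in> UNIV \<rightarrow> {0,1}" using i by (auto simp: c_def B_def)
    moreover have "\<xi> = edge_curve i c (\<xi> $ i)" by (auto simp: edge_curve_def c_def vec_eq_iff)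
    moreover have "\<xi> $ i \<in> {0..1}" using assms by (simp add: mem_cube)
    ultimately show ?thesis using that(3) by blast
  qed
qed

lemma finite_corner_choices: "finite (UNIV \<rightarrow> {0,1::real} :: (3 \<Rightarrow> real) set)"
  using finite_PiE[of "UNIV :: 3 set" "\<lambda>_. {0,1::real}"] by (simp add: PiE_UNIV_domain)

lemma edge_curve_deriv: "(edge_curve i c has_derivative (\<lambda>h. h *\<^sub>R axis i 1)) (at \<tau> within S)"
proof -
  have eq: "edge_curve i c = (\<lambda>\<tau>. edge_curve i c 0 + \<tau> *\<^sub>R axis i 1)"
    by (auto simp: edge_curve_def vec_eq_iff axis_def)
  show ?thesis by (subst eq) (auto intro!: derivative_eq_intros)
qed

text \<open>Such chart points form the image of a subset of the line under a differentiable map into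
  the plane, so they have area zero. Differentiability holds relative to \<open>T\<close> only: an
  edge of the second element may leave the first, and \<open>ref_inv F1\<close> has just one-sided
  derivatives on the boundary.\<close>

lemma negligible_edge_preimage:
  assumes F: "smooth_invertible F1" "smooth_invertible F2" and s: "s \<in> {0,1}" and c: "c \<in> UNIV \<rightarrow> {0,1}"
  shows "negligible {\<eta> \<in> cbox 0 1. F1 (ref_chart d s \<eta>) \<in> (\<lambda>\<tau>. F2 (edge_curve i c \<tau>)) ` {0..1}}"
proof -
  define T where "T = {\<tau> \<in> {0..1}. F2 (edge_curve i c \<tau>) \<in> F1 ` cbox 0 1}"
  define m where "m \<tau> = ref_proj d (ref_inv F1 (F2 (edge_curve i c \<tau>)))" for \<tau>
  have "negligible (m ` T)"
  proof (rule negligible_differentiable_image_lowdim)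
    show "m differentiable_on T"
      unfolding differentiable_on_def differentiable_def
    proof
      fix \<tau> assume \<tau>: "\<tau> \<in> T"
      have "edge_curve i c \<tau> \<in> cbox 0 1"
      proof -
        have "0 \<le> c j \<and> c j \<le> 1" for j using c by (metis Pi_iff UNIV_I insert_iff empty_iff order_refl zero_le_one)
        then show ?thesis using \<tau> by (auto simp: edge_curve_def mem_cube T_def)
      qed
      note 1 = F_deriv[OF F(2) this]
      have 2: "((\<lambda>\<tau>. F2 (edge_curve i c \<tau>)) has_derivative
          (\<lambda>h. jacobian F2 (at (edge_curve i c \<tau>)) *v (h *\<^sub>R axis i 1))) (at \<tau> within T)"
        by (rule has_derivative_compose[OF edge_curve_deriv 1])
      obtain \<xi> where \<xi>: "\<xi> \<in> cbox 0 1" "F2 (edge_curve i c \<tau>) = F1 \<xi>"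
        using \<tau> by (auto simp: T_def)
      have "(ref_inv F1 has_derivative jinv (jacobian F1 (at \<xi>)))
          (at (F2 (edge_curve i c \<tau>)) within F1 ` cbox 0 1)"
        using ref_inv_deriv_within[OF F(1) \<xi>(1)] \<xi>(2) by simp
      then have 3: "(ref_inv F1 has_derivative jinv (jacobian F1 (at \<xi>)))
          (at (F2 (edge_curve i c \<tau>)) within (\<lambda>\<tau>. F2 (edge_curve i c \<tau>)) ` T)"
        by (rule has_derivative_subset) (auto simp: T_def)
      from has_derivative_in_compose[OF 2 this]
      show "\<exists>D. (m has_derivative D) (at \<tau> within T)"
        unfolding m_def using bounded_linear.has_derivative[OF ref_proj_linear] by blast
    qed
  qed simp
  moreover have "{\<eta> \<in> cbox 0 1. F1 (ref_chart d s \<eta>) \<in> (\<lambda>\<tau>. F2 (edge_curve i c \<tau>)) ` {0..1}} \<subseteq> m ` T"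
  proof safe
    fix \<eta> \<tau> assume \<eta>: "\<eta> \<in> cbox 0 (1::real^2)" and \<tau>: "\<tau> \<in> {0..1}" "F1 (ref_chart d s \<eta>) = F2 (edge_curve i c \<tau>)"
    have cube: "ref_chart d s \<eta> \<in> cbox 0 1" using ref_chart_cube[OF s \<eta>] .
    then have "\<tau> \<in> T" using \<tau> by (auto simp: T_def intro!: image_eqI[of _ F1 "ref_chart d s \<eta>"])
    moreover have "\<eta> = m \<tau>"
      using \<tau>(2)[symmetric] ref_inv_F[OF F(1) cube] by (simp add: m_def ref_proj_chart)
    ultimately show "\<eta> \<in> m ` T" by blast
  qed
  ultimately show ?thesis using negligible_subset by blast
qed

text \<open>Faces of two neighbours may overlap partially, so an edge of the second element can cut
  through a face of the first. Away from such edges and from the boundary of the chart square, both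
  reference points are in the relative interior of a face, and \<open>opposite_normals\<close>
  applies.\<close>

lemma face_normals_opposite_AE:
  assumes F: "smooth_invertible F1" "smooth_invertible F2" and s: "s \<in> {0,1}"
    and disj: "F1 ` box 0 1 \<inter> F2 ` box 0 1 = {}"
  shows "\<exists>N. negligible N \<and> (\<forall>\<eta>\<in>cbox 0 1 - N. \<forall>\<xi>\<in>cbox 0 1 - box 0 1. F1 (ref_chart d s \<eta>) = F2 \<xi> \<longrightarrow>
     outer_normal F2 \<xi> = - outer_normal F1 (ref_chart d s \<eta>))"
proof -
  define E where "E = (\<Union>i\<in>UNIV. \<Union>c\<in>UNIV \<rightarrow> {0,1}.
    {\<eta> \<in> cbox 0 1. F1 (ref_chart d s \<eta>) \<in> (\<lambda>\<tau>. F2 (edge_curve i c \<tau>)) ` {0..1}})"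
  have "negligible E"
    unfolding E_def using negligible_edge_preimage[OF F s] finite_corner_choices
    by (auto intro!: negligible_Union)
  then have neg: "negligible (E \<union> (cbox 0 1 - box 0 1))"
    by (rule negligible_Un[OF _ negligible_frontier_interval])
  have "outer_normal F2 \<xi> = - outer_normal F1 (ref_chart d s \<eta>)"
    if \<eta>: "\<eta> \<in> cbox 0 1 - (E \<union> (cbox 0 1 - box 0 1))" and \<xi>: "\<xi> \<in> cbox 0 1 - box 0 1"
      and eq: "F1 (ref_chart d s \<eta>) = F2 \<xi>" for \<eta> \<xi>
  proof -
    have fp: "face_point d s (ref_chart d s \<eta>)"
      using ref_chart_face_point[OF s] \<eta> by blast
    have "\<xi> \<in> cbox 0 1" using \<xi> by blast
    then show ?thesis
    proof (cases rule: cube_cases)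
      case 1
      then show ?thesis using \<xi> by blast
    next
      case (2 d2 s2)
      then show ?thesis by (intro opposite_normals[OF F fp 2 eq disj])
    next
      case (3 i c \<tau>)
      then have "\<eta> \<in> E" using \<eta> eq by (fastforce simp: E_def)
      then show ?thesis using \<eta> by blast
    qed
  qed
  then show ?thesis using neg by blast
qed

lemma jacobian_continuous:
  assumes "smooth_invertible F" shows "continuous_on (cbox 0 1) (\<lambda>\<xi>. column i (jacobian F (at \<xi>)))"
  using smooth_neighbourhood[OF assms] C1_continuous continuous_on_subset by blast

lemma jinvT_continuous:
  assumes "smooth_invertible F" shows "continuous_on (cbox 0 1) (\<lambda>\<xi>. jinvT (jacobian F (at \<xi>)) w)"
proof -
  obtain U where "cbox 0 1 \<subseteq> U" "\<And>i. C1 U (\<lambda>\<xi>. column i (jacobian F (at \<xi>)))" "\<And>\<xi>. \<xi> \<in> U \<Longrightarrow> det (jacobian F (at \<xi>)) \<noteq> 0"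
    using smooth_neighbourhood[OF assms] by blast
  then show ?thesis
    using C1_continuous[OF C1_jinvT[OF assms, of U "\<lambda>_. w"]] C1_const continuous_on_subset by blast
qed

lemma ref_chart_continuous: "continuous_on S (ref_chart d s)"
  using ref_chart_deriv by (meson continuous_on_eq_continuous_within has_derivative_continuous)

lemma area_element_continuous:
  assumes F: "smooth_invertible F" and s: "s \<in> {0,1}"
  shows "continuous_on (cbox 0 1) (area_element (F \<circ> ref_chart d s))"
proof -
  have der: "frechet_derivative (F \<circ> ref_chart d s) (at \<eta>) v =
      (\<Sum>i\<in>UNIV. ref_chart d 0 v $ i *\<^sub>R column i (jacobian F (at (ref_chart d s \<eta>))))"
    if "\<eta> \<in> cbox 0 1" for \<eta> v
  proof -
    have "((F \<circ> ref_chart d s) has_derivative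
      (\<lambda>h. jacobian F (at (ref_chart d s \<eta>)) *v ref_chart d 0 h)) (at \<eta>)"
      unfolding o_def
      by (rule has_derivative_compose[OF ref_chart_deriv F_deriv[OF F ref_chart_cube[OF s that]]])
    from frechet_derivative_at[OF this, symmetric] show ?thesis
      by (simp add: matrix_mult_sum scalar_mult_eq_scaleR)
  qed
  have "continuous_on (cbox 0 1) (\<lambda>\<eta>. column i (jacobian F (at (ref_chart d s \<eta>))))" for i
    by (rule continuous_on_compose2[OF jacobian_continuous[OF F] ref_chart_continuous])
      (use ref_chart_cube[OF s] in auto)
  then have "continuous_on (cbox 0 1) (\<lambda>\<eta>. norm (cross3
      (\<Sum>i\<in>UNIV. ref_chart d 0 (axis 1 1) $ i *\<^sub>R column i (jacobian F (at (ref_chart d s \<eta>))))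
      (\<Sum>i\<in>UNIV. ref_chart d 0 (axis 2 1) $ i *\<^sub>R column i (jacobian F (at (ref_chart d s \<eta>))))))"
    by (intro continuous_on_norm bounded_bilinear.continuous_on[OF bounded_bilinear_cross3] continuous_intros)
  then show ?thesis
    by (rule continuous_on_cong[THEN iffD1, rotated 2]) (simp_all add: area_element_def der)
qed

text \<open>\<open>ref_normal\<close> jumps at the edges of the cube. Replacing it by its constant
  value on the open face gives a function that is continuous on the closed square, and hence bounded
  and measurable.\<close>

lemma outer_normal_chart:
  assumes F: "smooth_invertible F" and s: "s \<in> {0,1}"
  shows "\<exists>\<nu>. continuous_on (cbox 0 1) \<nu> \<and>
    (\<forall>\<eta>\<in>box 0 1. outer_normal F (ref_chart d s \<eta>) = \<nu> \<eta>)"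
proof (intro exI conjI ballI)
  let ?\<nu> = "\<lambda>\<eta>. sgn (jinvT (jacobian F (at (ref_chart d s \<eta>))) (axis d (2 * s - 1)))"
  have nz: "axis d (2 * s - 1) \<noteq> (0::real^3)" using s by (auto simp: axis_eq_0_iff)
  have "continuous_on (cbox 0 1) (\<lambda>\<eta>. jinvT (jacobian F (at (ref_chart d s \<eta>))) (axis d (2 * s - 1)))"
    by (rule continuous_on_compose2[OF jinvT_continuous[OF F] ref_chart_continuous])
      (use ref_chart_cube[OF s] in auto)
  then show "continuous_on (cbox 0 1) ?\<nu>"
    using jinvT_eq_0[OF det_nz[OF F ref_chart_cube[OF s]]] nz
    unfolding sgn_div_norm by (intro continuous_intros) auto
  show "outer_normal F (ref_chart d s \<eta>) = ?\<nu> \<eta>" if "\<eta> \<in> box 0 1" for \<eta>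
    using ref_normal_face_point[OF ref_chart_face_point[OF s that]] by (simp add: outer_normal_def)
qed

section \<open>Fields with separated variables and the projection onto the discrete space\<close>

text \<open>The spatial factors \<open>Q\<close> are arbitrary functions, so the same form serves
  for discrete fields, their traces and their curls.\<close>

definition separable :: "nat \<Rightarrow> (nat \<Rightarrow> real \<Rightarrow> real) \<Rightarrow> (nat \<Rightarrow> real^3 \<Rightarrow> real^3) \<Rightarrow> field" where
  "separable m a Q t x = (\<Sum>i<m. a i t *\<^sub>R Q i x)"

lemma separable_nth: "separable m a Q t x $ c = (\<Sum>i<m. (Q i x $ c) * a i t)"
  by (simp add: separable_def mult.commute)

text \<open>Fubini's theorem is used for the product of two Lebesgue spaces, and separated variables
  give measurability there factor by factor. The map \<open>\<Phi>\<close> is the identity for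
  volume integrals and a chart for face integrals.\<close>

lemma separable_bdd_meas:
  assumes "\<And>i. i < m \<Longrightarrow> bdd_meas N1 (a i)" "\<And>i. i < m \<Longrightarrow> bdd_meas N2 (\<lambda>y. Q i (\<Phi> y) $ c)"
  shows "bdd_meas (N1 \<Otimes>\<^sub>M N2) (\<lambda>(t, y). separable m a Q t (\<Phi> y) $ c)"
proof -
  have "bdd_meas (N1 \<Otimes>\<^sub>M N2) (\<lambda>z. \<Sum>i<m. (\<lambda>(t, y). Q i (\<Phi> y) $ c) z * (\<lambda>(t, y). a i t) z)"
    using assms by (intro bdd_meas_sum bdd_meas_mult bdd_meas_fst bdd_meas_snd) auto
  then show ?thesis
    by (simp add: separable_nth case_prod_beta')
qed

text \<open>At a fixed point the spatial factors are constants, so projecting the temporal factors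
  projects the field, whatever the spatial factors are. This is why the projection commutes with the
  curl and with traces.\<close>

lemma separable_is_proj:
  assumes "finite_measure N" "fun_subspace W" "\<And>w. w \<in> W \<Longrightarrow> bdd_meas N w"
    and "\<And>i. i < m \<Longrightarrow> is_proj N W (a i) (b i)" "\<And>i. i < m \<Longrightarrow> bdd_meas N (a i)"
  shows "is_proj N W (\<lambda>t. separable m a Q t x $ c) (\<lambda>t. separable m b Q t x $ c)"
  unfolding separable_nth using assms by (intro is_proj_sum) auto

lemma bdd_meas_bounded_image:
  assumes "bdd_meas N f" shows "\<exists>C\<ge>0. \<forall>x\<in>space N. \<bar>f x\<bar> \<le> C"
  using assms unfolding bdd_meas_def by (meson abs_ge_zero le_max_iff_disj max.cobounded2 order_refl)

lemma double_integral_add: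
  assumes "finite_measure N1" "finite_measure N2"
    and "bdd_meas (N1 \<Otimes>\<^sub>M N2) (\<lambda>(t, x). f t x)" "bdd_meas (N1 \<Otimes>\<^sub>M N2) (\<lambda>(t, x). g t x)"
  shows "(LINT t|N1. LINT x|N2. f t x + g t x) = (LINT t|N1. LINT x|N2. f t x) + (LINT t|N1. LINT x|N2. g t x)"
proof -
  have "(LINT t|N1. LINT x|N2. f t x + g t x) = (LINT t|N1. (LINT x|N2. f t x) + (LINT x|N2. g t x))"
    by (intro Bochner_Integration.integral_cong refl Bochner_Integration.integral_add
        bdd_meas_integrable[OF assms(2)] bdd_meas_slice[OF assms(3)] bdd_meas_slice[OF assms(4)])
  then show ?thesis
    using assms by (simp add: bdd_meas_finite_pair)
qed

lemma double_integral_cmult: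
  "(LINT t|N1. LINT x|N2. c * g t x) = (c::real) * (LINT t|N1. LINT x|N2. g t x)"
  by simp

lemma double_integral_diff:
  assumes "finite_measure N1" "finite_measure N2"
    and "bdd_meas (N1 \<Otimes>\<^sub>M N2) (\<lambda>(t, x). f t x)" "bdd_meas (N1 \<Otimes>\<^sub>M N2) (\<lambda>(t, x). g t x)"
  shows "(LINT t|N1. LINT x|N2. f t x - g t x) = (LINT t|N1. LINT x|N2. f t x) - (LINT t|N1. LINT x|N2. g t x)"
proof -
  have "bdd_meas (N1 \<Otimes>\<^sub>M N2) (\<lambda>(t, x). (- 1) * g t x)"
    using bdd_meas_minus[OF assms(4)] by (simp add: case_prod_beta')
  then show ?thesis
    using double_integral_add[OF assms(1-3), of "\<lambda>t x. (- 1) * g t x"] by simp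
qed

lemma double_integral_eq_0:
  assumes "finite_measure N1" "finite_measure N2" "bdd_meas (N1 \<Otimes>\<^sub>M N2) (\<lambda>(t, x). g t x)"
    and "\<And>x. x \<in> space N2 \<Longrightarrow> (LINT t|N1. g t x) = 0"
  shows "(LINT t|N1. LINT x|N2. g t x) = 0"
proof -
  have "(LINT x|N2. LINT t|N1. g t x) = (LINT x|N2. 0)"
    using assms(4) by (intro Bochner_Integration.integral_cong) auto
  then show ?thesis
    using bdd_meas_finite_pair(2)[OF assms(1-3)] by simp
qed

lemma inner_3: "(a::real^3) \<bullet> b = (\<Sum>c\<in>UNIV. a $ c * b $ c)"
  by (simp add: inner_vec_def)

lemma bdd_meas_inner:
  assumes "\<And>c. bdd_meas (N1 \<Otimes>\<^sub>M N2) (\<lambda>(t, x). u t x $ c)" "\<And>c. bdd_meas (N1 \<Otimes>\<^sub>M N2) (\<lambda>(t, x). v t x $ c)"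
  shows "bdd_meas (N1 \<Otimes>\<^sub>M N2) (\<lambda>(t, x). (u t x :: real^3) \<bullet> v t x)"
proof -
  have "bdd_meas (N1 \<Otimes>\<^sub>M N2) (\<lambda>z. \<Sum>c\<in>UNIV. (\<lambda>(t, x). u t x $ c) z * (\<lambda>(t, x). v t x $ c) z)"
    by (intro bdd_meas_sum bdd_meas_mult assms)
  then show ?thesis by (simp add: inner_3 case_prod_beta')
qed

section \<open>Decomposition of the domain into elements\<close>

context
  fixes M
  assumes M: "valid_mesh M"
begin

lemma mesh_smooth: "K < n_elem M \<Longrightarrow> smooth_invertible (el_map M K)"
  using M by (simp add: valid_mesh_def)

lemma interior_elem: "K < n_elem M \<Longrightarrow> interior (elem M K) = el_map M K ` box 0 1"
  using interior_F_cube[OF mesh_smooth] by (simp add: elem_def)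

lemma interior_elem_lmeasurable: "K < n_elem M \<Longrightarrow> interior (elem M K) \<in> lmeasurable"
  using F_ocube_lmeasurable[OF mesh_smooth] interior_elem by simp

lemma interior_elem_finite: "K < n_elem M \<Longrightarrow> finite_measure (lebesgue_on (interior (elem M K)))"
  by (intro finite_measure_lebesgue_on interior_elem_lmeasurable)

lemma interior_elem_Omega: "K < n_elem M \<Longrightarrow> interior (elem M K) \<subseteq> Omega M"
  using M by (simp add: valid_mesh_def)

lemma elem_disjoint:
  "K < n_elem M \<Longrightarrow> K' < n_elem M \<Longrightarrow> K \<noteq> K' \<Longrightarrow> interior (elem M K) \<inter> interior (elem M K') = {}"
  using M by (simp add: valid_mesh_def)

lemma elem_compact: "K < n_elem M \<Longrightarrow> compact (elem M K)"
  using compact_F_cube[OF mesh_smooth] by (simp add: elem_def)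

lemma Omega_bounded: "bounded (Omega M)"
proof -
  have "bounded (closure (Omega M))"
    using M elem_compact compact_imp_bounded by (auto simp: valid_mesh_def intro!: bounded_UN)
  then show ?thesis
    by (rule bounded_subset[OF _ closure_subset])
qed

lemma Omega_skeleton: "negligible (Omega M - (\<Union>K<n_elem M. interior (elem M K)))"
proof (rule negligible_subset)
  show "negligible (\<Union>K<n_elem M. el_map M K ` (cbox 0 1 - box 0 1))"
    using negligible_F_frontier[OF mesh_smooth] by (auto intro!: negligible_Union)
  have "Omega M \<subseteq> (\<Union>K<n_elem M. elem M K)"
    using M closure_subset by (fastforce simp: valid_mesh_def)
  then show "Omega M - (\<Union>K<n_elem M. interior (elem M K)) \<subseteq> (\<Union>K<n_elem M. el_map M K ` (cbox 0 1 - box 0 1))"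
    using interior_elem by (fastforce simp: elem_def)
qed

lemma integral_Omega:
  assumes "\<And>K. K < n_elem M \<Longrightarrow> integrable (lebesgue_on (interior (elem M K))) f"
  shows "(LINT x|lebesgue_on (Omega M). f x) = (\<Sum>K<n_elem M. LINT x|lebesgue_on (interior (elem M K)). (f x :: real))"
proof -
  let ?T = "\<Union>K<n_elem M. interior (elem M K)"
  have restr: "(LINT x|lebesgue_on S. f x) = (LINT x:S|lebesgue. f x)"
    "integrable (lebesgue_on S) f \<longleftrightarrow> set_integrable lebesgue S f" if "open S" for S
    using that by (simp_all add: integral_restrict_space set_lebesgue_integral_def integrable_restrict_space set_integrable_def)
  have "(LINT x|lebesgue_on (Omega M). f x) = (LINT x|lebesgue_on ?T. f x)"
    using M interior_elem_Omega
    by (intro integral_lebesgue_on_spike_set[OF Omega_skeleton]) (auto simp: valid_mesh_def)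
  also have "\<dots> = (LINT x:?T|lebesgue. f x)"
    by (intro restr) auto
  also have "\<dots> = (\<Sum>K<n_elem M. LINT x:interior (elem M K)|lebesgue. f x)"
    using elem_disjoint assms restr
    by (intro set_integral_finite_Union) (auto simp: disjoint_family_on_def)
  also have "\<dots> = (\<Sum>K<n_elem M. LINT x|lebesgue_on (interior (elem M K)). f x)"
    by (intro sum.cong restr[symmetric]) auto
  finally show ?thesis .
qed

text \<open>Time derivatives are known only away from the nodes, and all fields only inside the
  elements. The functions \<open>g K\<close> are bounded versions of the integrand that are
  meaningful everywhere on their element.\<close>

lemma ip_elements:
  assumes bdd_meas: "\<And>K. K < n_elem M \<Longrightarrow>
      bdd_meas (lebesgue_on (slab M) \<Otimes>\<^sub>M lebesgue_on (interior (elem M K))) (\<lambda>(t, x). g K t x)"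
    and N: "negligible N"
    and eq: "\<And>K t x. K < n_elem M \<Longrightarrow> t \<in> slab M - N \<Longrightarrow> x \<in> interior (elem M K) \<Longrightarrow> u t x \<bullet> v t x = g K t x"
  shows "ip M u v = (\<Sum>K<n_elem M. LINT t|lebesgue_on (slab M). LINT x|lebesgue_on (interior (elem M K)). g K t x)"
proof -
  have "(LINT x|lebesgue_on (Omega M). u t x \<bullet> v t x) =
      (\<Sum>K<n_elem M. LINT x|lebesgue_on (interior (elem M K)). g K t x)" if t: "t \<in> slab M - N" for t
  proof -
    have int: "integrable (lebesgue_on (interior (elem M K))) (g K t)" if "K < n_elem M" for K
      using bdd_meas_slice[OF bdd_meas[OF that], of t] t interior_elem_finite[OF that] by (auto intro: bdd_meas_integrable)
    have "(LINT x|lebesgue_on (Omega M). u t x \<bullet> v t x) =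
      (\<Sum>K<n_elem M. LINT x|lebesgue_on (interior (elem M K)). u t x \<bullet> v t x)"
    proof (intro integral_Omega)
      fix K assume K: "K < n_elem M"
      show "integrable (lebesgue_on (interior (elem M K))) (\<lambda>x. u t x \<bullet> v t x)"
        using int[OF K] eq[OF K t]
        by (subst Bochner_Integration.integrable_cong[OF refl, of _ _ "g K t"]) auto
    qed
    also have "\<dots> = (\<Sum>K<n_elem M. LINT x|lebesgue_on (interior (elem M K)). g K t x)"
      using eq[OF _ t] by (intro sum.cong refl Bochner_Integration.integral_cong) auto
    finally show ?thesis .
  qed
  then have "ip M u v = (LINT t|lebesgue_on (slab M).
      (\<Sum>K<n_elem M. LINT x|lebesgue_on (interior (elem M K)). g K t x))"
    unfolding ip_def using N slab_lmeasurable by (intro integral_lebesgue_on_spike(1)[of N]) auto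
  also have "\<dots> = (\<Sum>K<n_elem M. LINT t|lebesgue_on (slab M). LINT x|lebesgue_on (interior (elem M K)). g K t x)"
    using bdd_meas slab_finite interior_elem_finite by (intro Bochner_Integration.integral_sum bdd_meas_finite_pair(1)) auto
  finally show ?thesis .
qed

end

section \<open>Discrete fields on an element, gluing and the projection\<close>

lemma jinvT_sum: "jinvT J (\<Sum>i<m. c i *\<^sub>R w i) = (\<Sum>i<(m::nat). c i *\<^sub>R jinvT J (w i))"
proof -
  have "linear (jinvT J)"
    by (rule linearI) (simp_all add: jinvT_def algebra_simps)
  then show ?thesis
    by (simp add: linear_sum linear_cmul)
qed

text \<open>The condition on the pull-back, solved for the field itself. The shape functions are
  kept in reference coordinates, because membership in \<open>W_h\<close> is stated for
  them.\<close>

definition elem_rep :: "slab_mesh \<Rightarrow> nat \<Rightarrow> (real \<Rightarrow> real) set \<Rightarrow> field \<Rightarrow> nat \<Rightarrow> (nat \<Rightarrow> real \<Rightarrow> real) \<Rightarrow>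
    (nat \<Rightarrow> real^3 \<Rightarrow> real^3) \<Rightarrow> bool" where
  "elem_rep M K A u m a q \<longleftrightarrow> (\<forall>i<m. a i \<in> A \<and> q i \<in> Q3_space (deg_x M K)) \<and>
     (\<forall>t\<in>slab M. \<forall>x\<in>interior (elem M K). u t x = separable m a (\<lambda>i. cov_field (el_map M K) (q i)) t x)"

text \<open>Borel measurability, unlike Lebesgue measurability, is preserved under composition with
  the coordinate projections of the cylinder, as needed in \<open>glue_W_h\<close>. The indicator
  hides the arbitrary values outside the slab.\<close>

lemma T_time_borel:
  assumes M: "valid_mesh M" "K < n_elem M" and u: "u \<in> T_time M K"
  shows "(\<lambda>t. indicator (slab M) t *\<^sub>R u t) \<in> borel_measurable borel"
proof -
  let ?S = "restrict_space borel (slab M)"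
  have "u \<in> borel_measurable ?S"
  proof (rule measurable_piecewise_restrict[of "subint M K ` {..<n_sub M K}"])
    show "space ?S \<subseteq> \<Union> (subint M K ` {..<n_sub M K})"
      using slab_UN[OF M] by (simp add: space_restrict_space)
    show "\<Omega> \<inter> space ?S \<in> sets ?S" if "\<Omega> \<in> subint M K ` {..<n_sub M K}" for \<Omega>
    proof -
      have "\<Omega> \<in> sets borel" using that by (auto simp: subint_def)
      then show ?thesis by (simp add: sets_restrict_space space_restrict_space Int_commute)
    qed
    show "u \<in> borel_measurable (restrict_space ?S \<Omega>)" if \<Omega>: "\<Omega> \<in> subint M K ` {..<n_sub M K}" for \<Omega>
    proof -
      obtain k where k: "k < n_sub M K" "\<Omega> = subint M K k" using \<Omega> by auto
      then obtain r where r: "\<And>t. t \<in> subint M K k \<Longrightarrow> u t = poly r t"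
        using u by (fastforce simp: T_time_def poly_space_def)
      have "poly r \<in> borel_measurable (restrict_space ?S \<Omega>)"
        by (intro measurable_restrict_space1 borel_measurable_continuous_onI continuous_intros)
      then show ?thesis
        using r k by (subst measurable_cong[of _ _ "poly r"]) (auto simp: space_restrict_space)
    qed
  qed simp
  then show ?thesis
    by (subst (asm) borel_measurable_restrict_space_iff) (simp_all add: slab_def)
qed

context
  fixes M
  assumes M: "valid_mesh M"
begin

lemma tensor_elem_rep:
  assumes K: "K < n_elem M" and v: "pull_back M K v \<in> tensor_space (slab M) (box 0 1) A (Q3_space (deg_x M K))"
  shows "\<exists>m a q. elem_rep M K A v m a q"
proof -
  let ?F = "el_map M K"
  note F = mesh_smooth[OF M K]
  obtain m a q where aq0: "(\<forall>i<m. a i \<in> A \<and> q i \<in> Q3_space (deg_x M K)) \<and>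
     (\<forall>t\<in>slab M. \<forall>\<xi>\<in>box 0 1. pull_back M K v t \<xi> = (\<Sum>i<(m::nat). a i t *\<^sub>R q i \<xi>))"
    using v unfolding tensor_space_def mem_Collect_eq by (elim exE)
  then have aq: "\<And>i. i < m \<Longrightarrow> a i \<in> A \<and> q i \<in> Q3_space (deg_x M K)"
     "\<And>t \<xi>. t \<in> slab M \<Longrightarrow> \<xi> \<in> box 0 1 \<Longrightarrow> pull_back M K v t \<xi> = (\<Sum>i<(m::nat). a i t *\<^sub>R q i \<xi>)"
    by simp_all
  have "v t x = separable m a (\<lambda>i. cov_field ?F (q i)) t x" if t: "t \<in> slab M" and x: "x \<in> interior (elem M K)" for t x
  proof -
    obtain \<xi> where \<xi>: "\<xi> \<in> box 0 1" "x = ?F \<xi>"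
      using x interior_elem[OF M K] by auto
    then have cube: "\<xi> \<in> cbox 0 1" using box_subset_cbox by blast
    have "transpose (jacobian ?F (at \<xi>)) *v v t (?F \<xi>) = (\<Sum>i<m. a i t *\<^sub>R q i \<xi>)"
      using aq(2)[OF t \<xi>(1)] by (simp add: pull_back_def)
    then have "v t (?F \<xi>) = jinvT (jacobian ?F (at \<xi>)) (\<Sum>i<m. a i t *\<^sub>R q i \<xi>)"
      using jinvT_unique[OF det_nz[OF F cube]] by blast
    then show ?thesis
      using \<xi>(2) ref_inv_F[OF F cube] by (simp add: separable_def cov_field_def jinvT_sum)
  qed
  then show ?thesis
    using aq(1) by (auto simp: elem_rep_def)
qed

lemma V_h_rep: "v \<in> V_h M \<Longrightarrow> K < n_elem M \<Longrightarrow> \<exists>m a q. elem_rep M K (S_time M K) v m a q"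
  using tensor_elem_rep by (auto simp: V_h_def)

lemma W_h_rep: "v \<in> W_h M \<Longrightarrow> K < n_elem M \<Longrightarrow> \<exists>m a q. elem_rep M K (T_time M K) v m a q"
  using tensor_elem_rep by (auto simp: W_h_def)

lemma cov_field_elem_continuous:
  "K < n_elem M \<Longrightarrow> q \<in> Q3_space p \<Longrightarrow> continuous_on (elem M K) (cov_field (el_map M K) q)"
  using cov_field_C1(1)[OF mesh_smooth[OF M]] by (simp add: elem_def)

lemma cov_field_bdd_meas:
  assumes "K < n_elem M" "q \<in> Q3_space p"
  shows "bdd_meas (lebesgue_on (interior (elem M K))) (\<lambda>x. cov_field (el_map M K) q x $ c)"
  using interior_elem_lmeasurable[OF M assms(1)]
  by (intro bdd_meas_continuous_compact[OF elem_compact[OF M assms(1)] _ interior_subset] continuous_on_component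
      cov_field_elem_continuous[OF assms]) auto

lemma T_time_cong:
  assumes "K < n_elem M" "\<And>t. t \<in> slab M \<Longrightarrow> u t = u' t"
  shows "u \<in> T_time M K \<longleftrightarrow> u' \<in> T_time M K"
  using subint_slab[OF M assms(1)] assms(2) unfolding T_time_eq[OF M assms(1)] poly_space_def
  by (auto simp: subset_iff)

lemma is_proj_slab_cong:
  assumes A: "A \<subseteq> {..<n_elem M}" and "\<And>t. t \<in> slab M \<Longrightarrow> u t = u' t" "\<And>t. t \<in> slab M \<Longrightarrow> p t = p' t"
  shows "is_proj (lebesgue_on (slab M)) (\<Inter>K\<in>A. T_time M K) u p \<longleftrightarrow>
    is_proj (lebesgue_on (slab M)) (\<Inter>K\<in>A. T_time M K) u' p'"
proof -
  have "(LINT t|lebesgue_on (slab M). (u t - p t) * w t) = (LINT t|lebesgue_on (slab M). (u' t - p' t) * w t)" for w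
    using assms by (intro Bochner_Integration.integral_cong) auto
  moreover have "p \<in> (\<Inter>K\<in>A. T_time M K) \<longleftrightarrow> p' \<in> (\<Inter>K\<in>A. T_time M K)"
    using T_time_cong[of _ p p'] A assms(3) by blast
  ultimately show ?thesis by (simp add: is_proj_def)
qed

lemma elem_rep_bdd_meas:
  assumes K: "K < n_elem M" and u: "elem_rep M K A u m a q" and A: "\<And>f. f \<in> A \<Longrightarrow> bdd_meas (lebesgue_on (slab M)) f"
  shows "bdd_meas (lebesgue_on (slab M) \<Otimes>\<^sub>M lebesgue_on (interior (elem M K))) (\<lambda>(t, x). u t x $ c)"
proof -
  let ?N = "lebesgue_on (slab M) \<Otimes>\<^sub>M lebesgue_on (interior (elem M K))"
  have "bdd_meas ?N (\<lambda>(t, x). separable m a (\<lambda>i. cov_field (el_map M K) (q i)) t x $ c)"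
    using u A cov_field_bdd_meas[OF K] by (intro separable_bdd_meas) (auto simp: elem_rep_def)
  then show ?thesis
    using u by (subst bdd_meas_cong[where g = "\<lambda>(t, x). separable m a (\<lambda>i. cov_field (el_map M K) (q i)) t x $ c"])
      (auto simp: elem_rep_def space_pair_measure)
qed

text \<open>The right-hand side is continuous on the closed element and equals the field in its
  interior, so it is the limit defining the trace.\<close>

lemma elem_rep_tr:
  assumes K: "K < n_elem M" and u: "elem_rep M K A u m a q" and t: "t \<in> slab M" and x: "x \<in> elem M K"
  shows "tr M u K t x = separable m a (\<lambda>i. cov_field (el_map M K) (q i)) t x"
  unfolding tr_def elem_def
proof (rule trace_lim[OF mesh_smooth[OF M K]])
  show "continuous_on (el_map M K ` cbox 0 1) (separable m a (\<lambda>i. cov_field (el_map M K) (q i)) t)"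
    using u cov_field_elem_continuous[OF K] unfolding separable_def elem_rep_def elem_def
    by (intro continuous_intros) auto
  show "u t y = separable m a (\<lambda>i. cov_field (el_map M K) (q i)) t y" if "y \<in> el_map M K ` box 0 1" for y
    using u t that interior_elem[OF M K] by (auto simp: elem_rep_def)
qed (use x in \<open>simp add: elem_def\<close>)

text \<open>Assembles a global field from prescribed temporal factors and shape functions on each
  element. The indicators select the element and make the field Borel measurable on the whole
  space.\<close>

definition glue :: "(nat \<Rightarrow> nat) \<Rightarrow> (nat \<Rightarrow> nat \<Rightarrow> real \<Rightarrow> real) \<Rightarrow> (nat \<Rightarrow> nat \<Rightarrow> real^3 \<Rightarrow> real^3) \<Rightarrow> field" where
  "glue m b q t x = (\<Sum>K<n_elem M. \<Sum>i<m K. (indicator (slab M) t *\<^sub>R b K i t) *\<^sub>R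
      (indicator (interior (elem M K)) x *\<^sub>R cov_field (el_map M K) (q K i) x))"

lemma glue_eq:
  assumes "t \<in> slab M" "K < n_elem M" "x \<in> interior (elem M K)"
  shows "glue m b q t x = separable (m K) (b K) (\<lambda>i. cov_field (el_map M K) (q K i)) t x"
proof -
  have "glue m b q t x = (\<Sum>K'<n_elem M. if K' = K then
      separable (m K) (b K) (\<lambda>i. cov_field (el_map M K) (q K i)) t x else 0)"
    unfolding glue_def
  proof (rule sum.cong[OF refl])
    fix K' assume K': "K' \<in> {..<n_elem M}"
    have "indicat_real (interior (elem M K')) x = (if K' = K then 1 else 0)"
      using elem_disjoint[OF M _ assms(2), of K'] K' assms(3) by (auto simp: indicator_def)
    then show "(\<Sum>i<m K'. (indicator (slab M) t *\<^sub>R b K' i t) *\<^sub>R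
        (indicat_real (interior (elem M K')) x *\<^sub>R cov_field (el_map M K') (q K' i) x)) =
      (if K' = K then separable (m K) (b K) (\<lambda>i. cov_field (el_map M K) (q K i)) t x else 0)"
      using assms(1) by (simp add: separable_def)
  qed
  then show ?thesis using assms(2) by simp
qed

text \<open>Members of \<open>W_h\<close> satisfy no condition across element interfaces, so
  arbitrary element-wise data may be combined.\<close>

lemma glue_W_h:
  assumes b: "\<And>K i. K < n_elem M \<Longrightarrow> i < m K \<Longrightarrow> b K i \<in> T_time M K \<and> q K i \<in> Q3_space (deg_x M K)"
  shows "glue m b q \<in> W_h M"
proof -
  define B where "B K i t = indicat_real (slab M) t *\<^sub>R b K i t" for K i t
  define Q where "Q K i x = indicat_real (interior (elem M K)) x *\<^sub>R cov_field (el_map M K) (q K i) x" for K i x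
  have B: "B K i \<in> borel_measurable borel" "\<exists>C. \<forall>t. \<bar>B K i t\<bar> \<le> C" if Ki: "K < n_elem M" "i < m K" for K i
  proof -
    show "B K i \<in> borel_measurable borel"
      unfolding B_def[abs_def] using T_time_borel[OF M Ki(1)] b[OF Ki] by blast
    obtain C where "C \<ge> 0" "\<forall>t\<in>slab M. \<bar>b K i t\<bar> \<le> C"
      using bdd_meas_bounded_image[OF T_time_bdd_meas[OF M Ki(1)], of "b K i"] b[OF Ki] by auto
    then show "\<exists>C. \<forall>t. \<bar>B K i t\<bar> \<le> C"
      by (intro exI[of _ C]) (auto simp: B_def indicator_def)
  qed
  have Q: "Q K i \<in> borel_measurable borel" "\<exists>C. \<forall>x. norm (Q K i x) \<le> C" if Ki: "K < n_elem M" "i < m K" for K i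
  proof -
    have cont: "continuous_on (elem M K) (cov_field (el_map M K) (q K i))"
      using cov_field_elem_continuous b Ki by blast
    then show "Q K i \<in> borel_measurable borel"
      unfolding Q_def[abs_def]
      by (intro borel_measurable_continuous_on_indicator continuous_on_subset[OF _ interior_subset]) auto
    obtain C where "\<forall>x\<in>elem M K. norm (cov_field (el_map M K) (q K i) x) \<le> C"
      using compact_imp_bounded[OF compact_continuous_image[OF cont elem_compact[OF M Ki(1)]]]
      by (auto simp: bounded_iff)
    then have "norm (Q K i x) \<le> max C 0" for x
      using interior_subset[of "elem M K"] by (cases "x \<in> interior (elem M K)") (auto simp: Q_def le_max_iff_disj)
    then show "\<exists>C. \<forall>x. norm (Q K i x) \<le> C"
      by blast
  qed
  have glue: "glue m b q t x = (\<Sum>K<n_elem M. \<Sum>i<m K. B K i t *\<^sub>R Q K i x)" for t x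
    by (simp add: glue_def B_def Q_def)
  have meas: "(\<lambda>(t, x). glue m b q t x) \<in> borel_measurable borel"
    unfolding glue case_prod_beta'
  proof (intro borel_measurable_sum borel_measurable_scaleR)
    fix K i assume *: "K \<in> {..<n_elem M}" "i \<in> {..<m K}"
    show "(\<lambda>z. B K i (fst z)) \<in> borel_measurable borel"
      using * by (intro measurable_compose[OF _ B(1)] borel_measurable_continuous_onI continuous_intros) auto
    show "(\<lambda>z. Q K i (snd z)) \<in> borel_measurable borel"
      using * by (intro measurable_compose[OF _ Q(1)] borel_measurable_continuous_onI continuous_intros) auto
  qed
  obtain C where C: "\<And>K i t. K < n_elem M \<Longrightarrow> i < m K \<Longrightarrow> \<bar>B K i t\<bar> \<le> C K i" using B(2) by metis
  obtain D where D: "\<And>K i x. K < n_elem M \<Longrightarrow> i < m K \<Longrightarrow> norm (Q K i x) \<le> D K i" using Q(2) by metis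
  have bound: "norm (glue m b q t x) \<le> (\<Sum>K<n_elem M. \<Sum>i<m K. C K i * D K i)" for t x
    unfolding glue
  proof (intro sum_norm_le)
    fix K i assume *: "K \<in> {..<n_elem M}" "i \<in> {..<m K}"
    then have "\<bar>B K i t\<bar> \<le> C K i" "norm (Q K i x) \<le> D K i" using C D by auto
    then show "norm (B K i t *\<^sub>R Q K i x) \<le> C K i * D K i"
      by (simp add: mult_mono')
  qed
  let ?S = "slab M \<times> Omega M"
  have "?S \<in> lmeasurable"
  proof (rule bounded_set_imp_lmeasurable)
    show "bounded ?S"
      using Omega_bounded[OF M] by (auto simp: slab_def intro!: bounded_Times)
  qed (use M in \<open>auto simp: slab_def valid_mesh_def intro!: sets_completionI_sets borel_Times\<close>)
  then have fin: "finite_measure (lebesgue_on ?S)" by (rule finite_measure_lebesgue_on)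
  have meas': "(\<lambda>(t, x). glue m b q t x) \<in> borel_measurable (lebesgue_on ?S)"
    using meas by (intro measurable_restrict_space1 measurable_completion) simp
  have "bdd_meas (lebesgue_on ?S) (\<lambda>z. (norm ((\<lambda>(t, x). glue m b q t x) z))\<^sup>2)"
    unfolding bdd_meas_def
  proof
    show "(\<lambda>z. (norm ((\<lambda>(t, x). glue m b q t x) z))\<^sup>2) \<in> borel_measurable (lebesgue_on ?S)"
      using borel_measurable_power[OF measurable_compose[OF meas' borel_measurable_norm]] by simp
    show "\<exists>C. \<forall>z\<in>space (lebesgue_on ?S). \<bar>(norm ((\<lambda>(t, x). glue m b q t x) z))\<^sup>2\<bar> \<le> C"
      using bound by (intro exI[of _ "(\<Sum>K<n_elem M. \<Sum>i<m K. C K i * D K i)\<^sup>2"]) (auto intro!: power_mono)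
  qed
  then have "(\<lambda>(t, x). glue m b q t x) \<in> L2 ?S"
    using meas' bdd_meas_integrable[OF fin] by (simp add: L2_def)
  then have "glue m b q \<in> L2_L2 (t_start M) (t_end M) (Omega M)"
    by (simp add: L2_L2_def slab_def)
  moreover have "pull_back M K (glue m b q) \<in> tensor_space (slab M) (box 0 1) (T_time M K) (Q3_space (deg_x M K))"
    if K: "K < n_elem M" for K
  proof -
    have "pull_back M K (glue m b q) t \<xi> = (\<Sum>i<m K. b K i t *\<^sub>R q K i \<xi>)" if t: "t \<in> slab M" and \<xi>: "\<xi> \<in> box 0 1" for t \<xi>
    proof -
      note F = mesh_smooth[OF M K]
      have cube: "\<xi> \<in> cbox 0 1" using \<xi> box_subset_cbox by blast
      have "el_map M K \<xi> \<in> interior (elem M K)" using \<xi> interior_elem[OF M K] by auto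
      then have "glue m b q t (el_map M K \<xi>) =
          jinvT (jacobian (el_map M K) (at \<xi>)) (\<Sum>i<m K. b K i t *\<^sub>R q K i \<xi>)"
        using glue_eq[OF t K] ref_inv_F[OF F cube] by (simp add: separable_def cov_field_def jinvT_sum)
      then show ?thesis
        using transpose_jinvT[OF det_nz[OF F cube]] by (simp add: pull_back_def)
    qed
    then show ?thesis
      using b K unfolding tensor_space_def by blast
  qed
  ultimately show ?thesis by (simp add: W_h_def)
qed


lemma is_proj_T_exists_single:
  assumes "K < n_elem M" "bdd_meas (lebesgue_on (slab M)) u"
  shows "\<exists>p. is_proj (lebesgue_on (slab M)) (T_time M K) u p"
  using is_proj_T_exists[OF M assms(1) _ T_time_subspace[OF M assms(1)] assms(2)] by blast

lemma T_time_component: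
  assumes "K < n_elem M" "elem_rep M K (T_time M K) u m b q" "x \<in> interior (elem M K)"
  shows "(\<lambda>t. u t x $ c) \<in> T_time M K"
proof -
  have "(\<lambda>t. separable m b (\<lambda>i. cov_field (el_map M K) (q i)) t x $ c) \<in> T_time M K"
    unfolding separable_nth using assms(2) T_time_subspace[OF M assms(1)]
    by (intro fun_subspace_sum) (auto simp: elem_rep_def fun_subspace_def)
  then show ?thesis
    using assms by (subst T_time_cong[OF assms(1)]) (auto simp: elem_rep_def)
qed

text \<open>At each fixed point \<open>w\<close> belongs componentwise to the temporal space, to
  which the error is orthogonal. The time integral thus vanishes for each point separately, and
  Fubini's theorem gives the claim.\<close>

lemma ip_projection_error:
  assumes E: "\<And>K. K < n_elem M \<Longrightarrow> elem_rep M K (S_time M K) E (m K) (a K) (q K)"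
    and p: "\<And>K. K < n_elem M \<Longrightarrow> elem_rep M K (T_time M K) p (m K) (b K) (q K)"
    and ab: "\<And>K i. K < n_elem M \<Longrightarrow> i < m K \<Longrightarrow> is_proj (lebesgue_on (slab M)) (T_time M K) (a K i) (b K i)"
    and w: "w \<in> W_h M"
  shows "ip M (E - p) w = 0"
proof -
  let ?N = "lebesgue_on (slab M)" and ?B = "\<lambda>K. lebesgue_on (interior (elem M K))"
  have "ip M (E - p) w = (\<Sum>K<n_elem M. LINT t|?N. LINT x|?B K. (E t x - p t x) \<bullet> w t x)"
    and "\<And>K. K < n_elem M \<Longrightarrow> bdd_meas (?N \<Otimes>\<^sub>M ?B K) (\<lambda>(t, x). (E t x - p t x) \<bullet> w t x)"
  proof -
    show *: "bdd_meas (?N \<Otimes>\<^sub>M ?B K) (\<lambda>(t, x). (E t x - p t x) \<bullet> w t x)" if K: "K < n_elem M" for K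
    proof -
      obtain m' b' q' where w': "elem_rep M K (T_time M K) w m' b' q'"
        using W_h_rep[OF w K] by blast
      have "bdd_meas (?N \<Otimes>\<^sub>M ?B K) (\<lambda>z. (\<lambda>(t, x). E t x $ c) z - (\<lambda>(t, x). p t x $ c) z)" for c
        by (intro bdd_meas_diff elem_rep_bdd_meas[OF K E[OF K]] elem_rep_bdd_meas[OF K p[OF K]] S_time_bdd_meas[OF M K] T_time_bdd_meas[OF M K])
      then show ?thesis
        by (intro bdd_meas_inner elem_rep_bdd_meas[OF K w'] T_time_bdd_meas[OF M K]) (auto simp: case_prod_beta')
    qed
    show "ip M (E - p) w = (\<Sum>K<n_elem M. LINT t|?N. LINT x|?B K. (E t x - p t x) \<bullet> w t x)"
      using * by (intro ip_elements[OF M _ negligible_empty]) (auto simp: fun_diff_def)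
  qed
  moreover have "(LINT t|?N. (E t x - p t x) \<bullet> w t x) = 0" if K: "K < n_elem M" and x: "x \<in> interior (elem M K)" for K x
  proof -
    obtain m' b' q' where w': "elem_rep M K (T_time M K) w m' b' q'"
      using W_h_rep[OF w K] by blast
    have wT: "(\<lambda>t. w t x $ c) \<in> T_time M K" for c
      using T_time_component[OF K w' x] .
    let ?Q = "\<lambda>i. cov_field (el_map M K) (q K i)"
    have bmE: "bdd_meas ?N (\<lambda>t. E t x $ c)" and bmp: "bdd_meas ?N (\<lambda>t. p t x $ c)" for c
      using bdd_meas_slice2[OF elem_rep_bdd_meas[OF K E[OF K] S_time_bdd_meas[OF M K]]]
        bdd_meas_slice2[OF elem_rep_bdd_meas[OF K p[OF K] T_time_bdd_meas[OF M K]]] x by auto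
    have "(LINT t|?N. (E t x $ c - p t x $ c) * w t x $ c) = 0" for c
    proof -
      have "is_proj ?N (T_time M K) (\<lambda>t. separable (m K) (a K) ?Q t x $ c) (\<lambda>t. separable (m K) (b K) ?Q t x $ c)"
        using E[OF K] ab[OF K]
        by (intro separable_is_proj slab_finite T_time_subspace[OF M K] T_time_bdd_meas[OF M K] S_time_bdd_meas[OF M K])
          (auto simp: elem_rep_def)
      then have "(LINT t|?N. (separable (m K) (a K) ?Q t x $ c - separable (m K) (b K) ?Q t x $ c) * w t x $ c) = 0"
        using wT by (auto simp: is_proj_def)
      moreover have "(LINT t|?N. (separable (m K) (a K) ?Q t x $ c - separable (m K) (b K) ?Q t x $ c) * w t x $ c) =
        (LINT t|?N. (E t x $ c - p t x $ c) * w t x $ c)"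
        using E[OF K] p[OF K] x by (intro Bochner_Integration.integral_cong) (auto simp: elem_rep_def)
      ultimately show ?thesis by simp
    qed
    moreover have "(LINT t|?N. (E t x - p t x) \<bullet> w t x) = (\<Sum>c\<in>UNIV. LINT t|?N. (E t x $ c - p t x $ c) * w t x $ c)"
      unfolding inner_3 vector_minus_component
      by (intro Bochner_Integration.integral_sum bdd_meas_integrable[OF slab_finite] bdd_meas_mult bdd_meas_diff bmE bmp T_time_bdd_meas[OF M K wT])
    ultimately show ?thesis by simp
  qed
  ultimately show ?thesis
    using double_integral_eq_0[OF slab_finite interior_elem_finite[OF M]] by simp
qed

lemma W_h_bdd_meas:
  assumes "u \<in> W_h M" "K < n_elem M"
  shows "bdd_meas (lebesgue_on (slab M) \<Otimes>\<^sub>M lebesgue_on (interior (elem M K))) (\<lambda>(t, x). u t x $ c)"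
  using W_h_rep[OF assms] elem_rep_bdd_meas[OF assms(2) _ T_time_bdd_meas[OF M assms(2)]] by blast

lemma V_h_bdd_meas:
  assumes "u \<in> V_h M" "K < n_elem M"
  shows "bdd_meas (lebesgue_on (slab M) \<Otimes>\<^sub>M lebesgue_on (interior (elem M K))) (\<lambda>(t, x). u t x $ c)"
  using V_h_rep[OF assms] elem_rep_bdd_meas[OF assms(2) _ S_time_bdd_meas[OF M assms(2)]] by blast

lemma ip_eq_sum_elements:
  assumes "\<And>K c. K < n_elem M \<Longrightarrow>
      bdd_meas (lebesgue_on (slab M) \<Otimes>\<^sub>M lebesgue_on (interior (elem M K))) (\<lambda>(t, x). u t x $ c)"
    and "\<And>K c. K < n_elem M \<Longrightarrow>
      bdd_meas (lebesgue_on (slab M) \<Otimes>\<^sub>M lebesgue_on (interior (elem M K))) (\<lambda>(t, x). v t x $ c)"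
  shows "ip M u v = (\<Sum>K<n_elem M. LINT t|lebesgue_on (slab M). LINT x|lebesgue_on (interior (elem M K)). u t x \<bullet> v t x)"
  using assms by (intro ip_elements[OF M _ negligible_empty] bdd_meas_inner) auto

text \<open>Exchanging the integrals, \<open>d\<close> vanishes at all times for almost every point, being polynomial in
  time on the subintervals, and then at every point by continuity in space.\<close>

lemma elem_field_eq_0:
  fixes d :: field
  assumes K: "K < n_elem M" and d: "\<And>x c. x \<in> interior (elem M K) \<Longrightarrow> (\<lambda>t. d t x $ c) \<in> T_time M K"
    and cont: "\<And>t. t \<in> slab M \<Longrightarrow> continuous_on (interior (elem M K)) (d t)"
    and bdd_meas: "\<And>c. bdd_meas (lebesgue_on (slab M) \<Otimes>\<^sub>M lebesgue_on (interior (elem M K))) (\<lambda>(t, x). d t x $ c)"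
    and 0: "(LINT t|lebesgue_on (slab M). LINT x|lebesgue_on (interior (elem M K)). d t x \<bullet> d t x) = 0"
    and t: "t \<in> slab M" and x: "x \<in> interior (elem M K)"
  shows "d t x = 0"
proof -
  let ?N = "lebesgue_on (slab M)" and ?B = "lebesgue_on (interior (elem M K))"
  let ?I = "\<lambda>x. LINT t|?N. d t x \<bullet> d t x"
  have bmd: "bdd_meas (?N \<Otimes>\<^sub>M ?B) (\<lambda>(t, x). d t x \<bullet> d t x)"
    by (intro bdd_meas_inner bdd_meas)
  have fin: "finite_measure ?N" "finite_measure ?B"
    using slab_finite interior_elem_finite[OF M K] by auto
  have "bdd_meas (?B \<Otimes>\<^sub>M ?N) (\<lambda>(x, t). d t x \<bullet> d t x)"
    using bmd measurable_pair_swap[of "\<lambda>(t, x). d t x \<bullet> d t x" ?N ?B borel]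
    by (auto simp: bdd_meas_def space_pair_measure)
  then have int: "integrable ?B ?I"
    using bdd_meas_finite_pair(1)[OF fin(2,1)] by blast
  have "(LINT x|?B. ?I x) = 0"
    using 0 bdd_meas_finite_pair(2)[OF fin bmd] by simp
  then have "AE x in ?B. ?I x = 0"
    using integral_nonneg_eq_0_iff_AE[OF int] by (simp add: integral_nonneg_AE)
  then obtain N where N: "N \<in> null_sets ?B" "{x \<in> interior (elem M K). ?I x \<noteq> 0} \<subseteq> N"
    by (auto simp: eventually_ae_filter)
  then have negl: "negligible N"
    using interior_elem_lmeasurable[OF M K] by (metis fmeasurableD negligible_iff_null_sets null_sets_restrict_space)
  have zero: "d t y = 0" if y: "y \<in> interior (elem M K) - N" for y
  proof -
    have I: "?I y = 0" using y N by auto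
    have bmT: "bdd_meas ?N (\<lambda>t. d t y $ c)" for c
      using T_time_bdd_meas[OF M K d] y by blast
    have "?I y = (\<Sum>c\<in>UNIV. LINT t|?N. d t y $ c * d t y $ c)"
      unfolding inner_3 by (intro Bochner_Integration.integral_sum bdd_meas_integrable[OF fin(1)] bdd_meas_mult bmT)
    then have "(\<Sum>c\<in>UNIV. LINT t|?N. d t y $ c * d t y $ c) = 0" using I by simp
    then have "(LINT t|?N. d t y $ c * d t y $ c) = 0" for c
      by (subst (asm) sum_nonneg_eq_0_iff) auto
    then show ?thesis
      using T_time_integral_eq_0[OF M K d _ t] y by (auto simp: vec_eq_iff)
  qed
  show ?thesis
  proof (rule ccontr)
    assume nz: "d t x \<noteq> 0"
    have "open {y \<in> interior (elem M K). d t y \<in> - {0}}"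
      using continuous_open_preimage[OF cont[OF t] open_interior, of "- {0}"] by (auto simp: vimage_def Int_def)
    moreover have "negligible {y \<in> interior (elem M K). d t y \<in> - {0}}"
      using zero by (intro negligible_subset[OF negl]) auto
    ultimately show False
      using open_not_negligible nz x by blast
  qed
qed

lemma elem_rep_continuous:
  assumes "K < n_elem M" "elem_rep M K A u m a q" "t \<in> slab M"
  shows "continuous_on (interior (elem M K)) (u t)"
proof -
  have "continuous_on (interior (elem M K)) (separable m a (\<lambda>i. cov_field (el_map M K) (q i)) t)"
    using assms(2) cov_field_elem_continuous[OF assms(1)] unfolding separable_def elem_rep_def
    by (intro continuous_intros continuous_on_subset[OF _ interior_subset]) auto
  then show ?thesis
    using assms by (subst continuous_on_cong[OF refl, of _ _ "separable m a (\<lambda>i. cov_field (el_map M K) (q i)) t"])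
      (auto simp: elem_rep_def)
qed

text \<open>The explicit candidate \<open>p0\<close> is an orthogonal projection, and so is the
  chosen one once existence is known. Their difference has norm zero, and
  \<open>elem_field_eq_0\<close> turns this into equality at every point of the open
  elements.\<close>

lemma proj_W_rep:
  assumes E: "E \<in> V_h M"
  shows "proj_W M E \<in> W_h M"
    and "K < n_elem M \<Longrightarrow> \<exists>m a b q. elem_rep M K (S_time M K) E m a q \<and> elem_rep M K (T_time M K) (proj_W M E) m b q \<and>
      (\<forall>i<m. is_proj (lebesgue_on (slab M)) (T_time M K) (a i) (b i))"
proof -
  let ?N = "lebesgue_on (slab M)"
  obtain m a q where E_rep: "\<And>K. K < n_elem M \<Longrightarrow> elem_rep M K (S_time M K) E (m K) (a K) (q K)"
    using V_h_rep[OF E] by metis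
  have "\<forall>K i. \<exists>p. K < n_elem M \<and> i < m K \<longrightarrow> is_proj ?N (T_time M K) (a K i) p"
    using is_proj_T_exists_single S_time_bdd_meas[OF M] E_rep by (meson elem_rep_def)
  then obtain b where b: "\<And>K i. K < n_elem M \<Longrightarrow> i < m K \<Longrightarrow> is_proj ?N (T_time M K) (a K i) (b K i)"
    by metis
  define p0 where "p0 = glue m b q"
  have bq: "b K i \<in> T_time M K \<and> q K i \<in> Q3_space (deg_x M K)" if "K < n_elem M" "i < m K" for K i
    using b[OF that] E_rep[OF that(1)] that(2) by (auto simp: is_proj_def elem_rep_def)
  have p0: "p0 \<in> W_h M"
    unfolding p0_def using bq by (rule glue_W_h)
  have p0_rep: "elem_rep M K (T_time M K) p0 (m K) (b K) (q K)" if "K < n_elem M" for K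
    using bq that glue_eq[OF _ that] by (auto simp: elem_rep_def p0_def)
  have p0_orth: "ip M (E - p0) w = 0" if "w \<in> W_h M" for w
    using ip_projection_error[OF E_rep p0_rep b that] .
  let ?p = "proj_W M E"
  have "?p \<in> W_h M \<and> (\<forall>w\<in>W_h M. ip M (E - ?p) w = 0)"
    unfolding proj_W_def orth_proj_def using p0 p0_orth by (intro someI_ex[of "\<lambda>p. p \<in> W_h M \<and> (\<forall>w\<in>W_h M. ip M (E - p) w = 0)"]) blast
  then have p: "?p \<in> W_h M" and p_orth: "\<And>w. w \<in> W_h M \<Longrightarrow> ip M (E - ?p) w = 0"
    by auto
  show "?p \<in> W_h M" by (rule p)
  let ?B = "\<lambda>K. lebesgue_on (interior (elem M K))"
  have bmW: "bdd_meas (?N \<Otimes>\<^sub>M ?B K) (\<lambda>(t, x). u t x $ c)" if "u \<in> W_h M \<or> u \<in> V_h M" "K < n_elem M" for u K c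
    using that W_h_bdd_meas V_h_bdd_meas by blast
  have bmd: "bdd_meas (?N \<Otimes>\<^sub>M ?B K) (\<lambda>(t, x). (u - v) t x $ c)"
    if "u \<in> W_h M \<or> u \<in> V_h M" "v \<in> W_h M" "K < n_elem M" for u v K c
    using bdd_meas_diff[OF bmW[OF that(1,3), of c] bmW[OF _ that(3), of v c]] that(2) by (simp add: case_prod_beta')
  have diff: "ip M (u - v) w = ip M u w - ip M v w"
    if u: "u \<in> W_h M \<or> u \<in> V_h M" and v: "v \<in> W_h M" and w: "w \<in> W_h M" for u v w
  proof -
    have "(LINT t|?N. LINT x|?B K. (u - v) t x \<bullet> w t x) =
      (LINT t|?N. LINT x|?B K. u t x \<bullet> w t x) - (LINT t|?N. LINT x|?B K. v t x \<bullet> w t x)"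
      if K: "K < n_elem M" for K
    proof -
      have "bdd_meas (?N \<Otimes>\<^sub>M ?B K) (\<lambda>(t, x). u t x \<bullet> w t x)" "bdd_meas (?N \<Otimes>\<^sub>M ?B K) (\<lambda>(t, x). v t x \<bullet> w t x)"
        using u v w K by (intro bdd_meas_inner bmW; simp)+
      from double_integral_diff[OF slab_finite interior_elem_finite[OF M K] this] show ?thesis
        by (simp add: inner_diff_left)
    qed
    then show ?thesis
      using u v w by (simp add: ip_eq_sum_elements[OF bmd bmW] ip_eq_sum_elements[OF bmW bmW] sum_subtractf)
  qed
  have comm: "ip M u v = ip M v u" for u v by (simp add: ip_def inner_commute)
  have eqs: "ip M ?p w = ip M E w" "ip M p0 w = ip M E w" if "w \<in> W_h M" for w
    using p_orth[OF that] p0_orth[OF that] diff[OF _ p that, of E] diff[OF _ p0 that, of E] E by auto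
  \<comment> \<open>The squared norm of the difference, expanded so that orthogonality is applied to
    \<open>?p\<close> and \<open>p0\<close> separately, both of which are known members of
    \<open>W_h\<close>.\<close>
  have 0: "ip M ?p ?p - ip M p0 ?p - (ip M ?p p0 - ip M p0 p0) = 0"
    using eqs[OF p] eqs[OF p0] by simp
  let ?d = "?p - p0"
  have "(\<Sum>K<n_elem M. LINT t|?N. LINT x|?B K. ?d t x \<bullet> ?d t x) = 0"
  proof -
    have "(LINT t|?N. LINT x|?B K. ?d t x \<bullet> ?d t x) =
        (LINT t|?N. LINT x|?B K. ?d t x \<bullet> ?p t x) - (LINT t|?N. LINT x|?B K. ?d t x \<bullet> p0 t x)"
      if K: "K < n_elem M" for K
    proof -
      have "bdd_meas (?N \<Otimes>\<^sub>M ?B K) (\<lambda>(t, x). ?d t x \<bullet> ?p t x)" "bdd_meas (?N \<Otimes>\<^sub>M ?B K) (\<lambda>(t, x). ?d t x \<bullet> p0 t x)"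
        using bmd[OF _ p0 K, of ?p] bmW[OF _ K, of ?p] bmW[OF _ K, of p0] p p0 by (intro bdd_meas_inner; simp)+
      from double_integral_diff[OF slab_finite interior_elem_finite[OF M K] this] show ?thesis
        by (simp add: inner_diff_right)
    qed
    then have "(\<Sum>K<n_elem M. LINT t|?N. LINT x|?B K. ?d t x \<bullet> ?d t x) = ip M ?d ?p - ip M ?d p0"
      using p p0 by (simp add: ip_eq_sum_elements[OF bmd bmW] sum_subtractf)
    then show ?thesis using 0 diff[OF _ p0 p] diff[OF _ p0 p0] p by simp
  qed
  then have zero: "(LINT t|?N. LINT x|?B K. ?d t x \<bullet> ?d t x) = 0" if "K < n_elem M" for K
    using that by (subst (asm) sum_nonneg_eq_0_iff) (auto intro!: integral_nonneg_AE)
  show "\<exists>m a b q. elem_rep M K (S_time M K) E m a q \<and> elem_rep M K (T_time M K) (proj_W M E) m b q \<and>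
      (\<forall>i<m. is_proj (lebesgue_on (slab M)) (T_time M K) (a i) (b i))" if K: "K < n_elem M"
  proof -
    obtain m' b' q' where p_rep: "elem_rep M K (T_time M K) ?p m' b' q'"
      using W_h_rep[OF p K] by blast
    have "?d t x = 0" if t: "t \<in> slab M" and x: "x \<in> interior (elem M K)" for t x
    proof (rule elem_field_eq_0[OF K _ _ bmd[OF _ p0 K] zero[OF K] t x])
      show "(\<lambda>t. ?d t y $ c) \<in> T_time M K" if "y \<in> interior (elem M K)" for y c
        using fun_subspace_diff[OF T_time_subspace[OF M K] T_time_component[OF K p_rep that]
            T_time_component[OF K p0_rep[OF K] that]] by simp
      show "continuous_on (interior (elem M K)) (?d t)" if "t \<in> slab M" for t
        using continuous_on_diff[OF elem_rep_continuous[OF K p_rep that] elem_rep_continuous[OF K p0_rep[OF K] that]]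
        by (simp add: fun_diff_def)
    qed (use p in auto)
    then have "elem_rep M K (T_time M K) ?p (m K) (b K) (q K)"
      using p0_rep[OF K] by (auto simp: elem_rep_def)
    then show ?thesis
      using E_rep[OF K] b[OF K] by blast
  qed
qed

end

section \<open>Volume terms\<close>

text \<open>A constant matrix \<open>\<beta>\<close> covers both products needed: the inner product
  for volume terms and, with a fixed normal, the triple product for face terms.\<close>

lemma integral_bilinear_adjoint:
  fixes \<beta> :: "3 \<Rightarrow> 3 \<Rightarrow> real"
  assumes N: "finite_measure N" and W: "\<And>w. w \<in> W \<Longrightarrow> bdd_meas N w"
    and u: "\<And>c. is_proj N W (\<lambda>t. u t $ c) (\<lambda>t. pu t $ c)" "\<And>c. bdd_meas N (\<lambda>t. u t $ c)"
    and v: "\<And>c. is_proj N W (\<lambda>t. v t $ c) (\<lambda>t. pv t $ c)" "\<And>c. bdd_meas N (\<lambda>t. v t $ c)"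
  shows "(LINT t|N. (\<Sum>c\<in>UNIV. \<Sum>c'\<in>UNIV. \<beta> c c' * (u t $ c * pv t $ c'))) =
    (LINT t|N. (\<Sum>c\<in>UNIV. \<Sum>c'\<in>UNIV. \<beta> c c' * (pu t $ c * v t $ c')))"
proof -
  have p: "bdd_meas N (\<lambda>t. pu t $ c)" "bdd_meas N (\<lambda>t. pv t $ c)" for c
    using W u(1) v(1) by (auto simp: is_proj_def)
  have "(LINT t|N. (\<Sum>c\<in>UNIV. \<Sum>c'\<in>UNIV. \<beta> c c' * (f t $ c * g t $ c'))) =
    (\<Sum>c\<in>UNIV. \<Sum>c'\<in>UNIV. \<beta> c c' * (LINT t|N. f t $ c * g t $ c'))"
    if "\<And>c. bdd_meas N (\<lambda>t. f t $ c)" "\<And>c. bdd_meas N (\<lambda>t. g t $ c)" for f g :: "_ \<Rightarrow> real^3"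
  proof -
    have int: "integrable N (\<lambda>t. f t $ c * g t $ c')" for c c'
      by (intro bdd_meas_integrable N bdd_meas_mult that)
    then have "(LINT t|N. (\<Sum>c\<in>UNIV. \<Sum>c'\<in>UNIV. \<beta> c c' * (f t $ c * g t $ c'))) =
      (\<Sum>c\<in>UNIV. LINT t|N. (\<Sum>c'\<in>UNIV. \<beta> c c' * (f t $ c * g t $ c')))"
      by (intro Bochner_Integration.integral_sum Bochner_Integration.integrable_sum integrable_mult_right)
    also have "\<dots> = (\<Sum>c\<in>UNIV. \<Sum>c'\<in>UNIV. LINT t|N. \<beta> c c' * (f t $ c * g t $ c'))"
      using int by (intro sum.cong refl Bochner_Integration.integral_sum integrable_mult_right)
    finally show ?thesis by simp
  qed
  then show ?thesis
    using p u(2) v(2) is_proj_adjoint[OF N u(1) v(1) u(2) v(2) W] by simp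
qed

lemma inner_as_bilinear: "(u::real^3) \<bullet> w = (\<Sum>c\<in>UNIV. \<Sum>c'\<in>UNIV. (if c = c' then 1 else 0) * (u $ c * w $ c'))"
  by (simp add: inner_3 if_distrib if_distribR cong: if_cong)

lemma cross_as_bilinear:
  "u \<bullet> cross3 n w = (\<Sum>c\<in>UNIV. \<Sum>c'\<in>UNIV. (axis c 1 \<bullet> cross3 n (axis c' 1)) * (u $ c * w $ c'))"
  by (simp add: inner_3 sum_3 cross3_def axis_def algebra_simps)

lemma integral_inner_adjoint:
  assumes "finite_measure N" "\<And>w. w \<in> W \<Longrightarrow> bdd_meas N w"
    and "\<And>c. is_proj N W (\<lambda>t. u t $ c) (\<lambda>t. pu t $ c)" "\<And>c. bdd_meas N (\<lambda>t. u t $ c)"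
    and "\<And>c. is_proj N W (\<lambda>t. v t $ c) (\<lambda>t. pv t $ c)" "\<And>c. bdd_meas N (\<lambda>t. v t $ c)"
  shows "(LINT t|N. u t \<bullet> pv t) = (LINT t|N. pu t \<bullet> (v t :: real^3))"
  unfolding inner_as_bilinear by (rule integral_bilinear_adjoint[OF assms])

lemma integral_cross_adjoint:
  assumes "finite_measure N" "\<And>w. w \<in> W \<Longrightarrow> bdd_meas N w"
    and "\<And>c. is_proj N W (\<lambda>t. u t $ c) (\<lambda>t. pu t $ c)" "\<And>c. bdd_meas N (\<lambda>t. u t $ c)"
    and "\<And>c. is_proj N W (\<lambda>t. v t $ c) (\<lambda>t. pv t $ c)" "\<And>c. bdd_meas N (\<lambda>t. v t $ c)"
  shows "(LINT t|N. u t \<bullet> cross3 n (pv t)) = (LINT t|N. pu t \<bullet> cross3 n (v t))"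
  using integral_bilinear_adjoint[OF assms, of "\<lambda>c c'. axis c 1 \<bullet> cross3 n (axis c' 1)"]
  by (simp only: flip: cross_as_bilinear)

lemma jacobian_eq: "(f has_derivative f') (at x) \<Longrightarrow> jacobian f (at x) $ i $ j = f' (axis j 1) $ i"
  by (simp add: jacobian_def matrix_def frechet_derivative_at[symmetric])

text \<open>\<open>curl_h\<close> expects a field depending on time, so a constant one is supplied
  and evaluated at the arbitrary time 0.\<close>

definition curl_cov :: "(real^3 \<Rightarrow> real^3) \<Rightarrow> (real^3 \<Rightarrow> real^3) \<Rightarrow> real^3 \<Rightarrow> real^3" where
  "curl_cov F q = curl_h (\<lambda>_. cov_field F q) 0"

lemma time_regular_lincomb:
  assumes "finite I" "\<And>i. i \<in> I \<Longrightarrow> time_regular a b (u i) (u' i) (u0 i)"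
  shows "time_regular a b (\<lambda>t. \<Sum>i\<in>I. c i * u i t) (\<lambda>t. \<Sum>i\<in>I. c i * u' i t) (\<Sum>i\<in>I. c i * u0 i)"
proof -
  have "\<forall>i. \<exists>U N. i \<in> I \<longrightarrow> continuous_on {a..b} U \<and> (\<forall>t\<in>{a<..b}. u i t = U t) \<and> U a = u0 i \<and>
     finite N \<and> (\<forall>t\<in>{a<..<b} - N. (u i has_real_derivative u' i t) (at t))"
    using assms(2) unfolding time_regular_def by blast
  then obtain U N where UN: "\<And>i. i \<in> I \<Longrightarrow> continuous_on {a..b} (U i) \<and> (\<forall>t\<in>{a<..b}. u i t = U i t) \<and> U i a = u0 i \<and>
     finite (N i) \<and> (\<forall>t\<in>{a<..<b} - N i. (u i has_real_derivative u' i t) (at t))"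
    by metis
  show ?thesis
    unfolding time_regular_def
  proof (intro exI conjI)
    show "continuous_on {a..b} (\<lambda>t. \<Sum>i\<in>I. c i * U i t)"
      using UN by (intro continuous_intros) auto
    show "finite (\<Union>i\<in>I. N i)" using UN assms(1) by auto
    show "\<forall>t\<in>{a<..<b} - (\<Union>i\<in>I. N i). ((\<lambda>t. \<Sum>i\<in>I. c i * u i t) has_real_derivative (\<Sum>i\<in>I. c i * u' i t)) (at t)"
      using UN by (intro ballI DERIV_sum DERIV_cmult) auto
  qed (use UN in auto)
qed

context
  fixes M
  assumes M: "valid_mesh M"
begin

lemma curl_cov_props:
  assumes K: "K < n_elem M" and q: "q \<in> Q3_space p"
  shows "bdd_meas (lebesgue_on (interior (elem M K))) (\<lambda>x. curl_cov (el_map M K) q x $ c)"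
    and "x \<in> interior (elem M K) \<Longrightarrow> cov_field (el_map M K) q differentiable (at x)"
proof -
  let ?F = "el_map M K"
  obtain D where D: "\<And>x. x \<in> interior (elem M K) \<Longrightarrow> (cov_field ?F q has_derivative D x) (at x)"
      "\<And>h. continuous_on (elem M K) (\<lambda>x. D x h)"
    using cov_field_C1(2)[OF mesh_smooth[OF M K] q] interior_elem[OF M K] by (auto simp: elem_def)
  show "x \<in> interior (elem M K) \<Longrightarrow> cov_field ?F q differentiable (at x)"
    using D(1) differentiable_def by blast
  let ?curl = "\<lambda>x. vector [D x (axis 2 1) $ 3 - D x (axis 3 1) $ 2, D x (axis 3 1) $ 1 - D x (axis 1 1) $ 3,
      D x (axis 1 1) $ 2 - D x (axis 2 1) $ 1] :: real^3"
  have "curl_cov ?F q x = ?curl x" if "x \<in> interior (elem M K)" for x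
    by (simp add: curl_cov_def curl_h_def jacobian_eq[OF D(1)[OF that]])
  then have "bdd_meas (lebesgue_on (interior (elem M K))) (\<lambda>x. curl_cov ?F q x $ c) \<longleftrightarrow>
      bdd_meas (lebesgue_on (interior (elem M K))) (\<lambda>x. ?curl x $ c)"
    by (intro bdd_meas_cong) simp
  moreover have "continuous_on (elem M K) (\<lambda>x. ?curl x $ c)"
    using exhaust_3[of c] by (elim disjE; simp; intro continuous_intros continuous_on_component D(2))
  then have "bdd_meas (lebesgue_on (interior (elem M K))) (\<lambda>x. ?curl x $ c)"
    using interior_elem_lmeasurable[OF M K]
    by (intro bdd_meas_continuous_compact[OF elem_compact[OF M K] _ interior_subset]) auto
  ultimately show "bdd_meas (lebesgue_on (interior (elem M K))) (\<lambda>x. curl_cov ?F q x $ c)"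
    by simp
qed

text \<open>The curl acts on the spatial factors and leaves the temporal ones alone. Applied to a
  field and to its projection, this expresses that the projection commutes with the curl.\<close>

lemma elem_rep_curl:
  assumes K: "K < n_elem M" and u: "elem_rep M K A u m a q" and t: "t \<in> slab M" and x: "x \<in> interior (elem M K)"
  shows "curl_h u t x = separable m a (\<lambda>i. curl_cov (el_map M K) (q i)) t x"
proof -
  let ?Q = "\<lambda>i. cov_field (el_map M K) (q i)"
  have Q: "(?Q i has_derivative (\<lambda>h. jacobian (?Q i) (at x) *v h)) (at x)" if "i < m" for i
    using curl_cov_props(2)[OF K _ x] u that by (auto simp: elem_rep_def simp flip: jacobian_works)
  have "(separable m a ?Q t has_derivative (\<lambda>h. \<Sum>i<m. a i t *\<^sub>R (jacobian (?Q i) (at x) *v h))) (at x)"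
    unfolding separable_def using Q by (intro has_derivative_sum has_derivative_scaleR_right) auto
  then have "(u t has_derivative (\<lambda>h. \<Sum>i<m. a i t *\<^sub>R (jacobian (?Q i) (at x) *v h))) (at x)"
    by (rule has_derivative_transform_within_open[OF _ open_interior x]) (use u t in \<open>simp add: elem_rep_def\<close>)
  from jacobian_eq[OF this]
  have "jacobian (u t) (at x) $ i $ j = (\<Sum>k<m. a k t * (jacobian (?Q k) (at x) $ i $ j))" for i j
    by (simp add: matrix_vector_mult_basis column_def)
  then show ?thesis
    by (simp add: curl_h_def curl_cov_def separable_def Let_def vec_eq_iff forall_3 sum_subtractf right_diff_distrib)
qed

text \<open>At a fixed point, the curl of the projection of \<open>E\<close> is the temporal
  projection of the curl of \<open>E\<close>. Self-adjointness in time moves the projection onto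
  \<open>H\<close>, and Fubini's theorem integrates over the element.\<close>

lemma curl_terms_cancel:
  assumes E: "E \<in> V_h M" and H: "H \<in> V_h M"
  shows "ip M H (curl_h (proj_W M E)) = ip M (curl_h E) (proj_W M H)"
proof -
  let ?N = "lebesgue_on (slab M)" and ?B = "\<lambda>K. lebesgue_on (interior (elem M K))"
  let ?pE = "proj_W M E" and ?pH = "proj_W M H"
  have main: "bdd_meas (?N \<Otimes>\<^sub>M ?B K) (\<lambda>(t, x). H t x \<bullet> curl_h ?pE t x) \<and>
     bdd_meas (?N \<Otimes>\<^sub>M ?B K) (\<lambda>(t, x). curl_h E t x \<bullet> ?pH t x) \<and>
     (LINT t|?N. LINT x|?B K. H t x \<bullet> curl_h ?pE t x) = (LINT t|?N. LINT x|?B K. curl_h E t x \<bullet> ?pH t x)"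
    if K: "K < n_elem M" for K
  proof -
    note bmT = T_time_bdd_meas[OF M K] and bmS = S_time_bdd_meas[OF M K]
    obtain m a b q where rE: "elem_rep M K (S_time M K) E m a q" "elem_rep M K (T_time M K) ?pE m b q"
      "\<And>i. i < m \<Longrightarrow> is_proj ?N (T_time M K) (a i) (b i)"
      using proj_W_rep(2)[OF M E K] by blast
    obtain m' a' b' q' where rH: "elem_rep M K (S_time M K) H m' a' q'" "elem_rep M K (T_time M K) ?pH m' b' q'"
      "\<And>i. i < m' \<Longrightarrow> is_proj ?N (T_time M K) (a' i) (b' i)"
      using proj_W_rep(2)[OF M H K] by blast
    let ?C = "\<lambda>i. curl_cov (el_map M K) (q i)"
    have bdd_meas_curl: "bdd_meas (?N \<Otimes>\<^sub>M ?B K) (\<lambda>(t, x). curl_h u t x $ c)"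
      if u: "elem_rep M K A u m d q" "\<And>w. w \<in> A \<Longrightarrow> bdd_meas ?N w" for A u d c
    proof -
      have "bdd_meas (?N \<Otimes>\<^sub>M ?B K) (\<lambda>(t, x). separable m d ?C t x $ c)"
        using u curl_cov_props(1)[OF K] by (intro separable_bdd_meas) (auto simp: elem_rep_def)
      then show ?thesis
        by (subst bdd_meas_cong[where g = "\<lambda>(t, x). separable m d ?C t x $ c"])
          (auto simp: space_pair_measure elem_rep_curl[OF K u(1)])
    qed
    have bmH: "bdd_meas (?N \<Otimes>\<^sub>M ?B K) (\<lambda>(t, x). H t x $ c)" and bmpH: "bdd_meas (?N \<Otimes>\<^sub>M ?B K) (\<lambda>(t, x). ?pH t x $ c)" for c
      using elem_rep_bdd_meas[OF M K rH(1) bmS] elem_rep_bdd_meas[OF M K rH(2) bmT] by auto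
    have 1: "bdd_meas (?N \<Otimes>\<^sub>M ?B K) (\<lambda>(t, x). H t x \<bullet> curl_h ?pE t x)"
      by (intro bdd_meas_inner bmH bdd_meas_curl[OF rE(2)]; erule bmT)
    have 2: "bdd_meas (?N \<Otimes>\<^sub>M ?B K) (\<lambda>(t, x). curl_h E t x \<bullet> ?pH t x)"
      by (intro bdd_meas_inner bmpH bdd_meas_curl[OF rE(1)]; erule bmS)
    have "(LINT t|?N. H t x \<bullet> curl_h ?pE t x) = (LINT t|?N. curl_h E t x \<bullet> ?pH t x)"
      if x: "x \<in> interior (elem M K)" for x
    proof -
      have "(LINT t|?N. separable m' a' (\<lambda>i. cov_field (el_map M K) (q' i)) t x \<bullet> separable m b ?C t x) =
        (LINT t|?N. separable m' b' (\<lambda>i. cov_field (el_map M K) (q' i)) t x \<bullet> separable m a ?C t x)"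
      proof (rule integral_inner_adjoint[OF slab_finite bmT])
        show "is_proj ?N (T_time M K) (\<lambda>t. separable m' a' (\<lambda>i. cov_field (el_map M K) (q' i)) t x $ c)
            (\<lambda>t. separable m' b' (\<lambda>i. cov_field (el_map M K) (q' i)) t x $ c)" for c
          using rH bmS by (intro separable_is_proj[OF slab_finite T_time_subspace[OF M K] bmT]) (auto simp: elem_rep_def)
        show "is_proj ?N (T_time M K) (\<lambda>t. separable m a ?C t x $ c) (\<lambda>t. separable m b ?C t x $ c)" for c
          using rE bmS by (intro separable_is_proj[OF slab_finite T_time_subspace[OF M K] bmT]) (auto simp: elem_rep_def)
        show "bdd_meas ?N (\<lambda>t. separable m' a' (\<lambda>i. cov_field (el_map M K) (q' i)) t x $ c)" for c
          unfolding separable_nth using rH bmS by (intro bdd_meas_intros) (auto simp: elem_rep_def)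
        show "bdd_meas ?N (\<lambda>t. separable m a ?C t x $ c)" for c
          unfolding separable_nth using rE bmS by (intro bdd_meas_intros) (auto simp: elem_rep_def)
      qed
      moreover have "(LINT t|?N. H t x \<bullet> curl_h ?pE t x) =
          (LINT t|?N. separable m' a' (\<lambda>i. cov_field (el_map M K) (q' i)) t x \<bullet> separable m b ?C t x)"
        using rH(1) x by (intro Bochner_Integration.integral_cong refl)
          (auto simp: elem_rep_def elem_rep_curl[OF K rE(2)])
      moreover have "(LINT t|?N. curl_h E t x \<bullet> ?pH t x) =
          (LINT t|?N. separable m' b' (\<lambda>i. cov_field (el_map M K) (q' i)) t x \<bullet> separable m a ?C t x)"
        using rH(2) x by (intro Bochner_Integration.integral_cong refl)
          (auto simp: elem_rep_def elem_rep_curl[OF K rE(1)] inner_commute)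
      ultimately show ?thesis by simp
    qed
    then have "(LINT x|?B K. LINT t|?N. H t x \<bullet> curl_h ?pE t x) = (LINT x|?B K. LINT t|?N. curl_h E t x \<bullet> ?pH t x)"
      by (intro Bochner_Integration.integral_cong[OF refl, of "?B K"]) simp
    then show ?thesis
      using 1 2 bdd_meas_finite_pair(2)[OF slab_finite interior_elem_finite[OF M K]] by simp
  qed
  have "ip M H (curl_h ?pE) = (\<Sum>K<n_elem M. LINT t|?N. LINT x|?B K. H t x \<bullet> curl_h ?pE t x)"
    using main by (intro ip_elements[OF M _ negligible_empty]) auto
  moreover have "ip M (curl_h E) ?pH = (\<Sum>K<n_elem M. LINT t|?N. LINT x|?B K. curl_h E t x \<bullet> ?pH t x)"
    using main by (intro ip_elements[OF M _ negligible_empty]) auto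
  ultimately show ?thesis
    using main by simp
qed


text \<open>The initial value is also written in separated form, with constant temporal factors and
  the dummy time 0, so that results on \<open>separable\<close> apply to it.\<close>

lemma separable_time_regular:
  assumes "\<And>i. i < m \<Longrightarrow> time_regular a b (u i) (u' i) (u0 i)"
  shows "time_regular a b (\<lambda>t. separable m u Q t x $ c) (\<lambda>t. separable m u' Q t x $ c) (separable m (\<lambda>i _. u0 i) Q 0 x $ c)"
  unfolding separable_nth using assms by (intro time_regular_lincomb) auto

text \<open>A quadratic form in the temporal factors whose matrix is the Gram matrix of the spatial
  ones. The limit of the energy at the initial time thereby reduces to limits of finitely many
  functions of time.\<close>

lemma separable_norm_integral:
  assumes "\<And>i c. i < m \<Longrightarrow> bdd_meas N (\<lambda>x. Q i x $ c)" "finite_measure N"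
  shows "(LINT x|N. separable m a Q t x \<bullet> separable m a Q t x) = (\<Sum>i<m. \<Sum>j<m. a i t * a j t * (LINT x|N. Q i x \<bullet> Q j x))"
proof -
  have int: "integrable N (\<lambda>x. Q i x \<bullet> Q j x)" if "i < m" "j < m" for i j
    unfolding inner_3 using that by (intro bdd_meas_integrable assms bdd_meas_sum bdd_meas_mult)
  have "(LINT x|N. separable m a Q t x \<bullet> separable m a Q t x) = (LINT x|N. (\<Sum>i<m. \<Sum>j<m. a i t * a j t * (Q i x \<bullet> Q j x)))"
    by (rule Bochner_Integration.integral_cong[OF refl])
      (simp add: separable_def inner_sum_left inner_sum_right sum_distrib_left mult_ac inner_commute)
  also have "\<dots> = (\<Sum>i<m. LINT x|N. (\<Sum>j<m. a i t * a j t * (Q i x \<bullet> Q j x)))"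
    using int by (intro Bochner_Integration.integral_sum Bochner_Integration.integrable_sum integrable_mult_right) auto
  also have "\<dots> = (\<Sum>i<m. \<Sum>j<m. LINT x|N. a i t * a j t * (Q i x \<bullet> Q j x))"
    using int by (intro sum.cong refl Bochner_Integration.integral_sum integrable_mult_right) auto
  finally show ?thesis by simp
qed

lemma separable_bdd_meas_space:
  assumes "\<And>i. i < m \<Longrightarrow> bdd_meas N (\<lambda>x. Q i x $ c)"
  shows "bdd_meas N (\<lambda>x. separable m a Q t x $ c)"
  unfolding separable_nth using assms by (intro bdd_meas_intros) auto

lemma bdd_meas_norm_sq:
  assumes "\<And>c. bdd_meas N (\<lambda>x. f x $ c)" shows "bdd_meas N (\<lambda>x. (f x :: real^3) \<bullet> f x)"
  unfolding inner_3 using assms by (intro bdd_meas_sum bdd_meas_mult)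

text \<open>\<open>I0\<close> is the squared norm of the limit at the initial time.\<close>

lemma element_energy:
  assumes E: "E \<in> V_h M" and K: "K < n_elem M"
  shows "\<exists>I0 D N. ((\<lambda>t. LINT x|lebesgue_on (interior (elem M K)). E t x \<bullet> E t x) \<longlongrightarrow> I0) (at_right (t_start M)) \<and>
    finite N \<and> (\<forall>t\<in>slab M - N. \<forall>x\<in>interior (elem M K). time_deriv E t x = D t x) \<and>
    bdd_meas (lebesgue_on (slab M) \<Otimes>\<^sub>M lebesgue_on (interior (elem M K))) (\<lambda>(t, x). D t x \<bullet> proj_W M E t x) \<and>
    (LINT t|lebesgue_on (slab M). LINT x|lebesgue_on (interior (elem M K)). D t x \<bullet> proj_W M E t x) =
      1/2 * ((LINT x|lebesgue_on (interior (elem M K)). E (t_end M) x \<bullet> E (t_end M) x) - I0)"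
proof -
  let ?N = "lebesgue_on (slab M)" and ?B = "lebesgue_on (interior (elem M K))" and ?pE = "proj_W M E"
  let ?a = "t_start M" and ?b = "t_end M"
  note bmT = T_time_bdd_meas[OF M K] and bmS = S_time_bdd_meas[OF M K] and ab = slab_pos[OF M K]
  note fin = slab_finite interior_elem_finite[OF M K]
  obtain m a b q where r: "elem_rep M K (S_time M K) E m a q" "elem_rep M K (T_time M K) ?pE m b q"
    "\<And>i. i < m \<Longrightarrow> is_proj ?N (T_time M K) (a i) (b i)"
    using proj_W_rep(2)[OF M E K] by blast
  let ?Q = "\<lambda>i. cov_field (el_map M K) (q i)"
  have Ea: "E t x = separable m a ?Q t x" if "t \<in> slab M" "x \<in> interior (elem M K)" for t x
    using r(1) that by (simp add: elem_rep_def)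
  have pEb: "?pE t x = separable m b ?Q t x" if "t \<in> slab M" "x \<in> interior (elem M K)" for t x
    using r(2) that by (simp add: elem_rep_def)
  have aS: "a i \<in> S_time M K" and bT: "b i \<in> T_time M K" if "i < m" for i
    using r that by (auto simp: elem_rep_def)
  have Qbm: "bdd_meas ?B (\<lambda>x. ?Q i x $ c)" if "i < m" for i c
    using cov_field_bdd_meas[OF M K] r(1) that by (auto simp: elem_rep_def)
  have "\<forall>i. \<exists>a' u0. i < m \<longrightarrow> a' \<in> T_time M K \<and> time_regular ?a ?b (a i) a' u0"
    using S_time_regular[OF M K aS] by blast
  then obtain a' u0 where a': "\<And>i. i < m \<Longrightarrow> a' i \<in> T_time M K" "\<And>i. i < m \<Longrightarrow> time_regular ?a ?b (a i) (a' i) (u0 i)"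
    by metis
  have "\<forall>i. \<exists>N. i < m \<longrightarrow> finite N \<and> (\<forall>t\<in>{?a<..<?b} - N. (a i has_real_derivative a' i t) (at t))"
    using a'(2) unfolding time_regular_def by metis
  then obtain N where N: "\<And>i. i < m \<Longrightarrow> finite (N i)"
     "\<And>i t. i < m \<Longrightarrow> t \<in> {?a<..<?b} - N i \<Longrightarrow> (a i has_real_derivative a' i t) (at t)"
    by metis
  \<comment> \<open>The final time is excluded as well, because the two-sided derivative there
    depends on values beyond the slab.\<close>
  define NN where "NN = insert ?b (\<Union>i<m. N i)"
  define D where "D = separable m a' ?Q"
  define E0 where "E0 = separable m (\<lambda>i _. u0 i) ?Q 0"
  define I0 where "I0 = (LINT x|?B. E0 x \<bullet> E0 x)"
  have "((\<lambda>t. \<Sum>i<m. \<Sum>j<m. a i t * a j t * (LINT x|?B. ?Q i x \<bullet> ?Q j x)) \<longlongrightarrow> 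
      (\<Sum>i<m. \<Sum>j<m. u0 i * u0 j * (LINT x|?B. ?Q i x \<bullet> ?Q j x))) (at_right ?a)"
    using time_regular_tendsto[OF a'(2) ab] by (intro tendsto_intros) auto
  moreover have "(\<Sum>i<m. \<Sum>j<m. u0 i * u0 j * (LINT x|?B. ?Q i x \<bullet> ?Q j x)) = I0"
    unfolding I0_def E0_def by (subst separable_norm_integral[OF Qbm fin(2)]) auto
  moreover have "\<forall>\<^sub>F t in at_right ?a. (\<Sum>i<m. \<Sum>j<m. a i t * a j t * (LINT x|?B. ?Q i x \<bullet> ?Q j x)) =
      (LINT x|?B. E t x \<bullet> E t x)"
    unfolding eventually_at_right[OF ab]
  proof (intro exI conjI ballI allI impI)
    fix t assume "?a < t" "t < ?b"
    then have t: "t \<in> slab M" by (simp add: slab_def)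
    have "(LINT x|?B. E t x \<bullet> E t x) = (LINT x|?B. separable m a ?Q t x \<bullet> separable m a ?Q t x)"
      using Ea[OF t] by (intro Bochner_Integration.integral_cong) auto
    then show "(\<Sum>i<m. \<Sum>j<m. a i t * a j t * (LINT x|?B. ?Q i x \<bullet> ?Q j x)) = (LINT x|?B. E t x \<bullet> E t x)"
      by (simp add: separable_norm_integral[OF Qbm fin(2)])
  qed (use ab in auto)
  ultimately have lim: "((\<lambda>t. LINT x|?B. E t x \<bullet> E t x) \<longlongrightarrow> I0) (at_right ?a)"
    using Lim_transform_eventually by fastforce
  have deriv: "time_deriv E t x = D t x" if t: "t \<in> slab M - NN" and x: "x \<in> interior (elem M K)" for t x
  proof -
    have t': "t \<in> {?a<..<?b}" using t by (auto simp: slab_def NN_def)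
    have "((\<lambda>s. separable m a ?Q s x) has_vector_derivative D t x) (at t)"
      unfolding separable_def D_def using t t' N(2)
      by (intro has_vector_derivative_sum)
        (auto simp: NN_def has_real_derivative_iff_has_vector_derivative[symmetric]
          intro!: has_vector_derivative_scaleR[where g' = 0, simplified])
    then have "((\<lambda>s. E s x) has_vector_derivative D t x) (at t)"
      by (rule has_vector_derivative_transform_within_open[of _ _ _ "{?a<..<?b}"])
        (use t' Ea[OF _ x] in \<open>auto simp: slab_def\<close>)
    then show ?thesis
      by (simp add: time_deriv_def vector_derivative_at)
  qed
  have bmD: "bdd_meas (?N \<Otimes>\<^sub>M ?B) (\<lambda>(t, x). D t x $ c)" for c
    unfolding D_def using a'(1) bmT Qbm by (intro separable_bdd_meas) auto
  have bmE: "bdd_meas (?N \<Otimes>\<^sub>M ?B) (\<lambda>(t, x). separable m a ?Q t x $ c)" for c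
    using aS bmS Qbm by (intro separable_bdd_meas) auto
  have bmpE: "bdd_meas (?N \<Otimes>\<^sub>M ?B) (\<lambda>(t, x). ?pE t x $ c)" for c
    by (rule elem_rep_bdd_meas[OF M K r(2) bmT])
  have bmDp: "bdd_meas (?N \<Otimes>\<^sub>M ?B) (\<lambda>(t, x). D t x \<bullet> ?pE t x)"
    by (intro bdd_meas_inner bmD bmpE)
  have "(LINT t|?N. D t x \<bullet> ?pE t x) =
      1/2 * (separable m a ?Q ?b x \<bullet> separable m a ?Q ?b x - E0 x \<bullet> E0 x)" if x: "x \<in> interior (elem M K)" for x
  proof -
    let ?e = "\<lambda>c t. separable m a ?Q t x $ c" and ?d = "\<lambda>c t. D t x $ c" and ?p = "\<lambda>c t. separable m b ?Q t x $ c"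
    have be: "bdd_meas ?N (?e c)" and bd: "bdd_meas ?N (?d c)" and bp: "bdd_meas ?N (?p c)" for c
      unfolding D_def separable_nth using aS a' bT bmS bmT by (intro bdd_meas_intros; simp)+
    have "?d c \<in> T_time M K" for c
      unfolding D_def separable_nth using a'(1) T_time_subspace[OF M K]
      by (intro fun_subspace_sum) (auto simp: fun_subspace_def)
    moreover have "is_proj ?N (T_time M K) (?e c) (?p c)" for c
      using aS bmS r(3) by (intro separable_is_proj[OF slab_finite T_time_subspace[OF M K] bmT]) auto
    ultimately have orth: "(LINT t|?N. (?e c t - ?p c t) * ?d c t) = 0" for c
      by (auto simp: is_proj_def)
    have int: "integrable ?N (\<lambda>t. f t * g t)" if "bdd_meas ?N f" "bdd_meas ?N g" for f g
      using that by (intro bdd_meas_integrable slab_finite bdd_meas_mult)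
    have "(LINT t|?N. ?d c t * ?p c t) = 1/2 * (?e c ?b * ?e c ?b - E0 x $ c * E0 x $ c)" for c
    proof -
      \<comment> \<open>The product rule for a component with itself; the integrand is twice the one
        wanted, hence the factor 1/2.\<close>
      have "(LINT t|?N. ?d c t * ?e c t + ?e c t * ?d c t) = ?e c ?b * ?e c ?b - E0 x $ c * E0 x $ c"
        unfolding slab_def E0_def D_def
        using be[of c] bd[of c] a'(2)
        by (intro time_regular_integral separable_time_regular ab) (auto simp: slab_def D_def)
      then have "(LINT t|?N. ?e c t * ?d c t) = 1/2 * (?e c ?b * ?e c ?b - E0 x $ c * E0 x $ c)"
        by (simp add: mult.commute)
      moreover have "(LINT t|?N. ?e c t * ?d c t) - (LINT t|?N. ?p c t * ?d c t) = 0"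
        using orth[of c] int[OF be[of c] bd[of c]] int[OF bp[of c] bd[of c]] by (simp add: left_diff_distrib)
      ultimately show ?thesis by (simp add: mult.commute)
    qed
    moreover have "(LINT t|?N. D t x \<bullet> ?pE t x) = (LINT t|?N. (\<Sum>c\<in>UNIV. ?d c t * ?p c t))"
      using pEb[OF _ x] by (intro Bochner_Integration.integral_cong) (auto simp: inner_3)
    moreover have "\<dots> = (\<Sum>c\<in>UNIV. LINT t|?N. ?d c t * ?p c t)"
      by (intro Bochner_Integration.integral_sum int bd bp)
    ultimately show ?thesis
      by (simp add: inner_3 sum_subtractf sum_divide_distrib diff_divide_distrib)
  qed
  then have "(LINT x|?B. LINT t|?N. D t x \<bullet> ?pE t x) =
      (LINT x|?B. 1/2 * (separable m a ?Q ?b x \<bullet> separable m a ?Q ?b x - E0 x \<bullet> E0 x))"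
    by (intro Bochner_Integration.integral_cong) auto
  also have "\<dots> = 1/2 * ((LINT x|?B. separable m a ?Q ?b x \<bullet> separable m a ?Q ?b x) - I0)"
  proof -
    have "integrable ?B (\<lambda>x. separable m a ?Q ?b x \<bullet> separable m a ?Q ?b x)" "integrable ?B (\<lambda>x. E0 x \<bullet> E0 x)"
      unfolding E0_def using Qbm by (intro bdd_meas_integrable[OF fin(2)] bdd_meas_norm_sq separable_bdd_meas_space; simp)+
    then show ?thesis by (simp add: I0_def)
  qed
  also have "(LINT x|?B. separable m a ?Q ?b x \<bullet> separable m a ?Q ?b x) = (LINT x|?B. E ?b x \<bullet> E ?b x)"
    using Ea[of ?b] ab by (intro Bochner_Integration.integral_cong) (auto simp: slab_def)
  finally have "(LINT t|?N. LINT x|?B. D t x \<bullet> ?pE t x) = 1/2 * ((LINT x|?B. E ?b x \<bullet> E ?b x) - I0)"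
    using bdd_meas_finite_pair(2)[OF fin bmDp] by simp
  moreover have "finite NN" using N(1) by (simp add: NN_def)
  ultimately show ?thesis
    using lim deriv bmDp by blast
qed


lemma ip_weighted_time_deriv:
  assumes E: "E \<in> V_h M" and c: "\<And>K x. K < n_elem M \<Longrightarrow> x \<in> interior (elem M K) \<Longrightarrow> \<epsilon> x = c K"
  shows "\<exists>I0. (\<forall>K<n_elem M. ((\<lambda>t. LINT x|lebesgue_on (interior (elem M K)). E t x \<bullet> E t x) \<longlongrightarrow> I0 K) (at_right (t_start M))) \<and>
    ip M (\<lambda>t x. \<epsilon> x *\<^sub>R time_deriv E t x) (proj_W M E) =
      (\<Sum>K<n_elem M. c K * (1/2 * ((LINT x|lebesgue_on (interior (elem M K)). E (t_end M) x \<bullet> E (t_end M) x) - I0 K)))"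
proof -
  let ?N = "lebesgue_on (slab M)" and ?B = "\<lambda>K. lebesgue_on (interior (elem M K))"
  define P where "P K I0 D N \<longleftrightarrow> ((\<lambda>t. LINT x|?B K. E t x \<bullet> E t x) \<longlongrightarrow> I0) (at_right (t_start M)) \<and>
    finite (N) \<and> (\<forall>t\<in>slab M - N. \<forall>x\<in>interior (elem M K). time_deriv E t x = D t x) \<and>
    bdd_meas (?N \<Otimes>\<^sub>M ?B K) (\<lambda>(t, x). D t x \<bullet> proj_W M E t x) \<and>
    (LINT t|?N. LINT x|?B K. D t x \<bullet> proj_W M E t x) =
      1/2 * ((LINT x|?B K. E (t_end M) x \<bullet> E (t_end M) x) - I0)" for K I0 D N
  have "\<exists>I0 D N. P K I0 D N" if "K < n_elem M" for K
    unfolding P_def by (rule element_energy[OF E that])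
  then obtain I0 D N where "\<And>K. K < n_elem M \<Longrightarrow> P K (I0 K) (D K) (N K)"
    by metis
  then have IDN: "K < n_elem M \<Longrightarrow> ((\<lambda>t. LINT x|?B K. E t x \<bullet> E t x) \<longlongrightarrow> I0 K) (at_right (t_start M)) \<and>
    finite (N K) \<and> (\<forall>t\<in>slab M - N K. \<forall>x\<in>interior (elem M K). time_deriv E t x = D K t x) \<and>
    bdd_meas (?N \<Otimes>\<^sub>M ?B K) (\<lambda>(t, x). D K t x \<bullet> proj_W M E t x) \<and>
    (LINT t|?N. LINT x|?B K. D K t x \<bullet> proj_W M E t x) =
      1/2 * ((LINT x|?B K. E (t_end M) x \<bullet> E (t_end M) x) - I0 K)" for K
    unfolding P_def .
  have "ip M (\<lambda>t x. \<epsilon> x *\<^sub>R time_deriv E t x) (proj_W M E) =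
      (\<Sum>K<n_elem M. LINT t|?N. LINT x|?B K. c K * (D K t x \<bullet> proj_W M E t x))"
  proof (rule ip_elements[OF M])
    show "bdd_meas (?N \<Otimes>\<^sub>M ?B K) (\<lambda>(t, x). c K * (D K t x \<bullet> proj_W M E t x))" if "K < n_elem M" for K
      using IDN[OF that] bdd_meas_mult[OF bdd_meas_const[of "?N \<Otimes>\<^sub>M ?B K" "c K"], of "\<lambda>(t, x). D K t x \<bullet> proj_W M E t x"]
      by (simp add: case_prod_beta')
    show "negligible (\<Union>K<n_elem M. N K)"
      using IDN by (intro negligible_finite) auto
  qed (use IDN c in auto)
  also have "\<dots> = (\<Sum>K<n_elem M. c K * (1/2 * ((LINT x|?B K. E (t_end M) x \<bullet> E (t_end M) x) - I0 K)))"
    using IDN by (intro sum.cong refl) (simp add: double_integral_cmult)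
  finally show ?thesis using IDN by blast
qed

lemma energy_in_elements:
  assumes E: "E \<in> V_h M" and H: "H \<in> V_h M" and t: "t \<in> slab M"
    and \<epsilon>: "\<And>K x. K < n_elem M \<Longrightarrow> x \<in> interior (elem M K) \<Longrightarrow> \<epsilon> x = c K"
    and \<mu>: "\<And>K x. K < n_elem M \<Longrightarrow> x \<in> interior (elem M K) \<Longrightarrow> \<mu> x = d K"
  shows "energy_in M \<epsilon> \<mu> E H t = 1/2 * (\<Sum>K<n_elem M. c K * (LINT x|lebesgue_on (interior (elem M K)). E t x \<bullet> E t x) +
      d K * (LINT x|lebesgue_on (interior (elem M K)). H t x \<bullet> H t x))"
proof -
  let ?B = "\<lambda>K. lebesgue_on (interior (elem M K))"
  have int: "integrable (?B K) (\<lambda>x. u t x \<bullet> u t x)" if K: "K < n_elem M" and u: "u \<in> V_h M" for K u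
    using bdd_meas_slice[OF V_h_bdd_meas[OF M u K]] t
    by (intro bdd_meas_integrable[OF interior_elem_finite[OF M K]] bdd_meas_norm_sq) auto
  let ?f = "\<lambda>x. \<epsilon> x * (E t x \<bullet> E t x) + \<mu> x * (H t x \<bullet> H t x)"
  have eq: "?f x = c K * (E t x \<bullet> E t x) + d K * (H t x \<bullet> H t x)" if "K < n_elem M" "x \<in> interior (elem M K)" for K x
    using \<epsilon> \<mu> that by simp
  have "(LINT x|lebesgue_on (Omega M). ?f x) = (\<Sum>K<n_elem M. LINT x|?B K. ?f x)"
  proof (rule integral_Omega[OF M])
    fix K assume K: "K < n_elem M"
    have "integrable (?B K) (\<lambda>x. c K * (E t x \<bullet> E t x) + d K * (H t x \<bullet> H t x))"
      using int[OF K E] int[OF K H] by simp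
    then show "integrable (?B K) ?f"
      by (rule Bochner_Integration.integrable_cong[THEN iffD1, OF refl, rotated]) (simp add: eq[OF K])
  qed
  also have "\<dots> = (\<Sum>K<n_elem M. LINT x|?B K. c K * (E t x \<bullet> E t x) + d K * (H t x \<bullet> H t x))"
    by (rule sum.cong[OF refl], rule Bochner_Integration.integral_cong[OF refl]) (simp add: eq)
  also have "\<dots> = (\<Sum>K<n_elem M. c K * (LINT x|?B K. E t x \<bullet> E t x) + d K * (LINT x|?B K. H t x \<bullet> H t x))"
    using int E H by (intro sum.cong refl) simp
  finally show ?thesis by (simp add: energy_in_def)
qed

lemma energy_difference:
  assumes E: "E \<in> V_h M" and H: "H \<in> V_h M"
    and "elementwise_constant M \<epsilon>" "elementwise_constant M \<mu>"
  shows "energy M \<epsilon> \<mu> E H (t_end M) - energy M \<epsilon> \<mu> E H (t_start M) =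
    ip M (\<lambda>t x. \<epsilon> x *\<^sub>R time_deriv E t x) (proj_W M E) + ip M (\<lambda>t x. \<mu> x *\<^sub>R time_deriv H t x) (proj_W M H)"
proof -
  let ?B = "\<lambda>K. lebesgue_on (interior (elem M K))" and ?a = "t_start M" and ?b = "t_end M"
  have ab: "?a < ?b" using M by (simp add: valid_mesh_def)
  obtain c d where c: "\<And>K x. K < n_elem M \<Longrightarrow> x \<in> interior (elem M K) \<Longrightarrow> \<epsilon> x = c K"
    and d: "\<And>K x. K < n_elem M \<Longrightarrow> x \<in> interior (elem M K) \<Longrightarrow> \<mu> x = d K"
    using assms(3,4) unfolding elementwise_constant_def by metis
  obtain I0 where I0: "\<And>K. K < n_elem M \<Longrightarrow> ((\<lambda>t. LINT x|?B K. E t x \<bullet> E t x) \<longlongrightarrow> I0 K) (at_right ?a)"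
    "ip M (\<lambda>t x. \<epsilon> x *\<^sub>R time_deriv E t x) (proj_W M E) =
      (\<Sum>K<n_elem M. c K * (1/2 * ((LINT x|?B K. E ?b x \<bullet> E ?b x) - I0 K)))"
    using ip_weighted_time_deriv[OF E, of \<epsilon> c, OF c] by blast
  obtain J0 where J0: "\<And>K. K < n_elem M \<Longrightarrow> ((\<lambda>t. LINT x|?B K. H t x \<bullet> H t x) \<longlongrightarrow> J0 K) (at_right ?a)"
    "ip M (\<lambda>t x. \<mu> x *\<^sub>R time_deriv H t x) (proj_W M H) =
      (\<Sum>K<n_elem M. d K * (1/2 * ((LINT x|?B K. H ?b x \<bullet> H ?b x) - J0 K)))"
    using ip_weighted_time_deriv[OF H, of \<mu> d, OF d] by blast
  let ?e = "\<lambda>t. 1/2 * (\<Sum>K<n_elem M. c K * (LINT x|?B K. E t x \<bullet> E t x) + d K * (LINT x|?B K. H t x \<bullet> H t x))"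
  have e: "energy_in M \<epsilon> \<mu> E H t = ?e t" if "t \<in> slab M" for t
    using energy_in_elements[OF E H that c d] .
  \<comment> \<open>At the initial time \<open>energy\<close> is defined through \<open>Lim\<close>,
    so its value has to be computed from the element-wise limits.\<close>
  have "(?e \<longlongrightarrow> 1/2 * (\<Sum>K<n_elem M. c K * I0 K + d K * J0 K)) (at_right ?a)"
    using I0(1) J0(1) by (intro tendsto_intros) auto
  moreover have "\<forall>\<^sub>F t in at_right ?a. ?e t = energy_in M \<epsilon> \<mu> E H t"
    unfolding eventually_at_right[OF ab] using e ab by (intro exI[of _ ?b]) (auto simp: slab_def)
  ultimately have "(energy_in M \<epsilon> \<mu> E H \<longlongrightarrow> 1/2 * (\<Sum>K<n_elem M. c K * I0 K + d K * J0 K)) (at_right ?a)"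
    by (rule Lim_transform_eventually)
  then have "energy M \<epsilon> \<mu> E H ?a = 1/2 * (\<Sum>K<n_elem M. c K * I0 K + d K * J0 K)"
    by (simp add: energy_def tendsto_Lim)
  moreover have "energy M \<epsilon> \<mu> E H ?b = ?e ?b"
    using ab e[of ?b] by (simp add: energy_def slab_def)
  ultimately show ?thesis
    unfolding I0(2) J0(2)
    by (simp add: sum_distrib_left sum_subtractf[symmetric] sum.distrib[symmetric] algebra_simps
        diff_divide_distrib add_divide_distrib sum_divide_distrib)
qed

end

section \<open>Face terms\<close>

text \<open>The side from which \<open>face_integral\<close> parametrizes the face; both kinds of
  faces can then be treated alike.\<close>

fun face_elem :: "face \<Rightarrow> nat" where
  "face_elem (Interior K1 K2) = K1"
| "face_elem (Boundary K) = K"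

lemma face_integral_eq: "face_integral M f \<phi> = surface_integral M (face_elem f) (face_set M f) \<phi>"
  by (cases f) auto

abbreviation face_dom :: "slab_mesh \<Rightarrow> face \<Rightarrow> 3 \<Rightarrow> real \<Rightarrow> (real^2) set" where
  "face_dom M f d s \<equiv> chart_dom M (face_elem f) (face_set M f) d s"

abbreviation face_chart :: "slab_mesh \<Rightarrow> face \<Rightarrow> 3 \<Rightarrow> real \<Rightarrow> real^2 \<Rightarrow> real^3" where
  "face_chart M f \<equiv> chart M (face_elem f)"

text \<open>The function \<open>g\<close> is a bounded measurable version of the integrand in chart
  coordinates. The null set does not depend on time; it absorbs the edges and the points at which
  the normals of two neighbours are not known to be opposite.\<close>

definition face_repr :: "slab_mesh \<Rightarrow> face \<Rightarrow> (face \<Rightarrow> field) \<Rightarrow> (face \<Rightarrow> field) \<Rightarrow>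
    (3 \<Rightarrow> real \<Rightarrow> real \<Rightarrow> real^2 \<Rightarrow> real) \<Rightarrow> bool" where
  "face_repr M f a b g \<longleftrightarrow> (\<forall>d. \<forall>s\<in>{0,1}.
     bdd_meas (lebesgue_on (slab M) \<Otimes>\<^sub>M lebesgue_on (face_dom M f d s)) (\<lambda>(t, \<eta>). g d s t \<eta>) \<and>
     (\<exists>N. negligible N \<and> (\<forall>t\<in>slab M. \<forall>\<eta>\<in>face_dom M f d s - N.
        (a f t (face_chart M f d s \<eta>) \<bullet> b f t (face_chart M f d s \<eta>)) * area_element (face_chart M f d s) \<eta> = g d s t \<eta>)))"

lemma bdd_meas_cross:
  assumes "\<And>c. bdd_meas (N1 \<Otimes>\<^sub>M N2) (\<lambda>(t, y). u t y $ c)" "\<And>c. bdd_meas (N1 \<Otimes>\<^sub>M N2) (\<lambda>(t, y). v t y $ c)"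
    and "\<And>c. bdd_meas N2 (\<lambda>y. \<nu> y $ c)" "bdd_meas N2 r"
  shows "bdd_meas (N1 \<Otimes>\<^sub>M N2) (\<lambda>(t, y). (u t y \<bullet> cross3 (\<nu> y) (v t y)) * r y)"
proof -
  let ?u = "\<lambda>c z. (\<lambda>(t, y). u t y $ c) z" and ?v = "\<lambda>c z. (\<lambda>(t, y). v t y $ c) z"
    and ?n = "\<lambda>c z. (\<lambda>(t, y). \<nu> y $ c) z"
  have "bdd_meas (N1 \<Otimes>\<^sub>M N2) (\<lambda>z. (?u 1 z * (?n 2 z * ?v 3 z - ?n 3 z * ?v 2 z) + ?u 2 z * (?n 3 z * ?v 1 z - ?n 1 z * ?v 3 z)
      + ?u 3 z * (?n 1 z * ?v 2 z - ?n 2 z * ?v 1 z)) * (\<lambda>(t, y). r y) z)"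
    by (intro bdd_meas_mult bdd_meas_add bdd_meas_diff assms(1,2) bdd_meas_snd[OF assms(3)] bdd_meas_snd[OF assms(4)])
  then show ?thesis
    by (simp add: case_prod_beta' inner_3 sum_3 cross3_def)
qed

context
  fixes M
  assumes M: "valid_mesh M"
begin

lemma chart_dom_compact:
  assumes K: "K < n_elem M" and s: "s \<in> {0,1}" and "closed f"
  shows "compact (chart_dom M K f d s)" "continuous_on (chart_dom M K f d s) (chart M K d s)"
    "chart_dom M K f d s \<subseteq> cbox 0 1" "chart_dom M K f d s \<in> lmeasurable"
proof -
  have cont: "continuous_on (cbox 0 1) (chart M K d s)"
    unfolding chart_def o_def
    by (rule continuous_on_compose2[OF F_cont[OF mesh_smooth[OF M K]] ref_chart_continuous])
      (use ref_chart_cube[OF s] in auto)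
  have eq: "chart_dom M K f d s = cbox 0 1 \<inter> chart M K d s -` f"
    by (auto simp: chart_dom_def)
  show "chart_dom M K f d s \<subseteq> cbox 0 1" by (simp add: eq)
  then show "continuous_on (chart_dom M K f d s) (chart M K d s)"
    using cont continuous_on_subset by blast
  have "closed (chart_dom M K f d s)"
    unfolding eq by (rule continuous_closed_preimage[OF cont closed_cbox assms(3)])
  then show "compact (chart_dom M K f d s)"
    using bounded_subset[OF bounded_cbox \<open>chart_dom M K f d s \<subseteq> cbox 0 1\<close>] by (simp add: compact_eq_bounded_closed)
  then show "chart_dom M K f d s \<in> lmeasurable"
    by (rule lmeasurable_compact)
qed

lemma closed_face_set: "closed (face_set M f)"
  by (cases f) auto

lemmas face_dom = chart_dom_compact[OF _ _ closed_face_set]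

lemma face_ip_repr:
  assumes G: "finite G" "\<And>f. f \<in> G \<Longrightarrow> face_elem f < n_elem M" and repr: "\<And>f. f \<in> G \<Longrightarrow> face_repr M f a b (g f)"
  shows "face_ip M G a b = (\<Sum>f\<in>G. \<Sum>d\<in>UNIV. \<Sum>s\<in>{0,1}.
    LINT t|lebesgue_on (slab M). LINT \<eta>|lebesgue_on (face_dom M f d s). g f d s t \<eta>)"
proof -
  let ?N = "lebesgue_on (slab M)"
  have fin: "finite_measure (lebesgue_on (face_dom M f d s))" if "f \<in> G" "s \<in> {0,1}" for f d s
    using face_dom(4)[OF G(2)] that by (intro finite_measure_lebesgue_on) auto
  have "face_integral M f (\<lambda>x. a f t x \<bullet> b f t x) =
      (\<Sum>d\<in>UNIV. \<Sum>s\<in>{0,1}. LINT \<eta>|lebesgue_on (face_dom M f d s). g f d s t \<eta>)" if "f \<in> G" "t \<in> slab M" for f t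
    unfolding face_integral_eq surface_integral_def
  proof (intro sum.cong[OF refl])
    fix d s assume s: "s \<in> {0,1::real}"
    obtain N where "negligible N" "\<forall>t\<in>slab M. \<forall>\<eta>\<in>face_dom M f d s - N.
        (a f t (face_chart M f d s \<eta>) \<bullet> b f t (face_chart M f d s \<eta>)) * area_element (face_chart M f d s) \<eta> = g f d s t \<eta>"
      using repr[OF \<open>f \<in> G\<close>] s unfolding face_repr_def by blast
    then show "(LINT \<eta>|lebesgue_on (face_dom M f d s).
        (a f t (face_chart M f d s \<eta>) \<bullet> b f t (face_chart M f d s \<eta>)) * area_element (face_chart M f d s) \<eta>) =
      (LINT \<eta>|lebesgue_on (face_dom M f d s). g f d s t \<eta>)"
      using face_dom(4)[OF G(2)[OF \<open>f \<in> G\<close>] s] \<open>t \<in> slab M\<close> by (intro integral_lebesgue_on_spike(1)) auto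
  qed
  then have "face_ip M G a b = (LINT t|?N. (\<Sum>f\<in>G. \<Sum>d\<in>UNIV. \<Sum>s\<in>{0,1}. LINT \<eta>|lebesgue_on (face_dom M f d s). g f d s t \<eta>))"
    unfolding face_ip_def by (intro Bochner_Integration.integral_cong[OF refl] sum.cong[OF refl]) simp
  also have "\<dots> = (\<Sum>f\<in>G. \<Sum>d\<in>UNIV. \<Sum>s\<in>{0,1}. LINT t|?N. LINT \<eta>|lebesgue_on (face_dom M f d s). g f d s t \<eta>)"
  proof -
    have int: "integrable ?N (\<lambda>t. LINT \<eta>|lebesgue_on (face_dom M f d s). g f d s t \<eta>)" if "f \<in> G" "s \<in> {0,1}" for f d s
      using repr[OF that(1)] that(2) unfolding face_repr_def
      by (intro bdd_meas_finite_pair(1)[OF slab_finite fin[OF that]]) blast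
    then show ?thesis
      by (subst Bochner_Integration.integral_sum Bochner_Integration.integrable_sum; (intro Bochner_Integration.integrable_sum int)?; simp?)+
  qed
  finally show ?thesis .
qed

text \<open>The sum over faces stands inside the time integral. Pulling it out requires each
  contribution to be integrable in time, which the representation ensures.\<close>

lemma face_ip_sum:
  assumes "finite G" "\<And>f. f \<in> G \<Longrightarrow> face_elem f < n_elem M" "\<And>f. f \<in> G \<Longrightarrow> \<exists>g. face_repr M f a b g"
  shows "face_ip M G a b = (\<Sum>f\<in>G. face_ip M {f} a b)"
proof -
  obtain g where g: "\<And>f. f \<in> G \<Longrightarrow> face_repr M f a b (g f)"
    using assms(3) by metis
  have "face_ip M {f} a b = (\<Sum>d\<in>UNIV. \<Sum>s\<in>{0,1}.
    LINT t|lebesgue_on (slab M). LINT \<eta>|lebesgue_on (face_dom M f d s). g f d s t \<eta>)" if "f \<in> G" for f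
    using face_ip_repr[of "{f}" a b g] that g assms(2) by simp
  then show ?thesis
    using face_ip_repr[OF assms(1,2) g] by simp
qed

text \<open>\<open>U\<close>, \<open>PU\<close> and \<open>QU\<close> are the traces of \<open>u\<close> and of \<open>\<pi>u\<close>, and the temporal projection of the latter on the face.\<close>

lemma trace_data:
  assumes u: "u \<in> V_h M" and A: "K \<in> A" "A \<subseteq> {..<n_elem M}"
  shows "\<exists>U PU QU :: field.
    (\<forall>t\<in>slab M. \<forall>x\<in>elem M K. tr M u K t x = U t x \<and> tr M (proj_W M u) K t x = PU t x \<and>
       (\<forall>f. sides f = A \<longrightarrow> face_proj M f (tr M (proj_W M u)) K t x = QU t x)) \<and>
    (\<forall>S (\<Phi> :: real^2 \<Rightarrow> real^3) c. compact S \<longrightarrow> continuous_on S \<Phi> \<longrightarrow> \<Phi> ` S \<subseteq> elem M K \<longrightarrow>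
       bdd_meas (lebesgue_on (slab M) \<Otimes>\<^sub>M lebesgue_on S) (\<lambda>(t, y). U t (\<Phi> y) $ c) \<and>
       bdd_meas (lebesgue_on (slab M) \<Otimes>\<^sub>M lebesgue_on S) (\<lambda>(t, y). PU t (\<Phi> y) $ c) \<and>
       bdd_meas (lebesgue_on (slab M) \<Otimes>\<^sub>M lebesgue_on S) (\<lambda>(t, y). QU t (\<Phi> y) $ c)) \<and>
    (\<forall>x c. bdd_meas (lebesgue_on (slab M)) (\<lambda>t. U t x $ c) \<and>
       is_proj (lebesgue_on (slab M)) (T_time M K) (\<lambda>t. U t x $ c) (\<lambda>t. PU t x $ c) \<and>
       is_proj (lebesgue_on (slab M)) (\<Inter>K'\<in>A. T_time M K') (\<lambda>t. U t x $ c) (\<lambda>t. QU t x $ c))"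
proof -
  let ?N = "lebesgue_on (slab M)" and ?W = "\<Inter>K'\<in>A. T_time M K'"
  have K: "K < n_elem M" using A by auto
  note bmT = T_time_bdd_meas[OF M K] and bmS = S_time_bdd_meas[OF M K]
  have W: "?W \<subseteq> T_time M K" "fun_subspace ?W"
    using A by (auto intro!: fun_subspace_INT T_time_subspace[OF M])
  have bmW: "bdd_meas ?N w" if "w \<in> ?W" for w
    using that W bmT by blast
  obtain m a b q where r: "elem_rep M K (S_time M K) u m a q" "elem_rep M K (T_time M K) (proj_W M u) m b q"
    "\<And>i. i < m \<Longrightarrow> is_proj ?N (T_time M K) (a i) (b i)"
    using proj_W_rep(2)[OF M u K] by blast
  let ?Q = "\<lambda>i. cov_field (el_map M K) (q i)"
  have aS: "bdd_meas ?N (a i)" and bT: "bdd_meas ?N (b i)" and Qc: "continuous_on (elem M K) (?Q i)" if "i < m" for i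
    using r that bmS bmT cov_field_elem_continuous[OF M K] by (auto simp: elem_rep_def)
  have "\<exists>c. is_proj ?N ?W (b i) c" if "i < m" for i
    using is_proj_T_exists[OF M K W bT[OF that]] .
  then obtain c where c: "\<And>i. i < m \<Longrightarrow> is_proj ?N ?W (b i) (c i)"
    by metis
  have cW: "bdd_meas ?N (c i)" if "i < m" for i
    using c[OF that] bmW by (simp add: is_proj_def)
  \<comment> \<open>Projecting onto the face from the projected factors \<open>b\<close> amounts to
    projecting the original factors \<open>a\<close> directly: this is the identity P pi =
    P.\<close>
  have ac: "is_proj ?N ?W (a i) (c i)" if "i < m" for i
    by (rule is_proj_trans[OF slab_finite r(3)[OF that] c[OF that] W(1) aS[OF that] bmT])
  show ?thesis
  proof (rule exI[of _ "separable m a ?Q"], rule exI[of _ "separable m b ?Q"], rule exI[of _ "separable m c ?Q"],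
      intro conjI ballI allI impI)
    fix t x assume t: "t \<in> slab M" and x: "x \<in> elem M K"
    show "tr M u K t x = separable m a ?Q t x" "tr M (proj_W M u) K t x = separable m b ?Q t x"
      using elem_rep_tr[OF M K r(1) t x] elem_rep_tr[OF M K r(2) t x] by auto
    fix f assume f: "sides f = A"
    show "face_proj M f (tr M (proj_W M u)) K t x = separable m c ?Q t x"
    proof (rule vec_eq_iff[THEN iffD2], rule allI)
      fix e
      let ?v = "\<lambda>s. tr M (proj_W M u) K s x $ e"
      have v: "?v s = separable m b ?Q s x $ e" if "s \<in> slab M" for s
        using elem_rep_tr[OF M K r(2) that x] by simp
      have "bdd_meas ?N (\<lambda>s. separable m b ?Q s x $ e)"
        unfolding separable_nth using bT by (intro bdd_meas_intros) auto
      then have bmv: "bdd_meas ?N ?v"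
        using v by (subst bdd_meas_cong[where g = "\<lambda>s. separable m b ?Q s x $ e"]) auto
      have "is_proj ?N ?W (\<lambda>s. separable m b ?Q s x $ e) (\<lambda>s. separable m c ?Q s x $ e)"
        using c bT by (intro separable_is_proj[OF slab_finite W(2) bmW]) auto
      then have "is_proj ?N ?W ?v (\<lambda>s. separable m c ?Q s x $ e)"
        using v by (subst is_proj_slab_cong[OF M A(2), of ?v "\<lambda>s. separable m b ?Q s x $ e" _ "\<lambda>s. separable m c ?Q s x $ e"]) auto
      \<comment> \<open>\<open>face_proj\<close> picks some projection of the trace; pointwise
        uniqueness identifies it with the explicit one on the slab.\<close>
      then show "face_proj M f (tr M (proj_W M u)) K t x $ e = separable m c ?Q t x $ e"
        using is_proj_T_unique[OF M K W bmv orth_proj_time[OF M K W bmv] _ t]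
        by (simp add: face_proj_def f)
    qed
  next
    fix S :: "(real^2) set" and \<Phi> e assume S: "compact S" "continuous_on S \<Phi>" "\<Phi> ` S \<subseteq> elem M K"
    have "continuous_on S (\<lambda>y. ?Q i (\<Phi> y) $ e)" if "i < m" for i
      using continuous_on_compose2[OF Qc[OF that] S(2,3)] by (intro continuous_on_component)
    then have QS: "bdd_meas (lebesgue_on S) (\<lambda>y. ?Q i (\<Phi> y) $ e)" if "i < m" for i
      using that S(1) lmeasurable_compact by (intro bdd_meas_continuous_compact[OF S(1)]) auto
    show "bdd_meas (?N \<Otimes>\<^sub>M lebesgue_on S) (\<lambda>(t, y). separable m a ?Q t (\<Phi> y) $ e)"
      "bdd_meas (?N \<Otimes>\<^sub>M lebesgue_on S) (\<lambda>(t, y). separable m b ?Q t (\<Phi> y) $ e)"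
      "bdd_meas (?N \<Otimes>\<^sub>M lebesgue_on S) (\<lambda>(t, y). separable m c ?Q t (\<Phi> y) $ e)"
      using QS aS bT cW by (intro separable_bdd_meas; simp)+
  next
    fix x e
    show "bdd_meas ?N (\<lambda>t. separable m a ?Q t x $ e)"
      unfolding separable_nth using aS by (intro bdd_meas_intros) auto
    show "is_proj ?N (T_time M K) (\<lambda>t. separable m a ?Q t x $ e) (\<lambda>t. separable m b ?Q t x $ e)"
      using r(3) aS by (intro separable_is_proj[OF slab_finite T_time_subspace[OF M K] bmT]) auto
    show "is_proj ?N ?W (\<lambda>t. separable m a ?Q t x $ e) (\<lambda>t. separable m c ?Q t x $ e)"
      using ac aS by (intro separable_is_proj[OF slab_finite W(2) bmW]) auto
  qed
qed

lemma boundary_normal: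
  assumes K: "K < n_elem M" and s: "s \<in> {0,1}"
  shows "\<exists>\<nu>. continuous_on (cbox 0 1) \<nu> \<and> (\<forall>\<eta>\<in>box 0 1. normal M K (chart M K d s \<eta>) = \<nu> \<eta>)"
proof -
  obtain \<nu> where \<nu>: "continuous_on (cbox 0 1) \<nu>" "\<And>\<eta>. \<eta> \<in> box 0 1 \<Longrightarrow> outer_normal (el_map M K) (ref_chart d s \<eta>) = \<nu> \<eta>"
    using outer_normal_chart[OF mesh_smooth[OF M K] s] by blast
  have "normal M K (chart M K d s \<eta>) = \<nu> \<eta>" if "\<eta> \<in> box 0 1" for \<eta>
    using normal_outer_normal[OF mesh_smooth[OF M K] ref_chart_cube[OF s]] that \<nu>(2)[OF that] box_subset_cbox
    by (fastforce simp: chart_def)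
  then show ?thesis using \<nu>(1) by blast
qed

text \<open>A chart point of the common face lies on the frontier of the second element, hence is
  the image of a boundary point of its reference cube. There \<open>face_normals_opposite_AE\<close>
  compares the normals.\<close>

lemma neighbour_normal:
  assumes K: "K1 < n_elem M" "K2 < n_elem M" "K1 \<noteq> K2" and s: "s \<in> {0,1}"
  shows "\<exists>N. negligible N \<and> (\<forall>\<eta>\<in>chart_dom M K1 (face_set M (Interior K1 K2)) d s - N.
     normal M K2 (chart M K1 d s \<eta>) = - normal M K1 (chart M K1 d s \<eta>))"
proof -
  note F1 = mesh_smooth[OF M K(1)] and F2 = mesh_smooth[OF M K(2)]
  have "el_map M K1 ` box 0 1 \<inter> el_map M K2 ` box 0 1 = {}"
    using elem_disjoint[OF M K] interior_elem[OF M] K by simp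
  from face_normals_opposite_AE[OF F1 F2 s this, of d]
  obtain N where neg: "negligible N" and "\<forall>\<eta>\<in>cbox 0 1 - N. \<forall>\<xi>\<in>cbox 0 1 - box 0 1.
      el_map M K1 (ref_chart d s \<eta>) = el_map M K2 \<xi> \<longrightarrow>
      outer_normal (el_map M K2) \<xi> = - outer_normal (el_map M K1) (ref_chart d s \<eta>)"
    by (elim exE conjE)
  then have N: "outer_normal (el_map M K2) \<xi> = - outer_normal (el_map M K1) (ref_chart d s \<eta>)"
    if "\<eta> \<in> cbox 0 1 - N" "\<xi> \<in> cbox 0 1 - box 0 1" "el_map M K1 (ref_chart d s \<eta>) = el_map M K2 \<xi>" for \<eta> \<xi>
    using that by simp
  have "normal M K2 (chart M K1 d s \<eta>) = - normal M K1 (chart M K1 d s \<eta>)"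
    if \<eta>: "\<eta> \<in> chart_dom M K1 (face_set M (Interior K1 K2)) d s - N" for \<eta>
  proof -
    have c: "\<eta> \<in> cbox 0 1 - N" and x: "chart M K1 d s \<eta> \<in> frontier (elem M K2)"
      using \<eta> by (auto simp: chart_dom_def)
    have cl: "closed (elem M K2)"
      using elem_compact[OF M K(2)] compact_imp_closed by blast
    then have "chart M K1 d s \<eta> \<in> elem M K2" "chart M K1 d s \<eta> \<notin> interior (elem M K2)"
      using x by (auto simp: frontier_def)
    then obtain \<xi> where \<xi>: "\<xi> \<in> cbox 0 1 - box 0 1" "chart M K1 d s \<eta> = el_map M K2 \<xi>"
      using interior_elem[OF M K(2)] by (auto simp: elem_def)
    have "normal M K2 (chart M K1 d s \<eta>) = outer_normal (el_map M K2) \<xi>"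
      using normal_outer_normal[OF F2] \<xi> by auto
    moreover have "normal M K1 (chart M K1 d s \<eta>) = outer_normal (el_map M K1) (ref_chart d s \<eta>)"
      using normal_outer_normal[OF F1 ref_chart_cube[OF s]] c by (simp add: chart_def)
    ultimately show ?thesis
      using N[OF c \<xi>(1)] \<xi>(2) by (simp add: chart_def)
  qed
  then show ?thesis using neg by blast
qed

end

text \<open>The common integrand of all face terms. As a triple product it changes sign when the two
  fields are exchanged.\<close>

definition cross_form :: "(real^2 \<Rightarrow> real^3) \<Rightarrow> (real^2 \<Rightarrow> real^3) \<Rightarrow> (real^2 \<Rightarrow> real) \<Rightarrow> field \<Rightarrow> field \<Rightarrow>
    real \<Rightarrow> real^2 \<Rightarrow> real" where
  "cross_form X \<nu> r u v t \<eta> = (u t (X \<eta>) \<bullet> cross3 (\<nu> \<eta>) (v t (X \<eta>))) * r \<eta>"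

lemma cross_form_skew: "cross_form X \<nu> r u v t \<eta> = - cross_form X \<nu> r v u t \<eta>"
  by (simp add: cross_form_def inner_3 sum_3 cross3_def algebra_simps)

lemma cross_form_diff: "cross_form X \<nu> r u (v - w) t \<eta> = cross_form X \<nu> r u v t \<eta> - cross_form X \<nu> r u w t \<eta>"
  by (simp add: cross_form_def Cross3.right_diff_distrib inner_diff_right left_diff_distrib)

text \<open>\<open>N\<close> is the time slab, \<open>X\<close> a chart of the face on \<open>D\<close>, \<open>\<nu>\<close> the normal and \<open>r\<close> the area element in its coordinates.\<close>

locale chart_integrals =
  fixes N :: "real measure" and D :: "(real^2) measure" and X \<nu> :: "real^2 \<Rightarrow> real^3" and r :: "real^2 \<Rightarrow> real"
  assumes fin: "finite_measure N" "finite_measure D"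
    and \<nu>: "\<And>c. bdd_meas D (\<lambda>\<eta>. \<nu> \<eta> $ c)" and r: "bdd_meas D r"
begin

definition good :: "field \<Rightarrow> bool" where
  "good u \<longleftrightarrow> (\<forall>c. bdd_meas (N \<Otimes>\<^sub>M D) (\<lambda>(t, \<eta>). u t (X \<eta>) $ c))"

definition I :: "field \<Rightarrow> field \<Rightarrow> real" where
  "I u v = (LINT t|N. LINT \<eta>|D. cross_form X \<nu> r u v t \<eta>)"

lemma good_diff: "good u \<Longrightarrow> good v \<Longrightarrow> good (u - v)"
proof -
  assume "good u" "good v"
  then have "bdd_meas (N \<Otimes>\<^sub>M D) (\<lambda>z. (\<lambda>(t, \<eta>). u t (X \<eta>) $ c) z - (\<lambda>(t, \<eta>). v t (X \<eta>) $ c) z)" for c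
    by (intro bdd_meas_diff) (auto simp: good_def)
  then show ?thesis
    by (simp add: good_def case_prod_beta')
qed

lemma form_bdd_meas: "good u \<Longrightarrow> good v \<Longrightarrow> bdd_meas (N \<Otimes>\<^sub>M D) (\<lambda>(t, \<eta>). cross_form X \<nu> r u v t \<eta>)"
  unfolding cross_form_def using \<nu> r by (intro bdd_meas_cross) (auto simp: good_def)

lemma I_skew: "I u v = - I v u"
proof -
  have "cross_form X \<nu> r u v = (\<lambda>t \<eta>. - cross_form X \<nu> r v u t \<eta>)"
    by (intro ext cross_form_skew)
  then show ?thesis by (simp add: I_def)
qed

lemma I_diff_right:
  assumes "good u" "good v" "good w" shows "I u (v - w) = I u v - I u w"
  unfolding I_def cross_form_diff using assms by (intro double_integral_diff fin form_bdd_meas)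

lemma I_diff_left:
  assumes "good u" "good v" "good w" shows "I (v - w) u = I v u - I w u"
  using I_diff_right[OF assms] I_skew[of "v - w" u] I_skew[of v u] I_skew[of w u] by linarith

text \<open>The inner product of the average of the \<open>x\<close> and the tangential jump of the
  \<open>y\<close>, written for opposite normals: half of the product of \<open>x1 + x2\<close> with
  the normal crossed with \<open>y1 - y2\<close>.\<close>

definition jump_form :: "field \<Rightarrow> field \<Rightarrow> field \<Rightarrow> field \<Rightarrow> real \<Rightarrow> real^2 \<Rightarrow> real" where
  "jump_form x1 x2 y1 y2 t \<eta> = 1/2 * ((cross_form X \<nu> r x1 y1 t \<eta> + cross_form X \<nu> r x2 y1 t \<eta>)
     - (cross_form X \<nu> r x1 y2 t \<eta> + cross_form X \<nu> r x2 y2 t \<eta>))"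

lemma jump_form:
  assumes "good x1" "good x2" "good y1" "good y2"
  shows "bdd_meas (N \<Otimes>\<^sub>M D) (\<lambda>(t, \<eta>). jump_form x1 x2 y1 y2 t \<eta>)"
    and "(LINT t|N. LINT \<eta>|D. jump_form x1 x2 y1 y2 t \<eta>) = 1/2 * (I x1 y1 + I x2 y1 - (I x1 y2 + I x2 y2))"
proof -
  have add: "bdd_meas (N \<Otimes>\<^sub>M D) (\<lambda>(t, \<eta>). cross_form X \<nu> r x1 y t \<eta> + cross_form X \<nu> r x2 y t \<eta>)" if "good y" for y
    using bdd_meas_add[OF form_bdd_meas[OF assms(1) that] form_bdd_meas[OF assms(2) that]] by (simp add: case_prod_beta')
  have "bdd_meas (N \<Otimes>\<^sub>M D) (\<lambda>z. 1/2 * ((\<lambda>(t, \<eta>). cross_form X \<nu> r x1 y1 t \<eta> + cross_form X \<nu> r x2 y1 t \<eta>) z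
      - (\<lambda>(t, \<eta>). cross_form X \<nu> r x1 y2 t \<eta> + cross_form X \<nu> r x2 y2 t \<eta>) z))"
    by (intro bdd_meas_mult[OF bdd_meas_const] bdd_meas_diff add assms)
  then show "bdd_meas (N \<Otimes>\<^sub>M D) (\<lambda>(t, \<eta>). jump_form x1 x2 y1 y2 t \<eta>)"
    by (simp add: jump_form_def case_prod_beta')
  show "(LINT t|N. LINT \<eta>|D. jump_form x1 x2 y1 y2 t \<eta>) = 1/2 * (I x1 y1 + I x2 y1 - (I x1 y2 + I x2 y2))"
    unfolding jump_form_def double_integral_cmult
    using assms by (simp add: double_integral_diff[OF fin add add] double_integral_add[OF fin form_bdd_meas form_bdd_meas] I_def)
qed

text \<open>Fubini's theorem makes time the inner variable. At a fixed chart point the normal is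
  constant, so the projection in time can be moved across the triple product.\<close>

lemma I_adjoint:
  assumes "good u" "good pu" "good v" "good pv" and W: "\<And>w. w \<in> W \<Longrightarrow> bdd_meas N w"
    and u: "\<And>x c. is_proj N W (\<lambda>t. u t x $ c) (\<lambda>t. pu t x $ c)" "\<And>x c. bdd_meas N (\<lambda>t. u t x $ c)"
    and v: "\<And>x c. is_proj N W (\<lambda>t. v t x $ c) (\<lambda>t. pv t x $ c)" "\<And>x c. bdd_meas N (\<lambda>t. v t x $ c)"
  shows "I u pv = I pu v"
proof -
  have "(LINT t|N. cross_form X \<nu> r u pv t \<eta>) = (LINT t|N. cross_form X \<nu> r pu v t \<eta>)" for \<eta>
    unfolding cross_form_def
    using integral_cross_adjoint[OF fin(1) W u v, where n = "\<nu> \<eta>"] by simp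
  then show ?thesis
    unfolding I_def using assms(1-4)
    by (simp add: bdd_meas_finite_pair(2)[OF fin form_bdd_meas])
qed

text \<open>The volume form contributes the first two terms, the stabilization the last four; its defects
  are differences of the projection onto the temporal space of the face and those of the elements.\<close>

lemma interior_cancel:
  assumes good: "good e1" "good e2" "good pe1" "good pe2" "good qe1" "good qe2"
      "good h1" "good h2" "good ph1" "good ph2" "good qh1" "good qh2"
    and adj: "I h1 pe1 = I ph1 e1" "I h2 pe2 = I ph2 e2" "I h2 qe1 = I qh2 e1" "I h1 qe2 = I qh1 e2"
  shows "(LINT t|N. LINT \<eta>|D. jump_form h1 h2 pe1 pe2 t \<eta>) - (LINT t|N. LINT \<eta>|D. jump_form ph1 ph2 e1 e2 t \<eta>)
    + 1/2 * ((LINT t|N. LINT \<eta>|D. jump_form h1 h2 (qe1 - pe1) (qe2 - pe2) t \<eta>)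
       + (LINT t|N. LINT \<eta>|D. jump_form (qe1 - pe1) (qe2 - pe2) h1 h2 t \<eta>))
    - 1/2 * ((LINT t|N. LINT \<eta>|D. jump_form e1 e2 (qh1 - ph1) (qh2 - ph2) t \<eta>)
       + (LINT t|N. LINT \<eta>|D. jump_form (qh1 - ph1) (qh2 - ph2) e1 e2 t \<eta>)) = 0"
proof -
  \<comment> \<open>By skew-symmetry the same-side parts in each pair of stabilizing products
    cancel. Writing d1, d2 for the defects of the projected \<open>e\<close>, the first pair sums to
    \<open>I h2 d1 - I h1 d2\<close>. Its \<open>pe\<close> parts remove the mixed terms left by the
    volume form, the second pair does the same for \<open>ph\<close>, and the remaining terms with
    \<open>qe\<close> and \<open>qh\<close> cancel by the last two equations in
    \<open>adj\<close>.\<close>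
  note skew = I_skew[of qe1] I_skew[of qe2] I_skew[of pe1] I_skew[of pe2] I_skew[of e1] I_skew[of e2]
  show ?thesis
    using good adj by (simp add: jump_form(2) good_diff I_diff_left I_diff_right skew algebra_simps)
qed

end

section \<open>Cancellation on a single face\<close>

context
  fixes M
  assumes M: "valid_mesh M"
begin

lemma face_dom_cbox: "face_elem f < n_elem M \<Longrightarrow> s \<in> {0,1} \<Longrightarrow> face_dom M f d s \<subseteq> cbox 0 1"
  using face_dom(3)[OF M] by blast

lemma face_chart_integrals:
  assumes f: "face_elem f < n_elem M" and s: "s \<in> {0,1}" and \<nu>: "continuous_on (cbox 0 1) \<nu>"
  shows "chart_integrals (lebesgue_on (slab M)) (lebesgue_on (face_dom M f d s)) \<nu> (area_element (face_chart M f d s))"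
proof (rule chart_integrals.intro)
  note dom = face_dom[OF M f s, where d = d]
  show "finite_measure (lebesgue_on (slab M))" "finite_measure (lebesgue_on (face_dom M f d s))"
    using slab_finite finite_measure_lebesgue_on[OF dom(4)] by auto
  show "bdd_meas (lebesgue_on (face_dom M f d s)) (\<lambda>\<eta>. \<nu> \<eta> $ c)" for c
    using dom(4) by (intro bdd_meas_continuous_compact[OF compact_cbox[of 0 1] _ dom(3)] continuous_on_component \<nu>) auto
  show "bdd_meas (lebesgue_on (face_dom M f d s)) (area_element (face_chart M f d s))"
    using dom(4) area_element_continuous[OF mesh_smooth[OF M f] s]
    by (intro bdd_meas_continuous_compact[OF compact_cbox[of 0 1] _ dom(3)]) (auto simp: chart_def)
qed

text \<open>The choice operator is harmless: such a \<open>\<nu>\<close> exists, and it is continuous up to the boundary of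
  the square, which \<open>normal\<close> itself need not be.\<close>

definition chart_normal :: "face \<Rightarrow> 3 \<Rightarrow> real \<Rightarrow> real^2 \<Rightarrow> real^3" where
  "chart_normal f d s = (SOME \<nu>. continuous_on (cbox 0 1) \<nu> \<and>
     (\<forall>\<eta>\<in>box 0 1. normal M (face_elem f) (face_chart M f d s \<eta>) = \<nu> \<eta>))"

lemma chart_normal:
  assumes "face_elem f < n_elem M" "s \<in> {0,1}"
  shows "continuous_on (cbox 0 1) (chart_normal f d s)"
    and "\<eta> \<in> box 0 1 \<Longrightarrow> normal M (face_elem f) (face_chart M f d s \<eta>) = chart_normal f d s \<eta>"
  using someI_ex[OF boundary_normal[OF M assms]] unfolding chart_normal_def by blast+

abbreviation chart_form :: "face \<Rightarrow> 3 \<Rightarrow> real \<Rightarrow> field \<Rightarrow> field \<Rightarrow> real \<Rightarrow> real^2 \<Rightarrow> real" where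
  "chart_form f d s \<equiv> cross_form (face_chart M f d s) (chart_normal f d s) (area_element (face_chart M f d s))"

abbreviation chart_jump :: "face \<Rightarrow> field \<Rightarrow> field \<Rightarrow> field \<Rightarrow> field \<Rightarrow> 3 \<Rightarrow> real \<Rightarrow> real \<Rightarrow> real^2 \<Rightarrow> real" where
  "chart_jump f x1 x2 y1 y2 \<equiv> (\<lambda>d s. chart_integrals.jump_form (face_chart M f d s) (chart_normal f d s)
     (area_element (face_chart M f d s)) x1 x2 y1 y2)"

definition chart_good :: "face \<Rightarrow> field \<Rightarrow> bool" where
  "chart_good f u \<longleftrightarrow> (\<forall>d. \<forall>s\<in>{0,1}. chart_integrals.good (lebesgue_on (slab M)) (lebesgue_on (face_dom M f d s)) (face_chart M f d s) u)"

lemma chart_goodD: "chart_good f u \<Longrightarrow> s \<in> {0,1} \<Longrightarrow>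
    chart_integrals.good (lebesgue_on (slab M)) (lebesgue_on (face_dom M f d s)) (face_chart M f d s) u"
  unfolding chart_good_def by blast

lemma chart_integrals:
  assumes "face_elem f < n_elem M" "s \<in> {0,1}"
  shows "chart_integrals (lebesgue_on (slab M)) (lebesgue_on (face_dom M f d s)) (chart_normal f d s) (area_element (face_chart M f d s))"
  using face_chart_integrals[OF assms chart_normal(1)[OF assms]] .

text \<open>Opposite normals turn the sum of cross products in the jump into a difference, up to a
  null set. The side fields \<open>A\<close> and \<open>B\<close> may depend on the face, because
  the projection defects do.\<close>

lemma jump_repr:
  fixes A B :: "face \<Rightarrow> side_field"
  assumes K: "K1 < n_elem M" "K2 < n_elem M" "K1 \<noteq> K2" and f: "f = Interior K1 K2"
    and good: "chart_good f x1" "chart_good f x2" "chart_good f y1" "chart_good f y2"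
    and A: "\<And>t x. t \<in> slab M \<Longrightarrow> x \<in> face_set M f \<Longrightarrow> A f K1 t x = x1 t x \<and> A f K2 t x = x2 t x"
    and B: "\<And>t x. t \<in> slab M \<Longrightarrow> x \<in> face_set M f \<Longrightarrow> B f K1 t x = y1 t x \<and> B f K2 t x = y2 t x"
  shows "face_repr M f (\<lambda>f. avg (A f) f) (\<lambda>f. tjump M (B f) f) (chart_jump f x1 x2 y1 y2)"
    and "face_repr M f (\<lambda>f. tjump M (B f) f) (\<lambda>f. avg (A f) f) (chart_jump f x1 x2 y1 y2)"
proof -
  have fe: "face_elem f < n_elem M" using K f by simp
  have main: "bdd_meas (lebesgue_on (slab M) \<Otimes>\<^sub>M lebesgue_on (face_dom M f d s)) (\<lambda>(t, \<eta>). chart_jump f x1 x2 y1 y2 d s t \<eta>) \<and>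
     (\<exists>N. negligible N \<and> (\<forall>t\<in>slab M. \<forall>\<eta>\<in>face_dom M f d s - N.
        (avg (A f) f t (face_chart M f d s \<eta>) \<bullet> tjump M (B f) f t (face_chart M f d s \<eta>)) * area_element (face_chart M f d s) \<eta> =
        chart_jump f x1 x2 y1 y2 d s t \<eta>))" if s: "s \<in> {0,1}" for d s
  proof -
    interpret chart_integrals "lebesgue_on (slab M)" "lebesgue_on (face_dom M f d s)" "face_chart M f d s"
      "chart_normal f d s" "area_element (face_chart M f d s)"
      by (rule chart_integrals[OF fe s])
    obtain N where N: "negligible N" "\<And>\<eta>. \<eta> \<in> face_dom M f d s - N \<Longrightarrow>
        normal M K2 (face_chart M f d s \<eta>) = - normal M K1 (face_chart M f d s \<eta>)"
      using neighbour_normal[OF M K s, of d] f by auto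
    let ?N = "N \<union> (cbox 0 1 - box 0 1)"
    have "(avg (A f) f t (face_chart M f d s \<eta>) \<bullet> tjump M (B f) f t (face_chart M f d s \<eta>)) * area_element (face_chart M f d s) \<eta> =
        jump_form x1 x2 y1 y2 t \<eta>" if t: "t \<in> slab M" and \<eta>: "\<eta> \<in> face_dom M f d s - ?N" for t \<eta>
    proof -
      have "\<eta> \<in> box 0 1" using \<eta> face_dom_cbox[OF fe s] by blast
      then have n1: "normal M K1 (face_chart M f d s \<eta>) = chart_normal f d s \<eta>"
        using chart_normal(2)[OF fe s] f by simp
      then have n2: "normal M K2 (face_chart M f d s \<eta>) = - chart_normal f d s \<eta>"
        using N(2)[of \<eta>] \<eta> by simp
      have "face_chart M f d s \<eta> \<in> face_set M f" using \<eta> by (simp add: chart_dom_def)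
      note AB = A[OF t this] B[OF t this]
      have avg: "avg (A f) f t (face_chart M f d s \<eta>) =
          (1/2) *\<^sub>R (x1 t (face_chart M f d s \<eta>) + x2 t (face_chart M f d s \<eta>))"
        using AB f by simp
      have jump: "tjump M (B f) f t (face_chart M f d s \<eta>) =
          cross3 (chart_normal f d s \<eta>) (y1 t (face_chart M f d s \<eta>)) - cross3 (chart_normal f d s \<eta>) (y2 t (face_chart M f d s \<eta>))"
        using AB n1 n2 f by simp
      show ?thesis
        unfolding avg jump jump_form_def cross_form_def by (simp add: inner_add_left inner_diff_right algebra_simps)
    qed
    then show ?thesis
      using jump_form(1)[OF good[THEN chart_goodD, OF s]] N(1) negligible_frontier_interval
      by (intro conjI exI[of _ ?N]) auto
  qed
  then show "face_repr M f (\<lambda>f. avg (A f) f) (\<lambda>f. tjump M (B f) f) (chart_jump f x1 x2 y1 y2)"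
    unfolding face_repr_def by blast
  show "face_repr M f (\<lambda>f. tjump M (B f) f) (\<lambda>f. avg (A f) f) (chart_jump f x1 x2 y1 y2)"
    unfolding face_repr_def inner_commute[of "tjump M (B f) f _ _"] using main by blast
qed

lemma face_ip_single:
  assumes "face_elem f < n_elem M" "face_repr M f a b g"
  shows "face_ip M {f} a b = (\<Sum>d\<in>UNIV. \<Sum>s\<in>{0,1}.
    LINT t|lebesgue_on (slab M). LINT \<eta>|lebesgue_on (face_dom M f d s). g d s t \<eta>)"
  using face_ip_repr[OF M, of "{f}" a b "\<lambda>_. g"] assms by simp

text \<open>The first six claims supply the integrability needed to sum over faces; the last is the
  cancellation between volume form and stabilization on this face.\<close>

lemma interior_face_cancel:
  assumes E: "E \<in> V_h M" and H: "H \<in> V_h M" and K: "K1 < n_elem M" "K2 < n_elem M" "K1 \<noteq> K2"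
    and f: "f = Interior K1 K2"
  shows "\<exists>g. face_repr M f (avg (tr M H)) (tjump M (tr M (proj_W M E))) g"
    and "\<exists>g. face_repr M f (tjump M (tr M E)) (avg (tr M (proj_W M H))) g"
    and "\<exists>g. face_repr M f (avg (tr M H)) (\<lambda>f. tjump M (proj_defect M (proj_W M E) f) f) g"
    and "\<exists>g. face_repr M f (tjump M (tr M H)) (\<lambda>f. avg (proj_defect M (proj_W M E) f) f) g"
    and "\<exists>g. face_repr M f (avg (tr M E)) (\<lambda>f. tjump M (proj_defect M (proj_W M H) f) f) g"
    and "\<exists>g. face_repr M f (tjump M (tr M E)) (\<lambda>f. avg (proj_defect M (proj_W M H) f) f) g"
    and "face_ip M {f} (avg (tr M H)) (tjump M (tr M (proj_W M E))) - face_ip M {f} (tjump M (tr M E)) (avg (tr M (proj_W M H)))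
      + 1/2 * (face_ip M {f} (avg (tr M H)) (\<lambda>f. tjump M (proj_defect M (proj_W M E) f) f)
          + face_ip M {f} (tjump M (tr M H)) (\<lambda>f. avg (proj_defect M (proj_W M E) f) f))
      - 1/2 * (face_ip M {f} (avg (tr M E)) (\<lambda>f. tjump M (proj_defect M (proj_W M H) f) f)
          + face_ip M {f} (tjump M (tr M E)) (\<lambda>f. avg (proj_defect M (proj_W M H) f) f)) = 0"
proof -
  let ?N = "lebesgue_on (slab M)" and ?A = "{K1, K2}"
  let ?W = "\<Inter>K'\<in>?A. T_time M K'"
  have A: "?A \<subseteq> {..<n_elem M}" "K1 \<in> ?A" "K2 \<in> ?A" and sides: "sides f = ?A" and fe: "face_elem f < n_elem M"
    using K f by auto
  have sub: "face_set M f \<subseteq> elem M K1" "face_set M f \<subseteq> elem M K2"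
    using compact_imp_closed[OF elem_compact[OF M K(1)]] compact_imp_closed[OF elem_compact[OF M K(2)]] f
    by (auto simp: frontier_def)
  define data where "data u K U PU QU \<longleftrightarrow>
    (\<forall>t\<in>slab M. \<forall>x\<in>face_set M f. tr M u K t x = U t x \<and> tr M (proj_W M u) K t x = PU t x \<and>
       face_proj M f (tr M (proj_W M u)) K t x = QU t x) \<and>
    chart_good f U \<and> chart_good f PU \<and> chart_good f QU \<and>
    (\<forall>x c. bdd_meas ?N (\<lambda>t. U t x $ c)) \<and> (\<forall>x c. is_proj ?N (T_time M K) (\<lambda>t. U t x $ c) (\<lambda>t. PU t x $ c)) \<and>
    (\<forall>x c. is_proj ?N ?W (\<lambda>t. U t x $ c) (\<lambda>t. QU t x $ c))" for u K and U PU QU :: field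
  have data: "\<exists>U PU QU. data u K U PU QU" if u: "u \<in> V_h M" and K: "K \<in> ?A" for u K
  proof -
    obtain U PU QU :: field where U: 
      "\<And>t x. t \<in> slab M \<Longrightarrow> x \<in> elem M K \<Longrightarrow> tr M u K t x = U t x \<and> tr M (proj_W M u) K t x = PU t x \<and>
         (\<forall>f. sides f = ?A \<longrightarrow> face_proj M f (tr M (proj_W M u)) K t x = QU t x)"
      "\<And>S (\<Phi> :: real^2 \<Rightarrow> real^3) c. compact S \<Longrightarrow> continuous_on S \<Phi> \<Longrightarrow> \<Phi> ` S \<subseteq> elem M K \<Longrightarrow>
         bdd_meas (?N \<Otimes>\<^sub>M lebesgue_on S) (\<lambda>(t, y). U t (\<Phi> y) $ c) \<and> bdd_meas (?N \<Otimes>\<^sub>M lebesgue_on S) (\<lambda>(t, y). PU t (\<Phi> y) $ c) \<and>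
         bdd_meas (?N \<Otimes>\<^sub>M lebesgue_on S) (\<lambda>(t, y). QU t (\<Phi> y) $ c)"
      "\<And>x c. bdd_meas ?N (\<lambda>t. U t x $ c) \<and> is_proj ?N (T_time M K) (\<lambda>t. U t x $ c) (\<lambda>t. PU t x $ c) \<and>
         is_proj ?N ?W (\<lambda>t. U t x $ c) (\<lambda>t. QU t x $ c)"
      using trace_data[OF M u K A(1)] by (elim exE conjE) blast
    have fK: "face_set M f \<subseteq> elem M K" using K sub by auto
    have good: "bdd_meas (?N \<Otimes>\<^sub>M lebesgue_on (face_dom M f d s)) (\<lambda>(t, y). U t (face_chart M f d s y) $ c) \<and>
       bdd_meas (?N \<Otimes>\<^sub>M lebesgue_on (face_dom M f d s)) (\<lambda>(t, y). PU t (face_chart M f d s y) $ c) \<and>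
       bdd_meas (?N \<Otimes>\<^sub>M lebesgue_on (face_dom M f d s)) (\<lambda>(t, y). QU t (face_chart M f d s y) $ c)" if s: "s \<in> {0,1}" for d s c
      by (rule U(2)[OF face_dom(1)[OF M fe s] face_dom(2)[OF M fe s]]) (use fK in \<open>auto simp: chart_dom_def\<close>)
    have "chart_good f U" "chart_good f PU" "chart_good f QU"
      using good chart_integrals.good_def[OF chart_integrals[OF fe]] unfolding chart_good_def by blast+
    moreover have "tr M u K t x = U t x \<and> tr M (proj_W M u) K t x = PU t x \<and>
       face_proj M f (tr M (proj_W M u)) K t x = QU t x" if "t \<in> slab M" "x \<in> face_set M f" for t x
      using U(1)[OF that(1)] fK that(2) sides by blast
    ultimately show ?thesis using U(3) unfolding data_def by blast
  qed
  obtain e1 pe1 qe1 where "data E K1 e1 pe1 qe1" using data[OF E A(2)] by blast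
  note e1 = this[unfolded data_def]
  obtain e2 pe2 qe2 where "data E K2 e2 pe2 qe2" using data[OF E A(3)] by blast
  note e2 = this[unfolded data_def]
  obtain h1 ph1 qh1 where "data H K1 h1 ph1 qh1" using data[OF H A(2)] by blast
  note h1 = this[unfolded data_def]
  obtain h2 ph2 qh2 where "data H K2 h2 ph2 qh2" using data[OF H A(3)] by blast
  note h2 = this[unfolded data_def]
  have good: "chart_good f e1" "chart_good f e2" "chart_good f pe1" "chart_good f pe2" "chart_good f qe1" "chart_good f qe2"
    "chart_good f h1" "chart_good f h2" "chart_good f ph1" "chart_good f ph2" "chart_good f qh1" "chart_good f qh2"
    using e1 e2 h1 h2 by blast+
  have diff: "chart_good f (u - v)" if "chart_good f u" "chart_good f v" for u v
    using that chart_integrals.good_diff[OF chart_integrals[OF fe]] unfolding chart_good_def by blast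
  note goodd = diff[OF good(5,3)] diff[OF good(6,4)] diff[OF good(11,9)] diff[OF good(12,10)]
  note repr = jump_repr[OF K f]
  have tE: "tr M E K1 t x = e1 t x \<and> tr M E K2 t x = e2 t x"
    and tpE: "tr M (proj_W M E) K1 t x = pe1 t x \<and> tr M (proj_W M E) K2 t x = pe2 t x"
    and tH: "tr M H K1 t x = h1 t x \<and> tr M H K2 t x = h2 t x"
    and tpH: "tr M (proj_W M H) K1 t x = ph1 t x \<and> tr M (proj_W M H) K2 t x = ph2 t x"
    and dE: "proj_defect M (proj_W M E) f K1 t x = (qe1 - pe1) t x \<and> proj_defect M (proj_W M E) f K2 t x = (qe2 - pe2) t x"
    and dH: "proj_defect M (proj_W M H) f K1 t x = (qh1 - ph1) t x \<and> proj_defect M (proj_W M H) f K2 t x = (qh2 - ph2) t x"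
    if "t \<in> slab M" "x \<in> face_set M f" for t x
    using e1 e2 h1 h2 that by (auto simp: proj_defect_def)
  have r1: "face_repr M f (avg (tr M H)) (tjump M (tr M (proj_W M E))) (chart_jump f h1 h2 pe1 pe2)"
    using repr(1)[OF good(7,8,3,4), of "\<lambda>_. tr M H" "\<lambda>_. tr M (proj_W M E)", OF tH tpE] .
  have r2: "face_repr M f (tjump M (tr M E)) (avg (tr M (proj_W M H))) (chart_jump f ph1 ph2 e1 e2)"
    using repr(2)[OF good(9,10,1,2), of "\<lambda>_. tr M (proj_W M H)" "\<lambda>_. tr M E", OF tpH tE] .
  have r3: "face_repr M f (avg (tr M H)) (\<lambda>f. tjump M (proj_defect M (proj_W M E) f) f)
      (chart_jump f h1 h2 (qe1 - pe1) (qe2 - pe2))"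
    using repr(1)[OF good(7,8) goodd(1,2), of "\<lambda>_. tr M H" "proj_defect M (proj_W M E)", OF tH dE] .
  have r4: "face_repr M f (tjump M (tr M H)) (\<lambda>f. avg (proj_defect M (proj_W M E) f) f)
      (chart_jump f (qe1 - pe1) (qe2 - pe2) h1 h2)"
    using repr(2)[OF goodd(1,2) good(7,8), of "proj_defect M (proj_W M E)" "\<lambda>_. tr M H", OF dE tH] .
  have r5: "face_repr M f (avg (tr M E)) (\<lambda>f. tjump M (proj_defect M (proj_W M H) f) f)
      (chart_jump f e1 e2 (qh1 - ph1) (qh2 - ph2))"
    using repr(1)[OF good(1,2) goodd(3,4), of "\<lambda>_. tr M E" "proj_defect M (proj_W M H)", OF tE dH] .
  have r6: "face_repr M f (tjump M (tr M E)) (\<lambda>f. avg (proj_defect M (proj_W M H) f) f)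
      (chart_jump f (qh1 - ph1) (qh2 - ph2) e1 e2)"
    using repr(2)[OF goodd(3,4) good(1,2), of "proj_defect M (proj_W M H)" "\<lambda>_. tr M E", OF dH tE] .
  show "\<exists>g. face_repr M f (avg (tr M H)) (tjump M (tr M (proj_W M E))) g"
    "\<exists>g. face_repr M f (tjump M (tr M E)) (avg (tr M (proj_W M H))) g"
    "\<exists>g. face_repr M f (avg (tr M H)) (\<lambda>f. tjump M (proj_defect M (proj_W M E) f) f) g"
    "\<exists>g. face_repr M f (tjump M (tr M H)) (\<lambda>f. avg (proj_defect M (proj_W M E) f) f) g"
    "\<exists>g. face_repr M f (avg (tr M E)) (\<lambda>f. tjump M (proj_defect M (proj_W M H) f) f) g"
    "\<exists>g. face_repr M f (tjump M (tr M E)) (\<lambda>f. avg (proj_defect M (proj_W M H) f) f) g"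
    using r1 r2 r3 r4 r5 r6 by blast+
  let ?I = "\<lambda>d s x1 x2 y1 y2. LINT t|?N. LINT \<eta>|lebesgue_on (face_dom M f d s). chart_jump f x1 x2 y1 y2 d s t \<eta>"
  have "?I d s h1 h2 pe1 pe2 - ?I d s ph1 ph2 e1 e2
      + 1/2 * (?I d s h1 h2 (qe1 - pe1) (qe2 - pe2) + ?I d s (qe1 - pe1) (qe2 - pe2) h1 h2)
      - 1/2 * (?I d s e1 e2 (qh1 - ph1) (qh2 - ph2) + ?I d s (qh1 - ph1) (qh2 - ph2) e1 e2) = 0"
    if s: "s \<in> {0,1}" for d s
  proof -
    interpret chart_integrals ?N "lebesgue_on (face_dom M f d s)" "face_chart M f d s"
      "chart_normal f d s" "area_element (face_chart M f d s)"
      by (rule chart_integrals[OF fe s])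
    have g: "good e1" "good e2" "good pe1" "good pe2" "good qe1" "good qe2"
      "good h1" "good h2" "good ph1" "good ph2" "good qh1" "good qh2"
      using good[THEN chart_goodD, OF s] by blast+
    have bmW: "bdd_meas ?N w" if "w \<in> ?W" for w using that T_time_bdd_meas[OF M K(1)] by auto
    show ?thesis
    proof (rule interior_cancel[OF g])
      show "I h1 pe1 = I ph1 e1"
        by (rule I_adjoint[OF g(7,9,1,3) T_time_bdd_meas[OF M K(1)]]) (use h1 e1 in auto)
      show "I h2 pe2 = I ph2 e2"
        by (rule I_adjoint[OF g(8,10,2,4) T_time_bdd_meas[OF M K(2)]]) (use h2 e2 in auto)
      \<comment> \<open>Here the fields come from different sides, so self-adjointness is available
        only for the intersection of the two temporal spaces.\<close>
      show "I h2 qe1 = I qh2 e1"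
        by (rule I_adjoint[where W = ?W, OF g(8,12,1,5) bmW]) (use h2 e1 in auto)
      show "I h1 qe2 = I qh1 e2"
        by (rule I_adjoint[where W = ?W, OF g(7,11,2,6) bmW]) (use h1 e2 in auto)
    qed
  qed
  then have "(\<Sum>d\<in>UNIV. \<Sum>s\<in>{0,1}. ?I d s h1 h2 pe1 pe2 - ?I d s ph1 ph2 e1 e2
      + 1/2 * (?I d s h1 h2 (qe1 - pe1) (qe2 - pe2) + ?I d s (qe1 - pe1) (qe2 - pe2) h1 h2)
      - 1/2 * (?I d s e1 e2 (qh1 - ph1) (qh2 - ph2) + ?I d s (qh1 - ph1) (qh2 - ph2) e1 e2)) = 0"
    by (intro sum.neutral ballI)
  then show "face_ip M {f} (avg (tr M H)) (tjump M (tr M (proj_W M E))) - face_ip M {f} (tjump M (tr M E)) (avg (tr M (proj_W M H)))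
      + 1/2 * (face_ip M {f} (avg (tr M H)) (\<lambda>f. tjump M (proj_defect M (proj_W M E) f) f)
          + face_ip M {f} (tjump M (tr M H)) (\<lambda>f. avg (proj_defect M (proj_W M E) f) f))
      - 1/2 * (face_ip M {f} (avg (tr M E)) (\<lambda>f. tjump M (proj_defect M (proj_W M H) f) f)
          + face_ip M {f} (tjump M (tr M E)) (\<lambda>f. avg (proj_defect M (proj_W M H) f) f)) = 0"
    unfolding face_ip_single[OF fe r1] face_ip_single[OF fe r2] face_ip_single[OF fe r3]
      face_ip_single[OF fe r4] face_ip_single[OF fe r5] face_ip_single[OF fe r6]
    by (simp only: sum_subtractf sum.distrib flip: sum_distrib_left)
qed

text \<open>Only one element is involved, so both fields are projected onto the same temporal space
  and self-adjointness alone gives the equality.\<close>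

lemma boundary_face_cancel:
  assumes E: "E \<in> V_h M" and H: "H \<in> V_h M" and K: "K < n_elem M" and f: "f = Boundary K"
  shows "\<exists>g. face_repr M f (avg (tr M H)) (tjump M (tr M (proj_W M E))) g"
    and "\<exists>g. face_repr M f (tjump M (tr M E)) (avg (tr M (proj_W M H))) g"
    and "face_ip M {f} (avg (tr M H)) (tjump M (tr M (proj_W M E))) = face_ip M {f} (tjump M (tr M E)) (avg (tr M (proj_W M H)))"
proof -
  let ?N = "lebesgue_on (slab M)"
  have fe: "face_elem f < n_elem M" and A: "K \<in> {K}" "{K} \<subseteq> {..<n_elem M}"
    using K f by auto
  have fK: "face_set M f \<subseteq> elem M K"
    using compact_imp_closed[OF elem_compact[OF M K]] f by (auto simp: frontier_def)
  define data where "data u U PU \<longleftrightarrow> (\<forall>t\<in>slab M. \<forall>x\<in>face_set M f. tr M u K t x = U t x \<and> tr M (proj_W M u) K t x = PU t x) \<and>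
    chart_good f U \<and> chart_good f PU \<and> (\<forall>x c. bdd_meas ?N (\<lambda>t. U t x $ c)) \<and>
    (\<forall>x c. is_proj ?N (T_time M K) (\<lambda>t. U t x $ c) (\<lambda>t. PU t x $ c))" for u and U PU :: field
  have data: "\<exists>U PU. data u U PU" if u: "u \<in> V_h M" for u
  proof -
    obtain U PU QU :: field where U: 
      "\<And>t x. t \<in> slab M \<Longrightarrow> x \<in> elem M K \<Longrightarrow> tr M u K t x = U t x \<and> tr M (proj_W M u) K t x = PU t x"
      "\<And>S (\<Phi> :: real^2 \<Rightarrow> real^3) c. compact S \<Longrightarrow> continuous_on S \<Phi> \<Longrightarrow> \<Phi> ` S \<subseteq> elem M K \<Longrightarrow>
         bdd_meas (?N \<Otimes>\<^sub>M lebesgue_on S) (\<lambda>(t, y). U t (\<Phi> y) $ c) \<and> bdd_meas (?N \<Otimes>\<^sub>M lebesgue_on S) (\<lambda>(t, y). PU t (\<Phi> y) $ c)"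
      "\<And>x c. bdd_meas ?N (\<lambda>t. U t x $ c) \<and> is_proj ?N (T_time M K) (\<lambda>t. U t x $ c) (\<lambda>t. PU t x $ c)"
      using trace_data[OF M u A] by (elim exE conjE) blast
    have good: "bdd_meas (?N \<Otimes>\<^sub>M lebesgue_on (face_dom M f d s)) (\<lambda>(t, y). U t (face_chart M f d s y) $ c) \<and>
       bdd_meas (?N \<Otimes>\<^sub>M lebesgue_on (face_dom M f d s)) (\<lambda>(t, y). PU t (face_chart M f d s y) $ c)" if s: "s \<in> {0,1}" for d s c
      by (rule U(2)[OF face_dom(1)[OF M fe s] face_dom(2)[OF M fe s]]) (use fK in \<open>auto simp: chart_dom_def\<close>)
    have "chart_good f U" "chart_good f PU"
      using good chart_integrals.good_def[OF chart_integrals[OF fe]] unfolding chart_good_def by blast+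
    then show ?thesis using U(1,3) fK unfolding data_def by blast
  qed
  obtain e pe where "data E e pe"
    using data[OF E] by blast
  then have e: "\<And>t x. t \<in> slab M \<Longrightarrow> x \<in> face_set M f \<Longrightarrow> tr M E K t x = e t x \<and> tr M (proj_W M E) K t x = pe t x"
    "chart_good f e" "chart_good f pe" "\<And>x c. bdd_meas ?N (\<lambda>t. e t x $ c)"
    "\<And>x c. is_proj ?N (T_time M K) (\<lambda>t. e t x $ c) (\<lambda>t. pe t x $ c)"
    unfolding data_def by blast+
  obtain h ph where "data H h ph"
    using data[OF H] by blast
  then have h: "\<And>t x. t \<in> slab M \<Longrightarrow> x \<in> face_set M f \<Longrightarrow> tr M H K t x = h t x \<and> tr M (proj_W M H) K t x = ph t x"
    "chart_good f h" "chart_good f ph" "\<And>x c. bdd_meas ?N (\<lambda>t. h t x $ c)"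
    "\<And>x c. is_proj ?N (T_time M K) (\<lambda>t. h t x $ c) (\<lambda>t. ph t x $ c)"
    unfolding data_def by blast+
  have normal: "normal M K (face_chart M f d s \<eta>) = chart_normal f d s \<eta>" "face_chart M f d s \<eta> \<in> face_set M f"
    if "s \<in> {0,1}" "\<eta> \<in> face_dom M f d s - (cbox 0 1 - box 0 1)" for d s \<eta>
    using chart_normal(2)[OF fe that(1)] face_dom_cbox[OF fe that(1)] that(2) f by (auto simp: chart_dom_def)
  have bmf: "bdd_meas (?N \<Otimes>\<^sub>M lebesgue_on (face_dom M f d s)) (\<lambda>(t, \<eta>). chart_form f d s u v t \<eta>)"
    if "s \<in> {0,1}" "chart_good f u" "chart_good f v" for d s u v
    using chart_integrals.form_bdd_meas[OF chart_integrals[OF fe that(1)] chart_goodD[OF that(2,1)] chart_goodD[OF that(3,1)]] .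
  have r1: "face_repr M f (avg (tr M H)) (tjump M (tr M (proj_W M E))) (\<lambda>d s. chart_form f d s h pe)"
    unfolding face_repr_def
  proof (intro allI ballI conjI exI[of _ "cbox 0 1 - box 0 1"] negligible_frontier_interval)
    fix d s t \<eta> assume s: "s \<in> {0,1::real}" and *: "t \<in> slab M" "\<eta> \<in> face_dom M f d s - (cbox 0 1 - box 0 1)"
    show "(avg (tr M H) f t (face_chart M f d s \<eta>) \<bullet> tjump M (tr M (proj_W M E)) f t (face_chart M f d s \<eta>)) *
        area_element (face_chart M f d s) \<eta> = chart_form f d s h pe t \<eta>"
      using normal[OF s *(2)] e(1)[OF *(1)] h(1)[OF *(1)] f by (simp add: cross_form_def)
  qed (use bmf h e in blast)
  have r2: "face_repr M f (tjump M (tr M E)) (avg (tr M (proj_W M H))) (\<lambda>d s. chart_form f d s ph e)"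
    unfolding face_repr_def
  proof (intro allI ballI conjI exI[of _ "cbox 0 1 - box 0 1"] negligible_frontier_interval)
    fix d s t \<eta> assume s: "s \<in> {0,1::real}" and *: "t \<in> slab M" "\<eta> \<in> face_dom M f d s - (cbox 0 1 - box 0 1)"
    show "(tjump M (tr M E) f t (face_chart M f d s \<eta>) \<bullet> avg (tr M (proj_W M H)) f t (face_chart M f d s \<eta>)) *
        area_element (face_chart M f d s) \<eta> = chart_form f d s ph e t \<eta>"
      using normal[OF s *(2)] e(1)[OF *(1)] h(1)[OF *(1)] f by (simp add: cross_form_def inner_commute)
  qed (use bmf h e in blast)
  show "\<exists>g. face_repr M f (avg (tr M H)) (tjump M (tr M (proj_W M E))) g"
    "\<exists>g. face_repr M f (tjump M (tr M E)) (avg (tr M (proj_W M H))) g"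
    using r1 r2 by blast+
  have "(LINT t|?N. LINT \<eta>|lebesgue_on (face_dom M f d s). chart_form f d s h pe t \<eta>) =
      (LINT t|?N. LINT \<eta>|lebesgue_on (face_dom M f d s). chart_form f d s ph e t \<eta>)" if s: "s \<in> {0,1}" for d s
  proof -
    interpret chart_integrals ?N "lebesgue_on (face_dom M f d s)" "face_chart M f d s"
      "chart_normal f d s" "area_element (face_chart M f d s)"
      by (rule chart_integrals[OF fe s])
    have "good h" "good ph" "good e" "good pe"
      using h(2,3)[THEN chart_goodD, OF s] e(2,3)[THEN chart_goodD, OF s] by blast+
    then have "I h pe = I ph e"
      by (rule I_adjoint[OF _ _ _ _ T_time_bdd_meas[OF M K]]) (use h e in auto)
    then show ?thesis by (simp add: I_def)
  qed
  then show "face_ip M {f} (avg (tr M H)) (tjump M (tr M (proj_W M E))) = face_ip M {f} (tjump M (tr M E)) (avg (tr M (proj_W M H)))"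
    unfolding face_ip_single[OF fe r1] face_ip_single[OF fe r2] by (intro sum.cong refl)
qed

end

section \<open>Summation over all faces and the energy identity\<close>

lemma finite_faces: "finite (F0 M)" "finite (Fb M)" "F0 M \<inter> Fb M = {}"
proof -
  have "F0 M \<subseteq> (\<lambda>(i, j). Interior i j) ` ({..<n_elem M} \<times> {..<n_elem M})"
    by (auto simp: F0_def)
  then show "finite (F0 M)"
    by (rule finite_subset) simp
  have "Fb M \<subseteq> Boundary ` {..<n_elem M}"
    by (auto simp: Fb_def)
  then show "finite (Fb M)"
    by (rule finite_subset) simp
  show "F0 M \<inter> Fb M = {}"
    by (auto simp: F0_def Fb_def)
qed

lemma face_terms_cancel:
  assumes M: "valid_mesh M" and E: "E \<in> V_h M" and H: "H \<in> V_h M"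
  shows "face_ip M (F0 M \<union> Fb M) (avg (tr M H)) (tjump M (tr M (proj_W M E)))
    - face_ip M (F0 M \<union> Fb M) (tjump M (tr M E)) (avg (tr M (proj_W M H)))
    + S_h M (E, H) (proj_W M E, proj_W M H) = 0"
proof -
  have F0: "\<exists>K1 K2. K1 < n_elem M \<and> K2 < n_elem M \<and> K1 \<noteq> K2 \<and> f = Interior K1 K2" if "f \<in> F0 M" for f
    using that by (auto simp: F0_def)
  have Fb: "\<exists>K. K < n_elem M \<and> f = Boundary K" if "f \<in> Fb M" for f
    using that by (auto simp: Fb_def)
  have elem: "face_elem f < n_elem M" if "f \<in> F0 M \<union> Fb M" for f
    using that F0 Fb by fastforce
  have "face_ip M (F0 M \<union> Fb M) a b = (\<Sum>f\<in>F0 M. face_ip M {f} a b) + (\<Sum>f\<in>Fb M. face_ip M {f} a b)"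
    if "\<And>f. f \<in> F0 M \<union> Fb M \<Longrightarrow> \<exists>g. face_repr M f a b g" for a b
    using face_ip_sum[OF M finite_UnI[OF finite_faces(1,2)] elem that] sum.union_disjoint[OF finite_faces] by metis
  moreover have "\<exists>g. face_repr M f (avg (tr M H)) (tjump M (tr M (proj_W M E))) g"
    "\<exists>g. face_repr M f (tjump M (tr M E)) (avg (tr M (proj_W M H))) g" if "f \<in> F0 M \<union> Fb M" for f
    using that F0 Fb interior_face_cancel(1,2)[OF M E H] boundary_face_cancel(1,2)[OF M E H] by (metis Un_iff)+
  ultimately have 1:
    "face_ip M (F0 M \<union> Fb M) (avg (tr M H)) (tjump M (tr M (proj_W M E))) =
      (\<Sum>f\<in>F0 M. face_ip M {f} (avg (tr M H)) (tjump M (tr M (proj_W M E))))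
      + (\<Sum>f\<in>Fb M. face_ip M {f} (avg (tr M H)) (tjump M (tr M (proj_W M E))))"
    "face_ip M (F0 M \<union> Fb M) (tjump M (tr M E)) (avg (tr M (proj_W M H))) =
      (\<Sum>f\<in>F0 M. face_ip M {f} (tjump M (tr M E)) (avg (tr M (proj_W M H))))
      + (\<Sum>f\<in>Fb M. face_ip M {f} (tjump M (tr M E)) (avg (tr M (proj_W M H))))"
    by blast+
  have boundary: "(\<Sum>f\<in>Fb M. face_ip M {f} (avg (tr M H)) (tjump M (tr M (proj_W M E)))) =
      (\<Sum>f\<in>Fb M. face_ip M {f} (tjump M (tr M E)) (avg (tr M (proj_W M H))))"
    using Fb boundary_face_cancel(3)[OF M E H] by (intro sum.cong refl) blast
  have sum0: "face_ip M (F0 M) a b = (\<Sum>f\<in>F0 M. face_ip M {f} a b)"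
    if "\<And>f. f \<in> F0 M \<Longrightarrow> \<exists>g. face_repr M f a b g" for a b
    using face_ip_sum[OF M _ _ that] finite_faces(1) elem by blast
  let ?dE = "proj_defect M (proj_W M E)" and ?dH = "proj_defect M (proj_W M H)"
  have S: "face_ip M (F0 M) (avg (tr M H)) (\<lambda>f. tjump M (?dE f) f) = (\<Sum>f\<in>F0 M. face_ip M {f} (avg (tr M H)) (\<lambda>f. tjump M (?dE f) f))"
    "face_ip M (F0 M) (tjump M (tr M H)) (\<lambda>f. avg (?dE f) f) = (\<Sum>f\<in>F0 M. face_ip M {f} (tjump M (tr M H)) (\<lambda>f. avg (?dE f) f))"
    "face_ip M (F0 M) (avg (tr M E)) (\<lambda>f. tjump M (?dH f) f) = (\<Sum>f\<in>F0 M. face_ip M {f} (avg (tr M E)) (\<lambda>f. tjump M (?dH f) f))"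
    "face_ip M (F0 M) (tjump M (tr M E)) (\<lambda>f. avg (?dH f) f) = (\<Sum>f\<in>F0 M. face_ip M {f} (tjump M (tr M E)) (\<lambda>f. avg (?dH f) f))"
    by (rule sum0, frule F0, elim exE conjE, rule interior_face_cancel(3-6)[OF M E H], assumption+)+
  have "(\<Sum>f\<in>F0 M. face_ip M {f} (avg (tr M H)) (tjump M (tr M (proj_W M E))) - face_ip M {f} (tjump M (tr M E)) (avg (tr M (proj_W M H)))
      + 1/2 * (face_ip M {f} (avg (tr M H)) (\<lambda>f. tjump M (?dE f) f) + face_ip M {f} (tjump M (tr M H)) (\<lambda>f. avg (?dE f) f))
      - 1/2 * (face_ip M {f} (avg (tr M E)) (\<lambda>f. tjump M (?dH f) f) + face_ip M {f} (tjump M (tr M E)) (\<lambda>f. avg (?dH f) f))) = 0"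
    by (rule sum.neutral, rule ballI, drule F0, elim exE conjE, rule interior_face_cancel(7)[OF M E H])
  then show ?thesis
    unfolding S_h_def prod.case 1 boundary S by (simp only: sum_subtractf sum.distrib flip: sum_distrib_left)
qed

theorem theorem4p1:
  fixes M :: slab_mesh and \<epsilon> \<mu> :: "real^3 \<Rightarrow> real" and J g E\<^sub>h H\<^sub>h :: field
  assumes mesh: "valid_mesh M"
    and pos: "\<And>x. x \<in> Omega M \<Longrightarrow> 0 < \<epsilon> x \<and> 0 < \<mu> x"
    and const: "elementwise_constant M \<epsilon>" "elementwise_constant M \<mu>"
    and data: "source_admissible M J" "boundary_admissible M g"
    and sol: "E\<^sub>h \<in> V_h M" "H\<^sub>h \<in> V_h M"
    and eq: "\<And>v w. v \<in> W_h M \<Longrightarrow> w \<in> W_h M \<Longrightarrow>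
      C_h M \<epsilon> \<mu> (E\<^sub>h, H\<^sub>h) (v, w) + S_h M (E\<^sub>h, H\<^sub>h) (v, w) = L_form M J g (v, w)"
  shows "energy M \<epsilon> \<mu> E\<^sub>h H\<^sub>h (t_end M) - energy M \<epsilon> \<mu> E\<^sub>h H\<^sub>h (t_start M) =
    ip M J (proj_W M E\<^sub>h)
    - face_ip M (Fb M) (n_cross M g) (avg (tr M (proj_W M H\<^sub>h)))"
proof -
  have "C_h M \<epsilon> \<mu> (E\<^sub>h, H\<^sub>h) (proj_W M E\<^sub>h, proj_W M H\<^sub>h) + S_h M (E\<^sub>h, H\<^sub>h) (proj_W M E\<^sub>h, proj_W M H\<^sub>h) =
      L_form M J g (proj_W M E\<^sub>h, proj_W M H\<^sub>h)"
    using eq proj_W_rep(1)[OF mesh] sol by blast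
  then show ?thesis
    using energy_difference[OF mesh sol const] curl_terms_cancel[OF mesh sol] face_terms_cancel[OF mesh sol]
    by (simp add: C_h_def L_form_def)
qed

end
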